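(* For all integers $m,n\ge 3$ the CW sphere $E_{mn}=E(C_m\times C_n)$ is polytopal, i.e. there is a convex $4$-polytope whose face lattice is isomorphic to the face lattice of $E_{mn}$.
   Context: $C_k$ denotes a convex polygon with $k$ vertices, numbered cyclically with indices modulo $k$. For a $d$-polytope $P$, $E(P)$ is the regular CW $(d-1)$-sphere obtained from the boundary of $P$ by stellarly subdividing every facet $F$ of $P$ (adding a new vertex $v_F$) and then merging the two facets of the subdivision that share a ridge (face of dimension $d-2$) of $P$; so the facets of $E(P)$ are combinatorially bipyramids over the ridges $R=F\cap F'$ of $P$ with apices $v_F$ and $v_{F'}$. $E_{mn}$ is $E(C_m\times C_n)$, where $C_m\times C_n$ is the (simple, $4$-dimensional) product of an $m$-gon and an $n$-gon. Explicitly, with $i\in\mathbb{Z}/m$ and $j\in\mathbb{Z}/n$, the vertices of $E_{mn}$ are $v_{ij}$ (the vertices of $C_m\times C_n$), $v'_i$ (the new vertex of the facet $e_i\times C_n$, where $e_i$ is the edge of $C_m$ joining vertices $i$ and $i+1$) and $v''_j$ (the new vertex of the facet $C_m\times e_j$, where $e_j$ is the edge of $C_n$ joining vertices $j$ and $j+1$). Its facets have vertex sets $\{v_{ij},v_{i+1,j},v_{i,j+1},v_{i+1,j+1},v'_i,v''_j\}$, $\{v_{ij}: j\in\mathbb{Z}/n\}\cup\{v'_{i-1},v'_i\}$ and $\{v_{ij}: i\in\mathbb{Z}/m\}\cup\{v''_{j-1},v''_j\}$. *)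

theory Defs
  imports "HOL-Analysis.Analysis"
begin

definition convex_polygon :: "nat \<Rightarrow> (real ^ 2) set \<Rightarrow> bool" where
  "convex_polygon k C \<longleftrightarrow>
     polytope C \<and> aff_dim C = 2 \<and> card {x. x extreme_point_of C} = k"

definition ridge_of :: "'a::euclidean_space set \<Rightarrow> 'a set \<Rightarrow> bool" (infixr \<open>ridge'_of\<close> 50) where
  "R ridge_of P \<longleftrightarrow> R face_of P \<and> aff_dim R = aff_dim P - 2"

text \<open>
  The sphere E(P) is carried by the boundary of P itself: the vertex added in a facet F is a point
  v F of the relative interior of F, and cells are closed cells, given as sets of points.
\<close>

definition new_vertices :: "'a::euclidean_space set \<Rightarrow> ('a set \<Rightarrow> 'a) \<Rightarrow> bool" where
  "new_vertices P v \<longleftrightarrow> (\<forall>F. F facet_of P \<longrightarrow> v F \<in> rel_interior F)"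

text \<open>
  The nonempty cells after stellar subdivision of all facets.  The case \<open>G = {}\<close> in the second
  set yields the new vertices themselves.
\<close>

definition stellar_cells :: "('a::euclidean_space set \<Rightarrow> 'a) \<Rightarrow> 'a set \<Rightarrow> 'a set set" where
  "stellar_cells v P =
     {G. G face_of P \<and> G \<noteq> {} \<and> G \<noteq> P \<and> \<not> G facet_of P}
     \<union> {convex hull (insert (v F) G) | F G. F facet_of P \<and> G face_of F \<and> G \<noteq> F}"

text \<open>
  Merging the facets of the subdivision that contain a common ridge R of P: the ridge and these
  facets disappear as cells, and the union of these facets (a bipyramid over R) is a new cell.
\<close>

definition E_cells :: "('a::euclidean_space set \<Rightarrow> 'a) \<Rightarrow> 'a set \<Rightarrow> 'a set set" where
  "E_cells v P =
     {c \<in> stellar_cells v P. aff_dim c < aff_dim P - 1 \<and> \<not> c ridge_of P}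
     \<union> {\<Union>{c \<in> stellar_cells v P. aff_dim c = aff_dim P - 1 \<and> R \<subseteq> c} | R. R ridge_of P}"

text \<open>
  Face lattices are families of sets ordered by inclusion.  That of a CW sphere consists of its
  closed cells together with a bottom element (the empty cell) and a top element (the whole
  sphere); that of a polytope consists of all its faces, including the empty one and itself.
\<close>

definition E_face_lattice :: "('a::euclidean_space set \<Rightarrow> 'a) \<Rightarrow> 'a set \<Rightarrow> 'a set set" where
  "E_face_lattice v P = E_cells v P \<union> {{}, rel_frontier P}"

definition polytope_face_lattice :: "'a::euclidean_space set \<Rightarrow> 'a set set" where
  "polytope_face_lattice P = {F. F face_of P}"

definition lattice_isomorphic :: "'a set set \<Rightarrow> 'b set set \<Rightarrow> bool" where
  "lattice_isomorphic L M \<longleftrightarrow>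
     (\<exists>f. bij_betw f L M \<and> (\<forall>x\<in>L. \<forall>y\<in>L. x \<subseteq> y \<longleftrightarrow> f x \<subseteq> f y))"

end

theory Submission
  imports Defs
begin

text \<open>
  For each k choose a k-gon with vertices p i that is inscribed in a k-gon with vertices x i, p i
  being an inner point of the edge from x (i-1) to x i, such that the midpoint of 0 and x i is an
  inner point of the edge from p i to p (i+1).  With such polygons for m and n, the convex hull of
  the points (p i, p' j), (x i, 0) and (0, x' j) realizes E of the product: if a i = 1 and a' j = 1
  are the lines through the inner edges, then a i takes the value 2 at x i, so a i + a' j = 2 is a
  supporting hyperplane with the vertices of the bipyramid over the product of the i-th and the j-th
  edge; the other facets lie over the edges of the outer polygons.  The polygons are in general far
  from regular: from top to bottom, the distances of their vertices to 0 decrease geometrically.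
  For any polytope P the face lattice of E(P), like that of a polytope, is determined by the vertex
  sets of the facets, through their intersections, so only these have to be compared.
\<close>

section \<open>Facets and ridges of polytopes\<close>

text \<open>Concentric regular m-gons cannot be nested in this way for m >= 5: an edge has distance
  \<open>cos (pi / m)\<close> times the radius from the centre, so
  \<open>cos (pi / m) ^ 2 <= 1 / 2\<close> would follow. The distances have to be found by solving
  equations instead. After scaling the inner vertices by sqrt 2, both nesting conditions become the
  same relation between three consecutive points of a single ring of 2m points. In coordinates where
  lines are graphs of affine functions this relation is linear, and for slopes that double from
  point to point it is a recurrence with constant coefficients. Reflection supplies the other half
  of the ring. One slope remains free, and the intermediate value theorem chooses it so that the
  ring closes. On the combinatorial side the obstacle is that bipyramids are not convex, so cells
  cannot be compared as hulls of their vertices. The given polygons matter only through their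
  incidences, but for this the cyclic order of their vertices has to be derived from
  convexity.\<close>

lemma polytope_eq_hull_extreme_points:
  fixes P :: "'a::euclidean_space set"
  assumes "polytope P"
  shows "P = convex hull {x. x extreme_point_of P}"
  using Krein_Milman_Minkowski assms polytope_imp_compact polytope_imp_convex by blast

lemma finite_polytope_extreme_points:
  fixes P :: "'a::euclidean_space set"
  shows "polytope P \<Longrightarrow> finite {x. x extreme_point_of P}"
  by (simp add: finite_polyhedron_extreme_points polytope_imp_polyhedron)

lemma polytope_subset_iff_extreme_points:
  fixes F G :: "'a::euclidean_space set"
  assumes "polytope F" "convex G"
  shows "F \<subseteq> G \<longleftrightarrow> {x. x extreme_point_of F} \<subseteq> G"
proof
  assume "{x. x extreme_point_of F} \<subseteq> G"
  then show "F \<subseteq> G"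
    by (metis assms hull_minimal polytope_eq_hull_extreme_points)
qed (auto simp: extreme_point_of_def)

text \<open>The empty face is the case that needs an argument: two distinct vertices are each the
  intersection of the facets through them, so all facets together have no common point. In dimension
  0 there are no facets and the intersection would be \<open>UNIV\<close>.\<close>

lemma face_eq_Inter_facets:
  fixes P :: "'a::euclidean_space set"
  assumes P: "polytope P" and dim: "aff_dim P \<ge> 1" and G: "G face_of P" "G \<noteq> P"
  shows "G = \<Inter>{F. F facet_of P \<and> G \<subseteq> F}"
proof (cases "G = {}")
  case False
  then show ?thesis
    using G P face_of_polyhedron polytope_imp_polyhedron by blast
next
  case True
  have sub: "\<Inter>{F. F facet_of P} \<subseteq> {w}" if "w extreme_point_of P" for w
  proof -
    have "{w} \<noteq> P" using dim by auto
    moreover have "{w} face_of P" using that by (simp add: face_of_singleton)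
    ultimately have "{w} = \<Inter>{F. F facet_of P \<and> {w} \<subseteq> F}"
      using face_of_polyhedron[OF polytope_imp_polyhedron[OF P]] by blast
    then show ?thesis by blast
  qed
  have "P \<noteq> {}" using dim by auto
  then obtain w where w: "w extreme_point_of P"
    using P extreme_point_exists_convex polytope_imp_compact polytope_imp_convex by blast
  have "{x. x extreme_point_of P} \<noteq> {w}"
  proof
    assume "{x. x extreme_point_of P} = {w}"
    then have "P = {w}" using polytope_eq_hull_extreme_points[OF P] by simp
    then show False using dim by simp
  qed
  then obtain w' where "w' extreme_point_of P" "w' \<noteq> w" using w by blast
  then have "\<Inter>{F. F facet_of P} \<subseteq> {}" using sub[OF w] sub by blast
  then show ?thesis using True by auto
qed

lemma facet_subset_imp_eq:
  fixes P :: "'a::euclidean_space set"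
  assumes "F facet_of P" "F' facet_of P" "F \<subseteq> F'"
  shows "F = F'"
proof (rule ccontr)
  assume "F \<noteq> F'"
  have "F face_of F'"
    using face_of_subset[OF facet_of_imp_face_of[OF assms(1)] assms(3) facet_of_imp_subset[OF assms(2)]] .
  then have "aff_dim F < aff_dim F'"
    using \<open>F \<noteq> F'\<close> face_of_aff_dim_lt[OF face_of_imp_convex[OF facet_of_imp_face_of[OF assms(2)]]] by blast
  then show False using assms by (simp add: facet_of_def)
qed

lemma facet_ne: "F facet_of P \<Longrightarrow> F \<noteq> P"
  by auto

lemma Int_facets_eq_ridge:
  fixes P :: "'a::euclidean_space set"
  assumes P: "polytope P" and R: "R ridge_of P"
    and F: "F facet_of P" "F' facet_of P" "F \<noteq> F'" "R \<subseteq> F" "R \<subseteq> F'"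
  shows "F \<inter> F' = R"
proof -
  have FF': "F \<inter> F' face_of F" "F \<inter> F' face_of P"
    using F by (meson face_of_Int face_of_subset facet_of_imp_face_of facet_of_imp_subset inf_le1)+
  have "F \<inter> F' \<noteq> F"
  proof
    assume "F \<inter> F' = F"
    then have "F face_of F'" using F by (metis face_of_subset facet_of_def inf.cobounded2 facet_of_imp_subset)
    moreover have "convex F'" using F(2) face_of_imp_convex facet_of_imp_face_of by blast
    ultimately have "aff_dim F < aff_dim F'" using F(3) face_of_aff_dim_lt by blast
    then show False using F by (simp add: facet_of_def)
  qed
  moreover have "convex F" using F face_of_imp_convex facet_of_imp_face_of by blast
  ultimately have "aff_dim (F \<inter> F') < aff_dim F" using FF' face_of_aff_dim_lt by blast
  then have le: "aff_dim (F \<inter> F') \<le> aff_dim R" using F R by (simp add: facet_of_def ridge_of_def)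
  have "R face_of F \<inter> F'"
    using F(4,5) FF'(2) R face_of_face unfolding ridge_of_def by blast
  moreover have "convex (F \<inter> F')" using FF'(2) face_of_imp_convex by blast
  ultimately show ?thesis using le face_of_aff_dim_lt by fastforce
qed

text \<open>A ridge is an intersection of facets but not a facet, so at least two contain it. The
  affine functions on the affine hull of \<open>P\<close> that vanish on the ridge form a
  two-dimensional space, so the slack of a third facet would be a combination of the slacks of the
  first two. Its coefficients are positive, yet it would have to vanish on the third facet.\<close>

lemma ridge_in_two_facets:
  fixes P :: "'a::euclidean_space set"
  assumes P: "polytope P" and dim: "aff_dim P \<ge> 2" and R: "R ridge_of P"
  obtains F F' where "F facet_of P" "F' facet_of P" "F \<noteq> F'" "F \<inter> F' = R"
    "\<And>H. H facet_of P \<Longrightarrow> R \<subseteq> H \<Longrightarrow> H = F \<or> H = F'"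
proof -
  have "R face_of P" "R \<noteq> P" using R by (auto simp: ridge_of_def)
  then have RI: "R = \<Inter>{F. F facet_of P \<and> R \<subseteq> F}"
    using face_eq_Inter_facets[OF P] dim by force
  have ne: "R \<noteq> F" if "F facet_of P" for F
    using that R by (auto simp: ridge_of_def facet_of_def)
  have "R \<noteq> UNIV" using \<open>R face_of P\<close> \<open>R \<noteq> P\<close> face_of_imp_subset by blast
  then obtain F where F: "F facet_of P" "R \<subseteq> F" using RI by blast
  then obtain F' where F': "F' facet_of P" "R \<subseteq> F'" "F \<noteq> F'"
    using RI ne[OF F(1)] by blast
  have int: "F \<inter> F' = R" using Int_facets_eq_ridge P R F F' by metis
  have "H = F \<or> H = F'" if H: "H facet_of P" "R \<subseteq> H" for H
  proof (rule ccontr)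
    assume "\<not> (H = F \<or> H = F')"
    then have ints: "F \<inter> H = R" "F' \<inter> H = R"
      using Int_facets_eq_ridge P R F F' H by metis+
    have pt: "\<exists>x. x \<in> E - R" if "E facet_of P" "R \<subseteq> E" for E
      using that ne[OF that(1)] by blast
    obtain f where f: "f \<in> F - R" using pt F by blast
    obtain f' where f': "f' \<in> F' - R" using pt F' by blast
    obtain h where h: "h \<in> H - R" using pt H by blast
    have poly: "polyhedron P" using P polytope_imp_polyhedron by blast
    obtain a b where ab: "P \<subseteq> {x. a \<bullet> x \<le> b}" "F = P \<inter> {x. a \<bullet> x = b}"
      using facet_of_polyhedron poly F by metis
    obtain a' b' where ab': "P \<subseteq> {x. a' \<bullet> x \<le> b'}" "F' = P \<inter> {x. a' \<bullet> x = b'}"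
      using facet_of_polyhedron poly F' by metis
    obtain c d where cd: "P \<subseteq> {x. c \<bullet> x \<le> d}" "H = P \<inter> {x. c \<bullet> x = d}"
      using facet_of_polyhedron poly H by metis
    have inP: "f \<in> P" "f' \<in> P" "h \<in> P" using f f' h F F' H facet_of_imp_subset by blast+
    have "f \<notin> F'" "f \<notin> H" "f' \<notin> F" "f' \<notin> H" "h \<notin> F" "h \<notin> F'" using f f' h int ints by auto
    then have s: "a' \<bullet> f < b'" "c \<bullet> f < d" "a \<bullet> f' < b" "c \<bullet> f' < d" "a \<bullet> h < b" "a' \<bullet> h < b'"
      using ab ab' cd inP by fastforce+
    have e: "a \<bullet> f = b" "a' \<bullet> f' = b'" "c \<bullet> h = d" using f f' h ab ab' cd by auto
    \<comment> \<open>The coefficients are read off at \<open>f\<close>, where the slack of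
      \<open>F\<close> vanishes, and at \<open>f'\<close>, where the slack of \<open>F'\<close>
      vanishes.\<close>
    define \<mu> where "\<mu> = (d - c \<bullet> f) / (b' - a' \<bullet> f)"
    define \<nu> where "\<nu> = (d - c \<bullet> f') / (b - a \<bullet> f')"
    have pos: "\<mu> > 0" "\<nu> > 0" using s by (auto simp: \<mu>_def \<nu>_def)
    let ?n = "c - \<nu> *\<^sub>R a - \<mu> *\<^sub>R a'"
    let ?k = "d - \<nu> * b - \<mu> * b'"
    have "affine hull (insert f' (insert f R)) \<subseteq> {x. ?n \<bullet> x = ?k}"
    proof (rule hull_minimal)
      have "\<mu> * (b' - a' \<bullet> f) = d - c \<bullet> f" "\<nu> * (b - a \<bullet> f') = d - c \<bullet> f'"
        using s by (auto simp: \<mu>_def \<nu>_def)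
      then have "?n \<bullet> f = ?k" "?n \<bullet> f' = ?k"
        using e by (simp_all add: inner_diff_left algebra_simps)
      moreover have "?n \<bullet> x = ?k" if "x \<in> R" for x
      proof -
        have "x \<in> F" "x \<in> F'" "x \<in> H" using that int ints by auto
        then show ?thesis using ab ab' cd by (simp add: inner_diff_left)
      qed
      ultimately show "insert f' (insert f R) \<subseteq> {x. ?n \<bullet> x = ?k}" by auto
      show "affine {x. ?n \<bullet> x = ?k}" by (rule affine_hyperplane)
    qed
    moreover have "affine hull (insert f' (insert f R)) = affine hull P"
    proof (rule affine_dim_equal)
      have "f \<notin> affine hull R"
        using face_of_imp_eq_affine_Int[OF polytope_imp_convex[OF P] \<open>R face_of P\<close>]
          f inP by auto
      then have 1: "aff_dim (insert f R) = aff_dim P - 1"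
        using R by (simp add: aff_dim_insert ridge_of_def)
      have "affine hull (insert f R) \<subseteq> {x. a \<bullet> x = b}"
        by (rule hull_minimal) (use e int ab in \<open>auto simp: affine_hyperplane\<close>)
      then have "f' \<notin> affine hull (insert f R)" using s by auto
      then show "aff_dim (affine hull (insert f' (insert f R))) = aff_dim (affine hull P)"
        using 1 by (simp add: aff_dim_insert)
      show "affine hull (insert f' (insert f R)) \<subseteq> affine hull P"
        using inP face_of_imp_subset[OF \<open>R face_of P\<close>] by (intro hull_mono) auto
    qed (auto simp: affine_affine_hull)
    ultimately have "?n \<bullet> h = ?k" using inP hull_subset[of P affine] by blast
    then have "\<nu> * (b - a \<bullet> h) + \<mu> * (b' - a' \<bullet> h) = 0"
      using e by (simp add: inner_diff_left algebra_simps)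
    moreover have "\<nu> * (b - a \<bullet> h) > 0" "\<mu> * (b' - a' \<bullet> h) > 0" using pos s by auto
    ultimately show False by linarith
  qed
  then show thesis using that F F' int by blast
qed

section \<open>Face lattices from vertex-facet incidences\<close>

text \<open>Maps that preserve and reflect inclusion are injective, so two of them with the same
  image can be composed to an isomorphism. The common image will be a family of label sets.\<close>

lemma lattice_isomorphic_common_image:
  assumes f: "f ` L = K" "\<And>x y. x \<in> L \<Longrightarrow> y \<in> L \<Longrightarrow> x \<subseteq> y \<longleftrightarrow> f x \<subseteq> f y"
    and g: "g ` M = K" "\<And>x y. x \<in> M \<Longrightarrow> y \<in> M \<Longrightarrow> x \<subseteq> y \<longleftrightarrow> g x \<subseteq> g y"
  shows "lattice_isomorphic L M"
proof -
  have "inj_on f L" using f(2) by (intro inj_onI) (metis order_antisym_conv order_refl)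
  then have bf: "bij_betw f L K" using f(1) by (simp add: bij_betw_def)
  have "inj_on g M" using g(2) by (intro inj_onI) (metis order_antisym_conv order_refl)
  then have bg: "bij_betw g M K" using g(1) by (simp add: bij_betw_def)
  let ?h = "\<lambda>x. inv_into M g (f x)"
  have "bij_betw ?h L M"
    using bij_betw_trans[OF bf bij_betw_inv_into[OF bg]] by (simp add: o_def)
  moreover have "x \<subseteq> y \<longleftrightarrow> ?h x \<subseteq> ?h y" if "x \<in> L" "y \<in> L" for x y
  proof -
    have "?h x \<in> M" "?h y \<in> M" "g (?h x) = f x" "g (?h y) = f y"
      using that bf bg by (auto simp: bij_betw_def inv_into_into f_inv_into_f)
    then show ?thesis using f(2)[OF that] g(2) by metis
  qed
  ultimately show ?thesis unfolding lattice_isomorphic_def by blast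
qed

text \<open>
  Intersections of the vertex sets of facets.  Both face lattices are recovered from this family,
  so that only the vertex-facet incidences have to be compared.
\<close>

definition label_sets :: "'l set \<Rightarrow> ('i \<Rightarrow> 'l set) \<Rightarrow> 'i set \<Rightarrow> 'l set set" where
  "label_sets L W I = {{l \<in> L. \<forall>i\<in>S. l \<in> W i} | S. S \<subseteq> I}"

text \<open>By \<open>cover\<close> the inequalities describe the polytope, so every nonempty face
  is cut out by the inequalities that are tight on it, and its labels form an intersection of sets
  \<open>W i\<close>. The empty face must arise as such an intersection too, which is the hypothesis
  \<open>empty\<close>.\<close>

proposition face_lattice_label_sets:
  fixes pt :: "'l \<Rightarrow> 'a::euclidean_space" and A :: "'i \<Rightarrow> 'a"
  assumes fin: "finite L" "finite I"
    and le: "\<And>i l. i \<in> I \<Longrightarrow> l \<in> L \<Longrightarrow> A i \<bullet> pt l \<le> b i"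
    and eq: "\<And>i l. i \<in> I \<Longrightarrow> l \<in> L \<Longrightarrow> A i \<bullet> pt l = b i \<longleftrightarrow> l \<in> W i"
    and cover: "{z. \<forall>i\<in>I. A i \<bullet> z \<le> b i} \<subseteq> convex hull (pt ` L)"
    and empty: "{} \<in> label_sets L W I"
  shows "(\<lambda>F. {l\<in>L. pt l \<in> F}) ` {F. F face_of convex hull (pt ` L)} = label_sets L W I"
    and "\<And>F G. F face_of convex hull (pt ` L) \<Longrightarrow> G face_of convex hull (pt ` L) \<Longrightarrow>
           F \<subseteq> G \<longleftrightarrow> {l\<in>L. pt l \<in> F} \<subseteq> {l\<in>L. pt l \<in> G}"
proof -
  let ?Q = "convex hull (pt ` L)"
  have hull: "F = convex hull (pt ` {l\<in>L. pt l \<in> F})" if F: "F face_of ?Q" for F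
  proof -
    obtain S where S: "S \<subseteq> pt ` L" "F = convex hull S"
      using face_of_convex_hull_subset[OF finite_imp_compact[OF finite_imageI[OF fin(1)]] F] by blast
    have "S \<subseteq> pt ` {l\<in>L. pt l \<in> F}" using S hull_subset[of S convex] by auto
    then have "F \<subseteq> convex hull (pt ` {l\<in>L. pt l \<in> F})" using S hull_mono[of S] by auto
    moreover have "convex hull (pt ` {l\<in>L. pt l \<in> F}) \<subseteq> F"
      by (rule hull_minimal) (use F face_of_imp_convex in auto)
    ultimately show ?thesis by blast
  qed
  have Qeq: "?Q = {z. \<forall>i\<in>I. A i \<bullet> z \<le> b i}"
  proof
    have "{z. \<forall>i\<in>I. A i \<bullet> z \<le> b i} = (\<Inter>i\<in>I. {z. A i \<bullet> z \<le> b i})" by auto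
    then have "convex {z. \<forall>i\<in>I. A i \<bullet> z \<le> b i}"
      by (simp add: convex_INT convex_halfspace_le)
    then show "?Q \<subseteq> {z. \<forall>i\<in>I. A i \<bullet> z \<le> b i}"
      by (rule hull_minimal[rotated]) (use le in auto)
  qed (rule cover)
  show mono: "F \<subseteq> G \<longleftrightarrow> {l\<in>L. pt l \<in> F} \<subseteq> {l\<in>L. pt l \<in> G}"
    if "F face_of ?Q" "G face_of ?Q" for F G
  proof
    assume "{l\<in>L. pt l \<in> F} \<subseteq> {l\<in>L. pt l \<in> G}"
    then show "F \<subseteq> G" using hull[OF that(1)] hull[OF that(2)]
      hull_mono[OF image_mono, of "{l\<in>L. pt l \<in> F}" "{l\<in>L. pt l \<in> G}" convex pt] by simp
  qed auto
  have face: "?Q \<inter> {z. \<forall>i\<in>S. A i \<bullet> z = b i} face_of ?Q" if "S \<subseteq> I" for S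
  proof -
    have "\<Inter>((\<lambda>i. ?Q \<inter> {z. A i \<bullet> z = b i}) ` S) face_of ?Q" if "S \<noteq> {}"
    proof (rule face_of_Inter)
      fix T assume "T \<in> (\<lambda>i. ?Q \<inter> {z. A i \<bullet> z = b i}) ` S"
      then obtain i where i: "i \<in> I" "T = ?Q \<inter> {z. A i \<bullet> z = b i}" using \<open>S \<subseteq> I\<close> by auto
      show "T face_of ?Q" unfolding i(2)
        using i Qeq by (intro face_of_Int_supporting_hyperplane_le convex_convex_hull) blast
    qed (use that in auto)
    moreover have "\<Inter>((\<lambda>i. ?Q \<inter> {z. A i \<bullet> z = b i}) ` S) = ?Q \<inter> {z. \<forall>i\<in>S. A i \<bullet> z = b i}" if "S \<noteq> {}"
      using that by auto
    ultimately show ?thesis by (cases "S = {}") (auto simp: face_of_refl)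
  qed
  have lab: "{l\<in>L. pt l \<in> ?Q \<inter> {z. \<forall>i\<in>S. A i \<bullet> z = b i}} = {l\<in>L. \<forall>i\<in>S. l \<in> W i}" if "S \<subseteq> I" for S
    proof -
    have "pt l \<in> ?Q" if "l \<in> L" for l using that by (intro hull_inc) auto
    then show ?thesis using eq \<open>S \<subseteq> I\<close> by blast
  qed
  have faces: "\<exists>S\<subseteq>I. F = ?Q \<inter> {z. \<forall>i\<in>S. A i \<bullet> z = b i}" if F: "F face_of ?Q" "F \<noteq> {}" for F
  proof -
    obtain z where z: "z \<in> rel_interior F"
      using F face_of_imp_convex rel_interior_eq_empty by blast
    then have zF: "z \<in> F" using rel_interior_subset by blast
    \<comment> \<open>Constraints that are tight at one relative interior point of \<open>F\<close>
      are tight on all of \<open>F\<close>.\<close>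
    define S where "S = {i\<in>I. A i \<bullet> z = b i}"
    let ?G = "?Q \<inter> {z. \<forall>i\<in>S. A i \<bullet> z = b i}"
    have G: "?G face_of ?Q" by (rule face) (auto simp: S_def)
    have zG: "z \<in> ?G" using F zF face_of_imp_subset by (auto simp: S_def)
    have FG: "F \<subseteq> ?G"
      using subset_of_face_of[OF G] face_of_imp_subset[OF F(1)] z zG by blast
    have "?G \<subseteq> F"
    proof
      fix y assume y: "y \<in> ?G"
      \<comment> \<open>The constraints outside \<open>S\<close> are strict at \<open>z\<close>, so
        the segment from \<open>y\<close> to \<open>z\<close> can be prolonged beyond
        \<open>z\<close> within the polytope. Then \<open>z\<close> is an inner point of a segment,
        and the face property puts \<open>y\<close> into \<open>F\<close>.\<close>
      have "eventually (\<lambda>t. A i \<bullet> (z + t *\<^sub>R (z - y)) \<le> b i) (at_right 0)" if i: "i \<in> I - S" for i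
      proof -
        have "A i \<bullet> z \<le> b i" using zG i unfolding Qeq by blast
        then have less: "A i \<bullet> (z + 0 *\<^sub>R (z - y)) < b i" using i by (auto simp: S_def)
        have "((\<lambda>t. A i \<bullet> (z + t *\<^sub>R (z - y))) \<longlongrightarrow> A i \<bullet> (z + 0 *\<^sub>R (z - y))) (at_right 0)"
          by (intro tendsto_intros)
        from order_tendstoD(2)[OF this less] show ?thesis by (rule eventually_mono) simp
      qed
      then have "eventually (\<lambda>t. \<forall>i\<in>I - S. A i \<bullet> (z + t *\<^sub>R (z - y)) \<le> b i) (at_right 0)"
        using fin by (intro eventually_ball_finite) auto
      then have ev: "eventually (\<lambda>t. t > 0 \<and> (\<forall>i\<in>I - S. A i \<bullet> (z + t *\<^sub>R (z - y)) \<le> b i)) (at_right (0::real))"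
        using eventually_at_right_less by (rule eventually_conj[rotated])
      obtain t :: real where t: "t > 0" and tb: "\<And>i. i \<in> I - S \<Longrightarrow> A i \<bullet> (z + t *\<^sub>R (z - y)) \<le> b i"
        using eventually_happens'[OF trivial_limit_at_right_real ev] by blast
      define w where "w = z + t *\<^sub>R (z - y)"
      have wQ: "w \<in> ?Q"
        unfolding Qeq
      proof (intro CollectI ballI)
        fix i assume "i \<in> I"
        show "A i \<bullet> w \<le> b i"
        proof (cases "i \<in> S")
          case True
          then have "A i \<bullet> z = b i" "A i \<bullet> y = b i" using y zG by auto
          then show ?thesis by (simp add: w_def inner_right_distrib inner_diff_right)
        qed (use tb \<open>i \<in> I\<close> in \<open>auto simp: w_def\<close>)
      qed
      show "y \<in> F"
      proof (cases "y = z")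
        case False
        have "z = (1 - t / (1 + t)) *\<^sub>R w + (t / (1 + t)) *\<^sub>R y"
        proof -
          have "(1 + t) *\<^sub>R z = w + t *\<^sub>R y" by (simp add: w_def algebra_simps)
          then have "z = (1 / (1 + t)) *\<^sub>R (w + t *\<^sub>R y)"
            using t by (simp flip: \<open>(1 + t) *\<^sub>R z = w + t *\<^sub>R y\<close>)
          moreover have *: "1 - t / (1 + t) = 1 / (1 + t)" using t by (simp add: field_simps)
          ultimately show ?thesis unfolding * by (simp add: scaleR_add_right)
        qed
        moreover have "w \<noteq> y"
        proof
          assume "w = y"
          then have "(1 + t) *\<^sub>R (z - y) = 0" by (simp add: w_def algebra_simps)
          then show False using t False by simp
        qed
        moreover have "0 < t / (1 + t)" "t / (1 + t) < 1" using t by auto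
        ultimately have "z \<in> open_segment w y" unfolding in_segment by blast
        then show ?thesis using face_ofD[OF F(1)] wQ y zF by blast
      qed (use zF in auto)
    qed
    then have "F = ?G" using FG by (rule subset_antisym[rotated])
    moreover have "S \<subseteq> I" by (simp add: S_def)
    ultimately show ?thesis by (intro exI[of _ S] conjI)
  qed
  have "{l\<in>L. pt l \<in> F} \<in> label_sets L W I" if Fq: "F face_of ?Q" for F
  proof (cases "F = {}")
    case False
    then obtain S where "S \<subseteq> I" "F = ?Q \<inter> {z. \<forall>i\<in>S. A i \<bullet> z = b i}"
      using faces[OF Fq False] by blast
    then have "{l\<in>L. pt l \<in> F} = {l \<in> L. \<forall>i\<in>S. l \<in> W i}" using lab by simp
    then show ?thesis using \<open>S \<subseteq> I\<close> unfolding label_sets_def by blast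
  qed (use empty in simp)
  moreover have "K \<in> (\<lambda>F. {l\<in>L. pt l \<in> F}) ` {F. F face_of ?Q}" if K: "K \<in> label_sets L W I" for K
  proof -
    obtain S where "S \<subseteq> I" "K = {l \<in> L. \<forall>i\<in>S. l \<in> W i}" using K unfolding label_sets_def by blast
    then have "K = {l\<in>L. pt l \<in> ?Q \<inter> {z. \<forall>i\<in>S. A i \<bullet> z = b i}}" using lab by simp
    then show ?thesis using face[OF \<open>S \<subseteq> I\<close>] by (intro image_eqI) auto
  qed
  ultimately show "(\<lambda>F. {l\<in>L. pt l \<in> F}) ` {F. F face_of ?Q} = label_sets L W I" by blast
qed

section \<open>The cells of E(P)\<close>

text \<open>
  Labels stand for the vertices of E(P): the left summand for the vertices of P, the right one for
  the new vertices.  The labels of a ridge are the vertices of the bipyramid over it.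
\<close>

definition labels :: "'a::euclidean_space set \<Rightarrow> ('a + 'a set) set" where
  "labels P = Inl ` {w. w extreme_point_of P} \<union> Inr ` {F. F facet_of P}"

definition ridge_labels :: "'a::euclidean_space set \<Rightarrow> 'a set \<Rightarrow> ('a + 'a set) set" where
  "ridge_labels P R = Inl ` {w. w extreme_point_of R} \<union> Inr ` {F. F facet_of P \<and> R \<subseteq> F}"

lemma facet_of_facet_is_ridge:
  "F facet_of P \<Longrightarrow> R facet_of F \<Longrightarrow> R ridge_of P"
  unfolding facet_of_def ridge_of_def by (auto intro: face_of_trans)

locale stellar_sphere =
  fixes P :: "'a::euclidean_space set" and v :: "'a set \<Rightarrow> 'a"
  assumes P: "polytope P" and dim: "aff_dim P \<ge> 3" and v: "new_vertices P v"
begin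

abbreviation "d \<equiv> aff_dim P"

definition cone :: "'a set \<Rightarrow> 'a set \<Rightarrow> 'a set" where
  "cone F G = convex hull (insert (v F) G)"

definition bipyramid :: "'a set \<Rightarrow> 'a set" where
  "bipyramid R = \<Union>{cone F R | F. F facet_of P \<and> R \<subseteq> F}"

text \<open>Based on membership and not on extreme points of the cell, because bipyramids and the
  whole sphere are not convex.\<close>

definition labels_in :: "'a set \<Rightarrow> ('a + 'a set) set" where
  "labels_in c = Inl ` {w. w extreme_point_of P \<and> w \<in> c} \<union> Inr ` {F. F facet_of P \<and> v F \<in> c}"

definition small_faces :: "'a set set" where
  "small_faces = {G. G face_of P \<and> aff_dim G \<le> d - 3}"

text \<open>The case \<open>G = {}\<close> gives the new vertex itself. Cones over ridges are left
  out because they are merged into bipyramids.\<close>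

definition small_cones :: "'a set set" where
  "small_cones = {cone F G | F G. F facet_of P \<and> G face_of F \<and> aff_dim G \<le> d - 3}"

definition ridges :: "'a set set" where
  "ridges = {R. R ridge_of P}"

lemma facet_poly: "F facet_of P \<Longrightarrow> polytope F"
  using P face_of_polytope_polytope facet_of_imp_face_of by blast

lemma face_poly: "F face_of P \<Longrightarrow> polytope F"
  using P face_of_polytope_polytope by blast

lemma facet_dim: "F facet_of P \<Longrightarrow> aff_dim F = d - 1"
  by (simp add: facet_of_def)

lemma ridge_face: "R ridge_of P \<Longrightarrow> R face_of P"
  by (simp add: ridge_of_def)

lemma ridge_dim: "R ridge_of P \<Longrightarrow> aff_dim R = d - 2"
  by (simp add: ridge_of_def)

lemma vF: "F facet_of P \<Longrightarrow> v F \<in> rel_interior F"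
  using v by (simp add: new_vertices_def)

lemma vF_in: "F facet_of P \<Longrightarrow> v F \<in> F"
  using vF rel_interior_subset by blast

lemma facet_subset_face: "F facet_of P \<Longrightarrow> G face_of P \<Longrightarrow> v F \<in> G \<Longrightarrow> F \<subseteq> G"
  using subset_of_face_of[of G P F] vF facet_of_imp_subset by blast

lemma vF_in_facet: "F facet_of P \<Longrightarrow> F' facet_of P \<Longrightarrow> v F \<in> F' \<Longrightarrow> F = F'"
  using facet_subset_face facet_subset_imp_eq facet_of_imp_face_of by metis

lemma vF_not_extreme:
  assumes "F facet_of P" shows "\<not> v F extreme_point_of P"
proof
  assume "v F extreme_point_of P"
  then have "F \<subseteq> {v F}" using facet_subset_face[OF assms, of "{v F}"] by (simp add: face_of_singleton)
  then have "aff_dim F \<le> 0" using aff_dim_subset[of F "{v F}"] by simp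
  then show False using facet_dim[OF assms] dim by simp
qed

lemma cone_subset_facet:
  assumes "F facet_of P" "G \<subseteq> F" shows "cone F G \<subseteq> F"
  unfolding cone_def
  by (rule hull_minimal) (use assms vF_in facet_poly polytope_imp_convex in auto)

lemma vF_in_cone: "v F \<in> cone F G"
  unfolding cone_def by (simp add: hull_inc)

lemma subset_cone: "G \<subseteq> cone F G"
  unfolding cone_def by (meson hull_subset insert_subset order_trans subset_insertI)

lemma cone_mono: "G \<subseteq> G' \<Longrightarrow> cone F G \<subseteq> cone F G'"
  unfolding cone_def by (intro hull_mono) auto

lemma convex_cone: "convex (cone F G)"
  by (simp add: cone_def)

text \<open>A vertex of \<open>P\<close> lying in the cone is a vertex of the cone and thus one of
  its generators, but it is not \<open>v F\<close>.\<close>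

lemma extreme_in_cone:
  assumes F: "F facet_of P" and G: "G \<subseteq> F" and w: "w extreme_point_of P" "w \<in> cone F G"
  shows "w \<in> G"
proof -
  have "cone F G \<subseteq> P" using cone_subset_facet[OF F G] F facet_of_imp_subset by blast
  then have "w extreme_point_of cone F G" using w unfolding extreme_point_of_def by blast
  then have "w \<in> insert (v F) G" unfolding cone_def by (rule extreme_point_of_convex_hull)
  then show ?thesis using vF_not_extreme F w by blast
qed

lemma labels_in_small_face:
  assumes "G face_of P" "aff_dim G < d - 1"
  shows "labels_in G = Inl ` {w. w extreme_point_of G}"
proof -
  have "\<not> (F facet_of P \<and> v F \<in> G)" for F
  proof
    assume F: "F facet_of P \<and> v F \<in> G"
    then have "aff_dim F \<le> aff_dim G" using facet_subset_face[OF _ assms(1)] aff_dim_subset by blast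
    then show False using facet_dim[of F] F assms(2) by linarith
  qed
  then show ?thesis using extreme_point_of_face[OF assms(1)] by (auto simp: labels_in_def)
qed

lemma labels_in_cone:
  assumes F: "F facet_of P" and G: "G face_of F"
  shows "labels_in (cone F G) = insert (Inr F) (Inl ` {w. w extreme_point_of G})"
proof -
  have GF: "G \<subseteq> F" and GP: "G face_of P"
    using face_of_imp_subset[OF G] face_of_trans[OF G facet_of_imp_face_of[OF F]] .
  have "w extreme_point_of P \<and> w \<in> cone F G \<longleftrightarrow> w extreme_point_of G" for w
    using extreme_in_cone[OF F GF] subset_cone extreme_point_of_face[OF GP] by blast
  moreover have "F' facet_of P \<and> v F' \<in> cone F G \<longleftrightarrow> F' = F" for F'
    using vF_in_facet[of F' F] cone_subset_facet[OF F GF] vF_in_cone F by blast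
  ultimately show ?thesis by (auto simp: labels_in_def)
qed

lemma ridge_face_facet: "R ridge_of P \<Longrightarrow> F facet_of P \<Longrightarrow> R \<subseteq> F \<Longrightarrow> R face_of F"
  using face_of_subset[OF ridge_face _ facet_of_imp_subset] .

lemma two_facets:
  assumes "R ridge_of P"
  obtains F F' where "F facet_of P" "F' facet_of P" "F \<noteq> F'" "F \<inter> F' = R"
    "\<And>H. H facet_of P \<Longrightarrow> R \<subseteq> H \<Longrightarrow> H = F \<or> H = F'"
proof -
  have "d \<ge> 2" using dim by simp
  then show thesis using ridge_in_two_facets[OF P _ assms] that by blast
qed

lemma labels_in_Un: "labels_in (\<Union>\<C>) = \<Union>(labels_in ` \<C>)"
  by (auto simp: labels_in_def)

lemma labels_in_bipyramid:
  assumes R: "R ridge_of P"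
  shows "labels_in (bipyramid R) = ridge_labels P R"
proof -
  let ?\<F> = "{F. F facet_of P \<and> R \<subseteq> F}"
  have "bipyramid R = \<Union>((\<lambda>F. cone F R) ` ?\<F>)" unfolding bipyramid_def by blast
  then have "labels_in (bipyramid R) = (\<Union>F\<in>?\<F>. labels_in (cone F R))"
    by (simp add: labels_in_Un image_image)
  also have "\<dots> = (\<Union>F\<in>?\<F>. insert (Inr F) (Inl ` {w. w extreme_point_of R}))"
    by (intro SUP_cong refl labels_in_cone ridge_face_facet[OF R]) auto
  also have "\<dots> = ridge_labels P R"
  proof -
    obtain F where "F facet_of P" "R \<subseteq> F" using two_facets[OF R] by blast
    then show ?thesis unfolding ridge_labels_def by blast
  qed
  finally show ?thesis .
qed

lemma labels_in_frontier: "labels_in (rel_frontier P) = labels P"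
proof -
  have "F \<subseteq> rel_frontier P" if "F facet_of P" for F
    using face_of_subset_rel_frontier[OF facet_of_imp_face_of[OF that] facet_ne[OF that]] .
  moreover have "w \<in> rel_frontier P" if "w extreme_point_of P" for w
  proof -
    have "{w} \<noteq> P" using dim by auto
    then show ?thesis
      using face_of_subset_rel_frontier[of "{w}" P] that by (simp add: face_of_singleton)
  qed
  ultimately show ?thesis using vF_in unfolding labels_in_def labels_def by blast
qed

lemma aff_dim_cone:
  assumes F: "F facet_of P" and G: "G face_of F" "G \<noteq> F"
  shows "aff_dim (cone F G) = aff_dim G + 1"
proof -
  have "convex F" using F facet_poly polytope_imp_convex by blast
  then have "v F \<notin> affine hull G"
    using affine_hull_face_of_disjoint_rel_interior[of F G] G vF[OF F] by blast
  then show ?thesis by (simp add: cone_def aff_dim_insert aff_dim_convex_hull)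
qed

lemma face_of_facet: "F facet_of P \<Longrightarrow> G face_of F \<Longrightarrow> G face_of P"
  by (rule face_of_trans[OF _ facet_of_imp_face_of])

lemma stellar_cells_eq:
  "stellar_cells v P = {G. G face_of P \<and> G \<noteq> {} \<and> G \<noteq> P \<and> \<not> G facet_of P}
     \<union> {cone F G | F G. F facet_of P \<and> G face_of F \<and> G \<noteq> F}"
  by (simp add: stellar_cells_def cone_def)

text \<open>A cell of top dimension is a cone over a ridge \<open>G\<close>. If it contains
  \<open>R\<close>, then the vertices of \<open>R\<close>, being vertices of \<open>P\<close>, lie
  in \<open>G\<close>; so \<open>R\<close> is contained in \<open>G\<close>, and equal dimensions
  give \<open>R = G\<close>.\<close>

lemma merged_cells:
  assumes R: "R ridge_of P"
  shows "{c \<in> stellar_cells v P. aff_dim c = d - 1 \<and> R \<subseteq> c} = {cone F R | F. F facet_of P \<and> R \<subseteq> F}"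
proof (intro subset_antisym subsetI)
  fix c assume c: "c \<in> {c \<in> stellar_cells v P. aff_dim c = d - 1 \<and> R \<subseteq> c}"
  then obtain F G where FG: "c = cone F G" "F facet_of P" "G face_of F" "G \<noteq> F"
    unfolding stellar_cells_eq facet_of_def by blast
  have GP: "G face_of P" using face_of_facet[OF FG(2,3)] .
  have "aff_dim G = d - 2" using c aff_dim_cone[OF FG(2-4)] FG(1) by auto
  have "{w. w extreme_point_of R} \<subseteq> G"
  proof
    fix w assume "w \<in> {w. w extreme_point_of R}"
    then have "w extreme_point_of P" "w \<in> cone F G"
      using extreme_point_of_face[OF ridge_face[OF R]] c FG(1) by blast+
    then show "w \<in> G" using extreme_in_cone[OF FG(2) face_of_imp_subset[OF FG(3)]] by blast
  qed
  then have "R \<subseteq> G"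
    using polytope_subset_iff_extreme_points[OF face_poly[OF ridge_face[OF R]] face_of_imp_convex[OF GP]] by simp
  moreover have "R face_of G" using \<open>R \<subseteq> G\<close> face_of_face[OF GP] ridge_face[OF R] by simp
  ultimately have "R = G"
    using face_of_aff_dim_lt[OF face_of_imp_convex[OF GP]] ridge_dim[OF R] \<open>aff_dim G = d - 2\<close> by fastforce
  then show "c \<in> {cone F R | F. F facet_of P \<and> R \<subseteq> F}"
    using FG face_of_imp_subset by blast
next
  fix c assume "c \<in> {cone F R | F. F facet_of P \<and> R \<subseteq> F}"
  then obtain F where F: "c = cone F R" "F facet_of P" "R \<subseteq> F" by blast
  have RF: "R face_of F" "R \<noteq> F"
    using ridge_face_facet[OF R F(2,3)] ridge_dim[OF R] facet_dim[OF F(2)] by auto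
  then have "c \<in> stellar_cells v P" using F unfolding stellar_cells_eq by blast
  moreover have "aff_dim c = d - 1" using aff_dim_cone[OF F(2) RF] F(1) ridge_dim[OF R] by simp
  ultimately show "c \<in> {c \<in> stellar_cells v P. aff_dim c = d - 1 \<and> R \<subseteq> c}"
    using F subset_cone by blast
qed

text \<open>The bottom element is absorbed into \<open>small_faces\<close> as the empty face, and
  the bound \<open>d - 3\<close> removes exactly the ridges and the cones over them from the stellar
  cells.\<close>

lemma E_face_lattice_eq:
  "E_face_lattice v P = small_faces \<union> small_cones \<union> bipyramid ` ridges \<union> {rel_frontier P}"
proof -
  have small: "insert {} {c \<in> stellar_cells v P. aff_dim c < d - 1 \<and> \<not> c ridge_of P} = small_faces \<union> small_cones"
    (is "?l = ?r")
  proof (intro subset_antisym subsetI)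
    fix c assume "c \<in> ?l"
    then consider "c = {}" | "c \<in> stellar_cells v P" "aff_dim c < d - 1" "\<not> c ridge_of P" by blast
    then show "c \<in> ?r"
    proof cases
      case 1
      then show ?thesis using dim by (simp add: small_faces_def)
    next
      case 2
      then consider "c face_of P" | F G where "c = cone F G" "F facet_of P" "G face_of F" "G \<noteq> F"
        unfolding stellar_cells_eq by blast
      then show ?thesis
      proof cases
        case 1
        then have "aff_dim c \<noteq> d - 2" using 2 by (simp add: ridge_of_def)
        then show ?thesis using 1 2 by (simp add: small_faces_def)
      next
        case (2 F G)
        then have "aff_dim G \<le> d - 3" using aff_dim_cone[OF 2(2-4), folded 2(1)] \<open>aff_dim c < d - 1\<close> by linarith
        then show ?thesis using 2 unfolding small_cones_def by blast
      qed
    qed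
  next
    fix c assume "c \<in> ?r"
    then consider "c \<in> small_faces" | "c \<in> small_cones" by blast
    then show "c \<in> ?l"
    proof cases
      case 1
      then have c: "c face_of P" "aff_dim c \<le> d - 3" by (auto simp: small_faces_def)
      then have "c \<noteq> P" "\<not> c facet_of P" "\<not> c ridge_of P" by (auto simp: facet_of_def ridge_of_def)
      then show ?thesis using c unfolding stellar_cells_eq by (cases "c = {}") auto
    next
      case 2
      then obtain F G where FG: "c = cone F G" "F facet_of P" "G face_of F" "aff_dim G \<le> d - 3"
        unfolding small_cones_def by blast
      then have ne: "G \<noteq> F" using facet_dim[OF FG(2)] by auto
      have "\<not> c ridge_of P"
      proof
        assume c: "c ridge_of P"
        then have "F \<subseteq> c" using facet_subset_face[OF FG(2) ridge_face[OF c]] FG(1) vF_in_cone by simp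
        then show False using aff_dim_subset[of F c] facet_dim[OF FG(2)] ridge_dim[OF c] by simp
      qed
      then show ?thesis using FG ne aff_dim_cone[OF FG(2,3) ne, folded FG(1)] unfolding stellar_cells_eq by auto
    qed
  qed
  have big: "{\<Union>{c \<in> stellar_cells v P. aff_dim c = d - 1 \<and> R \<subseteq> c} | R. R ridge_of P} = bipyramid ` ridges"
  proof -
    have "{\<Union>{c \<in> stellar_cells v P. aff_dim c = d - 1 \<and> R \<subseteq> c} | R. R ridge_of P}
      = (\<lambda>R. \<Union>{c \<in> stellar_cells v P. aff_dim c = d - 1 \<and> R \<subseteq> c}) ` ridges"
      unfolding ridges_def by blast
    also have "\<dots> = bipyramid ` ridges"
      by (rule image_cong) (simp_all add: merged_cells bipyramid_def ridges_def)
    finally show ?thesis .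
  qed
  have comb: "X \<union> B \<union> {{}, r} = Y \<union> B' \<union> {r}"
    if "insert {} X = Y" "B = B'" for X Y B B' :: "'a set set" and r
    using that by blast
  show ?thesis unfolding E_face_lattice_def E_cells_def by (rule comb[OF small big])
qed

lemma small_face_subset_frontier: "G face_of P \<Longrightarrow> G \<noteq> P \<Longrightarrow> G \<subseteq> rel_frontier P"
  using face_of_subset_rel_frontier by blast

lemma cone_subset_frontier: "F facet_of P \<Longrightarrow> G face_of F \<Longrightarrow> cone F G \<subseteq> rel_frontier P"
  using cone_subset_facet[of F G] face_of_imp_subset[of G F]
    small_face_subset_frontier[OF facet_of_imp_face_of facet_ne, of F] by blast

lemma hull_faces_subset:
  assumes "G face_of P" "G' face_of P" "{w. w extreme_point_of G} \<subseteq> {w. w extreme_point_of G'}"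
  shows "G \<subseteq> G'"
  using polytope_subset_iff_extreme_points[OF face_poly[OF assms(1)] face_of_imp_convex[OF assms(2)]] assms(3)
  unfolding extreme_point_of_def by blast

lemma cone_subset_bipyramid: "F facet_of P \<Longrightarrow> R \<subseteq> F \<Longrightarrow> cone F R \<subseteq> bipyramid R"
  unfolding bipyramid_def by blast

lemma ridge_subset_bipyramid:
  assumes "R ridge_of P" shows "R \<subseteq> bipyramid R"
proof -
  obtain F where F: "F facet_of P" "R \<subseteq> F" using two_facets[OF assms] by blast
  show ?thesis using subset_trans[OF subset_cone cone_subset_bipyramid[OF F]] .
qed

lemma bipyramid_subset_frontier:
  assumes "R ridge_of P" shows "bipyramid R \<subseteq> rel_frontier P"
proof -
  have "cone F R \<subseteq> rel_frontier P" if "F facet_of P" "R \<subseteq> F" for F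
    using cone_subset_frontier[OF that(1) ridge_face_facet[OF assms that]] .
  then show ?thesis unfolding bipyramid_def by blast
qed

text \<open>The face \<open>G\<close> is the cell itself, the base of the cone or the ridge of the
  bipyramid. It reduces inclusions of cells to inclusions of faces of \<open>P\<close>, which are
  decided by vertices.\<close>

lemma labels_in_proper_cell:
  assumes "c \<in> small_faces \<union> small_cones \<union> bipyramid ` ridges"
  obtains G where "G face_of P" "G \<noteq> P" "{w. Inl w \<in> labels_in c} = {w. w extreme_point_of G}"
    "G \<subseteq> c" "c \<subseteq> rel_frontier P"
proof -
  consider "c \<in> small_faces" | "c \<in> small_cones" | "c \<in> bipyramid ` ridges" using assms by blast
  then show thesis
  proof cases
    case 1
    then have c: "c face_of P" "aff_dim c \<le> d - 3" by (auto simp: small_faces_def)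
    then have "labels_in c = Inl ` {w. w extreme_point_of c}" "c \<noteq> P"
      using labels_in_small_face[OF c(1)] by auto
    then show thesis using that[OF c(1)] small_face_subset_frontier[OF c(1)] by auto
  next
    case 2
    then obtain F G where FG: "c = cone F G" "F facet_of P" "G face_of F" "aff_dim G \<le> d - 3"
      unfolding small_cones_def by blast
    then have "G face_of P" "G \<noteq> P" using face_of_facet[OF FG(2,3)] by auto
    moreover have "{w. Inl w \<in> labels_in c} = {w. w extreme_point_of G}"
      using labels_in_cone[OF FG(2,3)] FG(1) by auto
    ultimately show thesis
      using that subset_cone cone_subset_frontier[OF FG(2,3)] FG(1) by simp
  next
    case 3
    then obtain R where R: "c = bipyramid R" "R ridge_of P" unfolding ridges_def by blast
    then have "R \<noteq> P" by (auto simp: ridge_of_def)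
    moreover have "{w. Inl w \<in> labels_in c} = {w. w extreme_point_of R}"
      using labels_in_bipyramid[OF R(2)] R(1) by (auto simp: ridge_labels_def)
    ultimately show thesis
      using that[OF ridge_face[OF R(2)]] ridge_subset_bipyramid[OF R(2)] bipyramid_subset_frontier[OF R(2)] R(1)
      by simp
  qed
qed

text \<open>As a bipyramid is not convex, a hull argument must take place in one of its halves. For
  a cone, the label of the apex shows that the ridge lies in the facet \<open>F\<close>, and this
  selects the half inside \<open>F\<close>.\<close>

lemma bipyramid_contains_small_cells:
  assumes c: "c \<in> small_faces \<union> small_cones" and R: "R \<in> ridges"
    and sub: "labels_in c \<subseteq> labels_in (bipyramid R)"
  shows "c \<subseteq> bipyramid R"
proof -
  have R': "R ridge_of P" using R by (simp add: ridges_def)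
  have lab: "labels_in (bipyramid R) = ridge_labels P R" by (rule labels_in_bipyramid[OF R'])
  consider "c \<in> small_faces" | "c \<in> small_cones" using c by blast
  then show ?thesis
  proof cases
    case 1
    then have c: "c face_of P" "aff_dim c \<le> d - 3" by (auto simp: small_faces_def)
    then have "labels_in c = Inl ` {w. w extreme_point_of c}" using labels_in_small_face[OF c(1)] by auto
    then have "{w. w extreme_point_of c} \<subseteq> {w. w extreme_point_of R}"
      using sub lab by (auto simp: ridge_labels_def)
    then have "c \<subseteq> R" using hull_faces_subset[OF c(1) ridge_face[OF R']] by simp
    then show ?thesis using ridge_subset_bipyramid[OF R'] by blast
  next
    case 2
    then obtain F G where FG: "c = cone F G" "F facet_of P" "G face_of F"
      unfolding small_cones_def by blast
    then have "labels_in c = insert (Inr F) (Inl ` {w. w extreme_point_of G})"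
      using labels_in_cone by blast
    then have "R \<subseteq> F" "{w. w extreme_point_of G} \<subseteq> {w. w extreme_point_of R}"
      using sub lab by (auto simp: ridge_labels_def)
    then have "cone F G \<subseteq> cone F R"
      using hull_faces_subset[OF face_of_facet[OF FG(2,3)] ridge_face[OF R']] cone_mono by simp
    then show ?thesis using FG cone_subset_bipyramid[OF FG(2) \<open>R \<subseteq> F\<close>] by simp
  qed
qed

text \<open>For convex \<open>c'\<close> and a small cell \<open>c\<close>, hulls suffice. In the
  other cases: a proper cell contains only the vertices of a proper face of \<open>P\<close>, hence
  not those of the whole sphere; a bipyramid has two new vertices, a small cell at most one; and
  nested ridges are equal, as their dimensions agree.\<close>

lemma labels_in_mono_iff:
  assumes c: "c \<in> E_face_lattice v P" and c': "c' \<in> E_face_lattice v P"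
  shows "c \<subseteq> c' \<longleftrightarrow> labels_in c \<subseteq> labels_in c'"
proof
  show "c \<subseteq> c' \<Longrightarrow> labels_in c \<subseteq> labels_in c'" by (auto simp: labels_in_def)
next
  assume sub: "labels_in c \<subseteq> labels_in c'"
  consider "c' = rel_frontier P" | "c' \<in> small_faces \<union> small_cones \<union> bipyramid ` ridges" "c = rel_frontier P"
    | "c' \<in> small_faces \<union> small_cones \<union> bipyramid ` ridges" "c \<in> small_faces \<union> small_cones"
    | "c' \<in> small_faces \<union> small_cones" "c \<in> bipyramid ` ridges"
    | "c' \<in> bipyramid ` ridges" "c \<in> bipyramid ` ridges"
    using c c' unfolding E_face_lattice_eq by blast
  then show "c \<subseteq> c'"
  proof cases
    case 1
    show ?thesis
    proof (cases "c = rel_frontier P")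
      case False
      then have c: "c \<in> small_faces \<union> small_cones \<union> bipyramid ` ridges"
        using c unfolding E_face_lattice_eq by blast
      obtain G where G: "G face_of P" "G \<noteq> P" "{w. Inl w \<in> labels_in c} = {w. w extreme_point_of G}"
          "G \<subseteq> c" "c \<subseteq> rel_frontier P"
        by (rule labels_in_proper_cell[OF c])
      show ?thesis using G(5) 1 by simp
    qed (simp add: 1)
  next
    case 2
    obtain G where G: "G face_of P" "G \<noteq> P" "{w. Inl w \<in> labels_in c'} = {w. w extreme_point_of G}"
          "G \<subseteq> c'" "c' \<subseteq> rel_frontier P"
        by (rule labels_in_proper_cell[OF 2(1)])
    have "{w. w extreme_point_of P} \<subseteq> {w. w extreme_point_of G}"
      using sub 2(2) G(3) labels_in_frontier by (auto simp: labels_def)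
    then have "P \<subseteq> G"
      using hull_faces_subset[OF face_of_refl[OF polytope_imp_convex[OF P]] G(1)] by simp
    then show ?thesis using G(2) face_of_imp_subset[OF G(1)] by blast
  next
    case 3
    show ?thesis
    proof (cases "c' \<in> bipyramid ` ridges")
      case True
      then show ?thesis using bipyramid_contains_small_cells[OF 3(2)] sub by blast
    next
      case False
      then have c': "c' \<in> small_faces \<union> small_cones" using 3 by blast
      then have conv': "convex c'"
        using convex_cone face_of_imp_convex by (auto simp: small_faces_def small_cones_def)
      have c3: "c \<in> small_faces \<union> small_cones \<union> bipyramid ` ridges" using 3 by blast
      have c4: "c' \<in> small_faces \<union> small_cones \<union> bipyramid ` ridges" using 3 by blast
      obtain G where G: "G face_of P" "G \<noteq> P" "{w. Inl w \<in> labels_in c} = {w. w extreme_point_of G}"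
          "G \<subseteq> c" "c \<subseteq> rel_frontier P"
        by (rule labels_in_proper_cell[OF c3])
      obtain G' where G': "G' face_of P" "G' \<noteq> P" "{w. Inl w \<in> labels_in c'} = {w. w extreme_point_of G'}"
          "G' \<subseteq> c'" "c' \<subseteq> rel_frontier P"
        by (rule labels_in_proper_cell[OF c4])
      have "G \<subseteq> G'" using hull_faces_subset[OF G(1) G'(1)] sub G(3) G'(3) by blast
      then have "G \<subseteq> c'" using G'(4) by blast
      consider "c \<in> small_faces" | "c \<in> small_cones" using 3 by blast
      then show ?thesis
      proof cases
        case 1
        then have c: "c face_of P" "aff_dim c \<le> d - 3" by (auto simp: small_faces_def)
        then have "labels_in c = Inl ` {w. w extreme_point_of c}" using labels_in_small_face[OF c(1)] by auto
        then have "{w. w extreme_point_of c} \<subseteq> {w. w extreme_point_of G}" using G(3) by auto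
        then show ?thesis using hull_faces_subset[OF c(1) G(1)] \<open>G \<subseteq> c'\<close> by blast
      next
        case 2
        then obtain F H where FH: "c = cone F H" "F facet_of P" "H face_of F"
          unfolding small_cones_def by blast
        then have lab: "labels_in c = insert (Inr F) (Inl ` {w. w extreme_point_of H})"
          using labels_in_cone by blast
        then have "{w. w extreme_point_of H} \<subseteq> {w. w extreme_point_of G}" using G(3) by auto
        then have "H \<subseteq> c'"
          using hull_faces_subset[OF face_of_facet[OF FH(2,3)] G(1)] \<open>G \<subseteq> c'\<close> by simp
        moreover have "v F \<in> c'" using lab sub by (auto simp: labels_in_def)
        ultimately show ?thesis using conv' FH(1) unfolding cone_def by (simp add: hull_minimal)
      qed
    qed
  next
    case 4
    then obtain R where R: "c = bipyramid R" "R ridge_of P" unfolding ridges_def by blast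
    obtain F F' where F: "F facet_of P" "F' facet_of P" "F \<noteq> F'" "F \<inter> F' = R"
    proof (rule two_facets[OF R(2)])
      fix F F' assume "F facet_of P" "F' facet_of P" "F \<noteq> F'" "F \<inter> F' = R"
      then show thesis by (rule that)
    qed
    then have "Inr F \<in> labels_in c'" "Inr F' \<in> labels_in c'"
      using sub labels_in_bipyramid[OF R(2)] R(1) by (auto simp: ridge_labels_def)
    moreover have "\<exists>H. \<forall>F. Inr F \<in> labels_in c' \<longrightarrow> F = H"
    proof -
      consider "c' \<in> small_faces" | "c' \<in> small_cones" using 4 by blast
      then show ?thesis
      proof cases
        case 1
        then have "labels_in c' = Inl ` {w. w extreme_point_of c'}"
          using labels_in_small_face[of c'] by (simp add: small_faces_def)
        then show ?thesis by auto
      next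
        case 2
        then obtain F G where FG: "c' = cone F G" "F facet_of P" "G face_of F"
          unfolding small_cones_def by blast
        then show ?thesis using labels_in_cone[OF FG(2,3)] by auto
      qed
    qed
    ultimately show ?thesis using F(3) by blast
  next
    case 5
    then obtain R R' where R: "c = bipyramid R" "R ridge_of P" "c' = bipyramid R'" "R' ridge_of P"
      unfolding ridges_def by blast
    then have "{w. w extreme_point_of R} \<subseteq> {w. w extreme_point_of R'}"
      using sub labels_in_bipyramid[OF R(2)] labels_in_bipyramid[OF R(4)] unfolding R(1,3)
      by (auto simp: ridge_labels_def)
    then have "R \<subseteq> R'" using hull_faces_subset[OF ridge_face[OF R(2)] ridge_face[OF R(4)]] by simp
    then have "R face_of R'" using face_of_face[OF ridge_face[OF R(4)]] ridge_face[OF R(2)] by simp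
    then have "R = R'"
      using face_of_aff_dim_lt[OF face_of_imp_convex[OF ridge_face[OF R(4)]], of R] ridge_dim[OF R(2)] ridge_dim[OF R(4)] by fastforce
    then show ?thesis using R by simp
  qed
qed

end

section \<open>Cells as intersections of bipyramids\<close>

context stellar_sphere
begin

lemma finite_labels: "finite (labels P)" "finite ridges"
proof -
  show "finite (labels P)"
    unfolding labels_def
    using finite_polytope_extreme_points[OF P] finite_polytope_facets[OF P] by simp
  have "ridges \<subseteq> {F. F face_of P}" unfolding ridges_def ridge_of_def by blast
  then show "finite ridges" using finite_polytope_faces[OF P] finite_subset by blast
qed

lemma common_labels:
  assumes S: "S \<subseteq> ridges" "S \<noteq> {}"
  shows "\<Inter>S face_of P"
    and "{l \<in> labels P. \<forall>R\<in>S. l \<in> ridge_labels P R}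
       = Inl ` {w. w extreme_point_of \<Inter>S} \<union> Inr ` {F. F facet_of P \<and> (\<forall>R\<in>S. R \<subseteq> F)}"
proof -
  have rf: "R face_of P" if "R \<in> S" for R
    using S that ridge_face unfolding ridges_def by blast
  show fS: "\<Inter>S face_of P" by (rule face_of_Inter[OF S(2) rf])
  have 1: "w extreme_point_of P \<and> (\<forall>R\<in>S. w extreme_point_of R) \<longleftrightarrow> w extreme_point_of \<Inter>S" for w
    using extreme_point_of_face[OF fS, of w] extreme_point_of_face[OF rf, of _ w] S(2) by blast
  have "{l \<in> labels P. \<forall>R\<in>S. l \<in> ridge_labels P R}
      = Inl ` {w. w extreme_point_of P \<and> (\<forall>R\<in>S. w extreme_point_of R)}
        \<union> Inr ` {F. F facet_of P \<and> (\<forall>R\<in>S. R \<subseteq> F)}"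
    using S(2) by (auto simp: labels_def ridge_labels_def)
  then show "{l \<in> labels P. \<forall>R\<in>S. l \<in> ridge_labels P R}
       = Inl ` {w. w extreme_point_of \<Inter>S} \<union> Inr ` {F. F facet_of P \<and> (\<forall>R\<in>S. R \<subseteq> F)}"
    unfolding 1 .
qed

text \<open>Two facets through a common ridge meet exactly in it, so they cannot share a second one.
  Hence different bipyramids have at most one new vertex in common.\<close>

lemma facet_through_two_ridges_unique:
  assumes R: "R ridge_of P" "R' ridge_of P" "R \<noteq> R'"
    and F: "F facet_of P" "R \<subseteq> F" "R' \<subseteq> F" and H: "H facet_of P" "R \<subseteq> H" "R' \<subseteq> H"
  shows "F = H"
proof (rule ccontr)
  assume "F \<noteq> H"
  then have "F \<inter> H = R" "F \<inter> H = R'"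
    using Int_facets_eq_ridge[OF P R(1) F(1) H(1)] Int_facets_eq_ridge[OF P R(2) F(1) H(1)] F H by auto
  then show False using R by simp
qed

text \<open>No ridge gives the sphere and one ridge its bipyramid. Several ridges meet in a face of
  dimension at most \<open>d - 3\<close>; if some facet contains them all, it is unique and the
  common labels are those of the cone over this face, otherwise those of the face itself.\<close>

lemma common_labels_are_cells:
  assumes S: "S \<subseteq> ridges"
  shows "{l \<in> labels P. \<forall>R\<in>S. l \<in> ridge_labels P R} \<in> labels_in ` E_face_lattice v P"
proof -
  consider "S = {}" | R where "S = {R}" | R R' where "R \<in> S" "R' \<in> S" "R \<noteq> R'" by blast
  then show ?thesis
  proof cases
    case 1
    then have "{l \<in> labels P. \<forall>R\<in>S. l \<in> ridge_labels P R} = labels_in (rel_frontier P)"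
      using labels_in_frontier by simp
    then show ?thesis unfolding E_face_lattice_eq by blast
  next
    case (2 R)
    then have R: "R \<in> ridges" "R ridge_of P" using S by (auto simp: ridges_def)
    have "ridge_labels P R \<subseteq> labels P"
      using extreme_point_of_face[OF ridge_face[OF R(2)]] unfolding ridge_labels_def labels_def by blast
    then have "{l \<in> labels P. \<forall>R\<in>S. l \<in> ridge_labels P R} = labels_in (bipyramid R)"
      using labels_in_bipyramid[OF R(2)] 2 by auto
    then show ?thesis using R unfolding E_face_lattice_eq by blast
  next
    case (3 R R')
    then have R: "R ridge_of P" "R' ridge_of P" using S unfolding ridges_def by auto
    have Sne: "S \<noteq> {}" using 3 by blast
    note I = common_labels[OF S Sne]
    have IR: "\<Inter>S \<subseteq> R" "\<Inter>S \<subseteq> R'" using 3 by auto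
    have dimI: "aff_dim (\<Inter>S) \<le> d - 3"
    proof -
      have fR: "\<Inter>S face_of R" using face_of_face[OF ridge_face[OF R(1)]] I(1) IR by simp
      have "\<Inter>S \<noteq> R"
      proof
        assume eq: "\<Inter>S = R"
        then have "R face_of R'" using face_of_face[OF ridge_face[OF R(2)]] I(1) IR by simp
        then show False
          using face_of_aff_dim_lt[OF face_of_imp_convex[OF ridge_face[OF R(2)]], of R] 3
            ridge_dim[OF R(1)] ridge_dim[OF R(2)] by simp
      qed
      then show ?thesis
        using face_of_aff_dim_lt[OF face_of_imp_convex[OF ridge_face[OF R(1)]] fR] ridge_dim[OF R(1)] by simp
    qed
    show ?thesis
    proof (cases "\<exists>F. F facet_of P \<and> (\<forall>R\<in>S. R \<subseteq> F)")
      case False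
      then have none: "{F. F facet_of P \<and> (\<forall>R\<in>S. R \<subseteq> F)} = {}" by blast
      have "labels_in (\<Inter>S) = Inl ` {w. w extreme_point_of \<Inter>S}"
        using labels_in_small_face[OF I(1)] dimI by simp
      then have "{l \<in> labels P. \<forall>R\<in>S. l \<in> ridge_labels P R} = labels_in (\<Inter>S)"
        unfolding I(2) none by simp
      moreover have "\<Inter>S \<in> small_faces" using I(1) dimI by (simp add: small_faces_def)
      ultimately show ?thesis unfolding E_face_lattice_eq by blast
    next
      case True
      then obtain F where F: "F facet_of P" "\<forall>R\<in>S. R \<subseteq> F" by blast
      have "H = F" if "H facet_of P" "\<forall>R\<in>S. R \<subseteq> H" for H
        using facet_through_two_ridges_unique[OF R 3(3), of H F] that F 3 by blast
      then have "{F. F facet_of P \<and> (\<forall>R\<in>S. R \<subseteq> F)} = {F}" using F by blast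
      moreover have GF: "\<Inter>S face_of F"
      proof -
        have "\<Inter>S \<subseteq> F" using IR F 3 by blast
        then show ?thesis using face_of_face[OF facet_of_imp_face_of[OF F(1)]] I(1) by simp
      qed
      ultimately have "{l \<in> labels P. \<forall>R\<in>S. l \<in> ridge_labels P R} = labels_in (cone F (\<Inter>S))"
        using I(2) labels_in_cone[OF F(1) GF] by simp
      moreover have "cone F (\<Inter>S) \<in> small_cones"
        using F GF dimI unfolding small_cones_def by blast
      ultimately show ?thesis unfolding E_face_lattice_eq by blast
    qed
  qed
qed

lemma face_of_facet_eq_Inter_ridges:
  assumes F: "F facet_of P" and G: "G face_of F" "G \<noteq> F"
  shows "G = \<Inter>{R. R facet_of F \<and> G \<subseteq> R}"
proof -
  have "aff_dim F \<ge> 1" using facet_dim[OF F] dim by simp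
  then show ?thesis using face_eq_Inter_facets[OF facet_poly[OF F] _ G] by blast
qed

text \<open>The ridges of \<open>F\<close> through \<open>G\<close> intersect in \<open>G\<close>.
  There are at least two of them because \<open>G\<close> is too small to be a ridge, so
  \<open>F\<close> is the only facet that contains them all.\<close>

lemma labels_in_small_cone_common:
  assumes F: "F facet_of P" and G: "G face_of F" "aff_dim G \<le> d - 3"
  shows "\<exists>S\<subseteq>ridges. labels_in (cone F G) = {l \<in> labels P. \<forall>R\<in>S. l \<in> ridge_labels P R}"
proof -
  let ?S = "{R. R facet_of F \<and> G \<subseteq> R}"
  have GF: "G \<noteq> F" using facet_dim[OF F] G(2) by auto
  have IG: "\<Inter>?S = G" using face_of_facet_eq_Inter_ridges[OF F G(1) GF] by simp
  have S: "?S \<subseteq> ridges" using facet_of_facet_is_ridge[OF F] unfolding ridges_def by blast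
  have "G \<noteq> UNIV" using GF face_of_imp_subset[OF G(1)] by blast
  then have Sne: "?S \<noteq> {}" using IG by (metis Inter_empty)
  then obtain R where R: "R \<in> ?S" by blast
  have "\<exists>R'\<in>?S. R' \<noteq> R"
  proof (rule ccontr)
    assume "\<not> (\<exists>R'\<in>?S. R' \<noteq> R)"
    then have "?S = {R}" using R by blast
    then have "G = R" using IG by simp
    moreover have "aff_dim R = d - 2" using R S ridge_dim unfolding ridges_def by blast
    ultimately show False using G(2) by simp
  qed
  then obtain R' where R': "R' \<in> ?S" "R' \<noteq> R" by blast
  have rr: "R ridge_of P" "R' ridge_of P" using R R' S unfolding ridges_def by blast+
  have sub: "\<forall>R\<in>?S. R \<subseteq> F" using facet_of_imp_subset by blast
  have "H = F" if "H facet_of P" "\<forall>R\<in>?S. R \<subseteq> H" for H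
    using facet_through_two_ridges_unique[OF rr R'(2)[symmetric] that(1) _ _ F] that(2) sub R R' by blast
  then have "{F. F facet_of P \<and> (\<forall>R\<in>?S. R \<subseteq> F)} = {F}" using F sub by blast
  then have "labels_in (cone F G) = {l \<in> labels P. \<forall>R\<in>?S. l \<in> ridge_labels P R}"
    using common_labels(2)[OF S Sne] labels_in_cone[OF F G(1)] IG by simp
  then show ?thesis using S by blast
qed

text \<open>All ridges of \<open>P\<close> through \<open>G\<close> are taken, and not only those in
  one facet, so that their bipyramids have no new vertex in common.\<close>

lemma labels_in_small_face_common:
  assumes G: "G face_of P" "aff_dim G \<le> d - 3"
  shows "\<exists>S\<subseteq>ridges. labels_in G = {l \<in> labels P. \<forall>R\<in>S. l \<in> ridge_labels P R}"
proof -
  let ?S = "{R \<in> ridges. G \<subseteq> R}"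
  have GP: "G \<noteq> P" using G by auto
  have facets: "G = \<Inter>{F. F facet_of P \<and> G \<subseteq> F}"
    using face_eq_Inter_facets[OF P _ G(1) GP] dim by linarith
  have Gne: "G \<noteq> F" if "F facet_of P" for F using facet_dim[OF that] G(2) by auto
  have GU: "G \<noteq> UNIV" using GP face_of_imp_subset[OF G(1)] by blast
  have inF: "G face_of F" "G = \<Inter>{R. R facet_of F \<and> G \<subseteq> R}" if "F facet_of P" "G \<subseteq> F" for F
  proof -
    show "G face_of F" using face_of_face[OF facet_of_imp_face_of[OF that(1)]] G that by simp
    then show "G = \<Inter>{R. R facet_of F \<and> G \<subseteq> R}"
      using face_of_facet_eq_Inter_ridges[OF that(1) _ Gne[OF that(1)]] by blast
  qed
  have sub: "{R. R facet_of F \<and> G \<subseteq> R} \<subseteq> ?S" if "F facet_of P" for F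
    using facet_of_facet_is_ridge[OF that] unfolding ridges_def by blast
  have "{F. F facet_of P \<and> G \<subseteq> F} \<noteq> {}" using facets GU by (metis Inter_empty)
  then obtain F where F: "F facet_of P" "G \<subseteq> F" by blast
  have "\<Inter>?S \<subseteq> \<Inter>{R. R facet_of F \<and> G \<subseteq> R}" using sub[OF F(1)] by (rule Inter_anti_mono)
  then have IG: "\<Inter>?S = G" using inF(2)[OF F] by blast
  have Sne: "?S \<noteq> {}" using IG GU by (metis Inter_empty)
  \<comment> \<open>If \<open>H\<close> contained all these ridges, then in another facet
    \<open>F'\<close> through \<open>G\<close> the only ridge through \<open>G\<close> would be
    \<open>F' \<inter> H\<close>, and \<open>G\<close> would be equal to it.\<close>
  have "False" if H: "H facet_of P" "\<forall>R\<in>?S. R \<subseteq> H" for H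
  proof -
    have "G \<subseteq> H" using IG Sne H(2) by blast
    have "{F. F facet_of P \<and> G \<subseteq> F} \<noteq> {H}" using facets Gne[OF H(1)] by (metis cInf_singleton)
    then obtain F' where F': "F' facet_of P" "G \<subseteq> F'" "F' \<noteq> H" using \<open>G \<subseteq> H\<close> H(1) by blast
    have "R = F' \<inter> H" if R: "R facet_of F'" "G \<subseteq> R" for R
    proof -
      have "R \<in> ?S" using sub[OF F'(1)] R by blast
      then have "R \<subseteq> H" "R ridge_of P" using H(2) by (auto simp: ridges_def)
      then show ?thesis
        using Int_facets_eq_ridge[OF P _ F'(1) H(1) F'(3)] facet_of_imp_subset[OF R(1)] by simp
    qed
    then have "{R. R facet_of F' \<and> G \<subseteq> R} \<subseteq> {F' \<inter> H}" by blast
    moreover have "{R. R facet_of F' \<and> G \<subseteq> R} \<noteq> {}" using inF(2)[OF F'(1,2)] GU by (metis Inter_empty)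
    ultimately obtain R where R: "{R. R facet_of F' \<and> G \<subseteq> R} = {R}" by blast
    then have "G = R" using inF(2)[OF F'(1,2)] by simp
    moreover have "R facet_of F'" using R by blast
    ultimately have "G ridge_of P" using facet_of_facet_is_ridge[OF F'(1)] by simp
    then show False using ridge_dim G(2) by fastforce
  qed
  then have none: "{F. F facet_of P \<and> (\<forall>R\<in>?S. R \<subseteq> F)} = {}" by blast
  have sub': "?S \<subseteq> ridges" by blast
  have "labels_in G = Inl ` {w. w extreme_point_of G}"
    using labels_in_small_face[OF G(1)] G(2) by simp
  then have "labels_in G = {l \<in> labels P. \<forall>R\<in>?S. l \<in> ridge_labels P R}"
    unfolding common_labels(2)[OF sub' Sne] none IG by simp
  then show ?thesis using sub' by blast
qed

lemma labels_in_image: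
  "labels_in ` E_face_lattice v P = label_sets (labels P) (ridge_labels P) ridges"
proof (intro subset_antisym subsetI)
  fix K assume "K \<in> label_sets (labels P) (ridge_labels P) ridges"
  then show "K \<in> labels_in ` E_face_lattice v P"
    using common_labels_are_cells unfolding label_sets_def by blast
next
  fix K assume "K \<in> labels_in ` E_face_lattice v P"
  then obtain c where c: "c \<in> E_face_lattice v P" "K = labels_in c" by blast
  have "\<exists>S\<subseteq>ridges. labels_in c = {l \<in> labels P. \<forall>R\<in>S. l \<in> ridge_labels P R}"
  proof -
    consider "c \<in> small_faces" | "c \<in> small_cones" | R where "R \<in> ridges" "c = bipyramid R" | "c = rel_frontier P"
      using c(1) unfolding E_face_lattice_eq by blast
    then show ?thesis
    proof cases
      case 1
      then show ?thesis using labels_in_small_face_common by (simp add: small_faces_def)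
    next
      case 2
      then show ?thesis using labels_in_small_cone_common unfolding small_cones_def by blast
    next
      case (3 R)
      then have R: "R ridge_of P" by (simp add: ridges_def)
      have "ridge_labels P R \<subseteq> labels P"
        using extreme_point_of_face[OF ridge_face[OF R]] unfolding ridge_labels_def labels_def by blast
      then show ?thesis using 3 labels_in_bipyramid[OF R] by (intro exI[of _ "{R}"]) auto
    next
      case 4
      then show ?thesis using labels_in_frontier by (intro exI[of _ "{}"]) simp
    qed
  qed
  then show "K \<in> label_sets (labels P) (ridge_labels P) ridges"
    using c(2) unfolding label_sets_def by blast
qed

theorem E_face_lattice_realization:
  fixes pt :: "'a + 'a set \<Rightarrow> 'b::euclidean_space" and A :: "'a set \<Rightarrow> 'b"
  assumes le: "\<And>R l. R ridge_of P \<Longrightarrow> l \<in> labels P \<Longrightarrow> A R \<bullet> pt l \<le> b R"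
    and eq: "\<And>R l. R ridge_of P \<Longrightarrow> l \<in> labels P \<Longrightarrow> A R \<bullet> pt l = b R \<longleftrightarrow> l \<in> ridge_labels P R"
    and cover: "{z. \<forall>R. R ridge_of P \<longrightarrow> A R \<bullet> z \<le> b R} \<subseteq> convex hull (pt ` labels P)"
  shows "lattice_isomorphic (polytope_face_lattice (convex hull (pt ` labels P))) (E_face_lattice v P)"
proof -
  \<comment> \<open>The empty cell shows that the empty set is an intersection of label sets of
    ridges.\<close>
  have "{} \<in> E_face_lattice v P" by (simp add: E_face_lattice_def)
  moreover have "labels_in {} = {}" by (simp add: labels_in_def)
  ultimately have empty: "{} \<in> label_sets (labels P) (ridge_labels P) ridges"
    unfolding labels_in_image[symmetric] by (metis imageI)
  have le': "\<And>R l. R \<in> ridges \<Longrightarrow> l \<in> labels P \<Longrightarrow> A R \<bullet> pt l \<le> b R"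
    and eq': "\<And>R l. R \<in> ridges \<Longrightarrow> l \<in> labels P \<Longrightarrow> A R \<bullet> pt l = b R \<longleftrightarrow> l \<in> ridge_labels P R"
    and cover': "{z. \<forall>R\<in>ridges. A R \<bullet> z \<le> b R} \<subseteq> convex hull (pt ` labels P)"
    using le eq cover by (auto simp: ridges_def)
  note fl = face_lattice_label_sets[OF finite_labels le' eq' cover' empty]
  show ?thesis
    unfolding polytope_face_lattice_def
  proof (rule lattice_isomorphic_common_image[OF fl(1) _ labels_in_image labels_in_mono_iff])
    fix F G assume "F \<in> {F. F face_of convex hull pt ` labels P}" "G \<in> {F. F face_of convex hull pt ` labels P}"
    then show "F \<subseteq> G \<longleftrightarrow> {l \<in> labels P. pt l \<in> F} \<subseteq> {l \<in> labels P. pt l \<in> G}"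
      using fl(2) by simp
  qed
qed

end

section \<open>Closed convex polygons in polar coordinates\<close>

text \<open>The determinant of two plane vectors, twice the signed area of the triangle with corners
  0, \<open>z\<close> and \<open>w\<close>.\<close>

definition cdet :: "complex \<Rightarrow> complex \<Rightarrow> real" where
  "cdet z w = Re z * Im w - Im z * Re w"

lemma cdet_polar: "cdet (of_real a * cis x) (of_real b * cis y) = a * b * sin (y - x)"
  by (simp add: cdet_def sin_diff algebra_simps)

lemma cdet_linear_right: "cdet z (a *\<^sub>R u + b *\<^sub>R v) = a * cdet z u + b * cdet z v"
  by (simp add: cdet_def algebra_simps)

lemma cdet_same [simp]: "cdet z z = 0"
  by (simp add: cdet_def)

text \<open>Indices run over all naturals and angles are lifted to the real line, so that going
  round becomes an increasing sequence. The condition \<open>turn\<close> fixes the winding number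
  around 0 to be 1.\<close>

locale star_ring =
  fixes m :: nat and w :: "nat \<Rightarrow> complex" and \<psi> \<rho> :: "nat \<Rightarrow> real"
  assumes m: "m \<ge> 1"
    and polar: "\<And>k. w k = of_real (\<rho> k) * cis (\<psi> k)"
    and \<rho>: "\<And>k. \<rho> k > 0"
    and \<psi>: "\<And>k. \<psi> k < \<psi> (Suc k)" "\<And>k. \<psi> (Suc k) < \<psi> k + pi"
    and turn: "\<And>k. \<psi> (k + m) = \<psi> k + 2 * pi"
    and w_period: "\<And>k. w (k + m) = w k"
begin

text \<open>The polar dual of the line through two consecutive vertices: the edge turned clockwise
  by a right angle and scaled so that the inner product is 1 on the line.\<close>

definition edge_normal :: "nat \<Rightarrow> complex" where
  "edge_normal k = (- \<i> * (w (Suc k) - w k)) / of_real (cdet (w k) (w (Suc k)))"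

lemma D_pos: "cdet (w k) (w (Suc k)) > 0"
  unfolding polar[of k] polar[of "Suc k"] cdet_polar
  using \<rho>[of k] \<rho>[of "Suc k"] \<psi>[of k] by (simp add: sin_gt_zero)

lemma edge_normal_inner:
  "edge_normal k \<bullet> z = (cdet z (w (Suc k)) + cdet (w k) z) / cdet (w k) (w (Suc k))"
proof -
  have "edge_normal k \<bullet> z = ((Im (w (Suc k)) - Im (w k)) * Re z - (Re (w (Suc k)) - Re (w k)) * Im z)
      / cdet (w k) (w (Suc k))"
    unfolding edge_normal_def inner_complex_def by (simp add: diff_divide_distrib add_divide_distrib algebra_simps)
  also have "\<dots> = (cdet z (w (Suc k)) + cdet (w k) z) / cdet (w k) (w (Suc k))"
    by (simp add: cdet_def algebra_simps)
  finally show ?thesis .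
qed

lemma edge_normal_vertex:
  "edge_normal k \<bullet> w k = 1" "edge_normal k \<bullet> w (Suc k) = 1"
  using D_pos[of k] by (simp_all add: edge_normal_inner)

lemma edge_normal_period: "edge_normal (k + m) = edge_normal k"
  using w_period[of k] w_period[of "Suc k"] by (simp add: edge_normal_def)

lemma edge_normal_mod: "edge_normal (k mod m) = edge_normal k"
proof -
  have "edge_normal (j + q * m) = edge_normal j" for j q
  proof (induction q)
    case (Suc q)
    have "j + Suc q * m = (j + q * m) + m" by simp
    then show ?case using Suc edge_normal_period by metis
  qed simp
  from this[of "k mod m" "k div m"] show ?thesis by simp
qed

lemma w_mod: "w (k mod m) = w k"
proof -
  have "w (j + q * m) = w j" for j q
  proof (induction q)
    case (Suc q)
    have "j + Suc q * m = (j + q * m) + m" by simp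
    then show ?case using Suc w_period by metis
  qed simp
  from this[of "k mod m" "k div m"] show ?thesis by simp
qed

lemma decompose:
  "z = (cdet z (w (Suc k)) / cdet (w k) (w (Suc k))) *\<^sub>R w k
     + (cdet (w k) z / cdet (w k) (w (Suc k))) *\<^sub>R w (Suc k)"
proof -
  have "cdet (w k) (w (Suc k)) *\<^sub>R z = cdet z (w (Suc k)) *\<^sub>R w k + cdet (w k) z *\<^sub>R w (Suc k)"
    by (simp add: complex_eq_iff cdet_def algebra_simps)
  then have "(1 / cdet (w k) (w (Suc k))) *\<^sub>R (cdet (w k) (w (Suc k)) *\<^sub>R z)
    = (1 / cdet (w k) (w (Suc k))) *\<^sub>R (cdet z (w (Suc k)) *\<^sub>R w k + cdet (w k) z *\<^sub>R w (Suc k))"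
    by simp
  then show ?thesis using D_pos[of k] by (simp add: scaleR_add_right)
qed

lemma \<psi>_strict_mono: "i < j \<Longrightarrow> \<psi> i < \<psi> j"
  by (rule lift_Suc_mono_less[of \<psi>]) (rule \<psi>(1))

text \<open>The lifted angles are unbounded, so the argument of \<open>z\<close>, lifted beyond
  \<open>\<psi> 0\<close>, falls between two consecutive ones. Cramer's rule
  (\<open>decompose\<close>) then has nonnegative coefficients, since the sector is narrower than a
  half plane.\<close>

lemma fan:
  obtains k \<alpha> \<beta> where "z = \<alpha> *\<^sub>R w k + \<beta> *\<^sub>R w (Suc k)" "\<alpha> \<ge> 0" "\<beta> \<ge> 0"
proof -
  have unb: "\<psi> (q * m) = \<psi> 0 + 2 * pi * real q" for q
  proof (induction q)
    case (Suc q)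
    have "Suc q * m = q * m + m" by simp
    then show ?case using Suc turn[of "q * m"] by (simp add: algebra_simps)
  qed simp
  obtain q :: nat where q: "\<psi> 0 - Arg z < 2 * pi * real q"
    using reals_Archimedean3[of "2 * pi"] by (auto simp: mult.commute)
  define \<phi> where "\<phi> = Arg z + 2 * pi * real q"
  have z: "z = of_real (cmod z) * cis \<phi>"
  proof -
    have "cis \<phi> = cis (Arg z) * cis (2 * pi * real q)" by (simp only: \<phi>_def cis_mult)
    also have "cis (2 * pi * real q) = 1" by (rule cis_multiple_2pi) simp
    finally have "cis \<phi> = cis (Arg z)" by simp
    then show ?thesis using rcis_cmod_Arg[of z] by (simp add: rcis_def)
  qed
  have \<phi>0: "\<psi> 0 < \<phi>" using q by (simp add: \<phi>_def)
  obtain q' :: nat where "\<phi> - \<psi> 0 < 2 * pi * real q'"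
    using reals_Archimedean3[of "2 * pi"] by (auto simp: mult.commute)
  then have "\<phi> < \<psi> (q' * m)" using unb by simp
  then have ex: "\<phi> < \<psi> (Suc (q' * m))" using \<psi>(1)[of "q' * m"] by simp
  define k where "k = (LEAST k. \<phi> < \<psi> (Suc k))"
  have k1: "\<phi> < \<psi> (Suc k)" unfolding k_def using ex by (rule LeastI)
  have k0: "\<psi> k \<le> \<phi>"
  proof (cases k)
    case (Suc k')
    then have "\<not> \<phi> < \<psi> (Suc k')" using not_less_Least[of k' "\<lambda>k. \<phi> < \<psi> (Suc k)"] k_def by simp
    then show ?thesis using Suc by simp
  qed (use \<phi>0 in simp)
  have "sin (\<phi> - \<psi> k) \<ge> 0" "sin (\<psi> (Suc k) - \<phi>) \<ge> 0"
    using k0 k1 \<psi>(2)[of k] by (intro sin_ge_zero; simp)+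
  then have "cdet (w k) z \<ge> 0" "cdet z (w (Suc k)) \<ge> 0"
    unfolding polar[of k] polar[of "Suc k"]
    by (subst z, subst cdet_polar, simp add: less_imp_le[OF \<rho>])+
  then show thesis
    using that[OF decompose[of z k]] D_pos[of k] by simp
qed

end

text \<open>Convexity is required only locally, of the next vertex after each edge. Together with
  winding number 1 this yields the global statement \<open>normal_vertex\<close>.\<close>

locale convex_ring = star_ring +
  assumes convex: "\<And>k. edge_normal k \<bullet> w (Suc (Suc k)) < 1"
begin

text \<open>Both normals take the value 1 at the common vertex, so their difference is a multiple of
  the determinant with this vertex; the sign of the factor is seen at the vertex after it.\<close>

lemma normal_step:
  "\<exists>c>0. \<forall>z. edge_normal (Suc k) \<bullet> z - edge_normal k \<bullet> z = c * cdet (w (Suc k)) z"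
proof -
  let ?D = "cdet (w (Suc k)) (w (Suc (Suc k)))"
  let ?c = "(1 - edge_normal k \<bullet> w (Suc (Suc k))) / ?D"
  have "?c > 0" using D_pos[of "Suc k"] convex[of k] by simp
  moreover have "edge_normal (Suc k) \<bullet> z - edge_normal k \<bullet> z = ?c * cdet (w (Suc k)) z" for z
  proof -
    define \<alpha> \<beta> where "\<alpha> = cdet z (w (Suc (Suc k))) / ?D" and "\<beta> = cdet (w (Suc k)) z / ?D"
    have z: "z = \<alpha> *\<^sub>R w (Suc k) + \<beta> *\<^sub>R w (Suc (Suc k))"
      unfolding \<alpha>_def \<beta>_def by (rule decompose)
    have "edge_normal (Suc k) \<bullet> z - edge_normal k \<bullet> z = \<beta> * (1 - edge_normal k \<bullet> w (Suc (Suc k)))"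
      by (subst (1 2) z) (simp add: inner_add_right edge_normal_vertex algebra_simps)
    then show ?thesis by (simp add: \<beta>_def)
  qed
  ultimately show ?thesis by blast
qed

text \<open>
  By the previous lemma, for a fixed vertex the values of successive edge normals first decrease
  and then increase along a full turn, which starts and ends with the value 1.
\<close>

lemma normal_vertex_before:
  assumes "j < k" "k < j + m" "\<psi> k - \<psi> j \<le> pi"
  shows "edge_normal k \<bullet> w j < 1"
  using assms
proof (induction k)
  case (Suc k)
  obtain c where c: "c > 0" "\<And>z. edge_normal (Suc k) \<bullet> z - edge_normal k \<bullet> z = c * cdet (w (Suc k)) z"
    using normal_step by blast
  have d: "cdet (w (Suc k)) (w j) = - (\<rho> (Suc k) * \<rho> j * sin (\<psi> (Suc k) - \<psi> j))"
    unfolding polar[of "Suc k"] polar[of j] cdet_polar by (simp add: sin_diff algebra_simps)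
  have pos: "\<rho> (Suc k) * \<rho> j > 0" using \<rho> by simp
  have gt: "0 < \<psi> (Suc k) - \<psi> j" using \<psi>_strict_mono[OF Suc.prems(1)] by simp
  show ?case
  proof (cases "k = j")
    case True
    then have "sin (\<psi> (Suc k) - \<psi> j) > 0" using gt \<psi>(2)[of k] by (intro sin_gt_zero) auto
    then have "cdet (w (Suc k)) (w j) < 0" unfolding d using pos by simp
    then have "c * cdet (w (Suc k)) (w j) < 0" using c(1) by (simp add: mult_pos_neg)
    then show ?thesis using c(2)[of "w j"] edge_normal_vertex(1)[of j] True by simp
  next
    case False
    then have k: "j < k" using Suc.prems by simp
    have "sin (\<psi> (Suc k) - \<psi> j) \<ge> 0" using gt Suc.prems by (intro sin_ge_zero) auto
    then have "cdet (w (Suc k)) (w j) \<le> 0" unfolding d using pos by simp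
    then have "c * cdet (w (Suc k)) (w j) \<le> 0" using c(1) by (simp add: mult_nonneg_nonpos)
    moreover have "edge_normal k \<bullet> w j < 1"
      using Suc.IH[OF k] Suc.prems \<psi>(1)[of k] by simp
    ultimately show ?thesis using c(2)[of "w j"] by simp
  qed
qed simp

lemma normal_vertex_after:
  assumes "j < k" "Suc k < j + m" "\<psi> k - \<psi> j > pi"
  shows "edge_normal k \<bullet> w j < 1"
proof -
  \<comment> \<open>The induction runs downwards from the edge \<open>j + m - 1\<close>, which ends
    in \<open>w (j + m) = w j\<close>. There the value is exactly 1, so strictness can be claimed
    only from the preceding edge on.\<close>
  have "\<psi> i - \<psi> j > pi \<Longrightarrow> j < i \<Longrightarrow> edge_normal i \<bullet> w j \<le> 1 \<and> (Suc i < j + m \<longrightarrow> edge_normal i \<bullet> w j < 1)"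
    if "i \<le> j + m - 1" for i
    using that
  proof (induction i rule: inc_induct)
    case base
    have "Suc (j + m - 1) = j + m" using m by simp
    then have "edge_normal (j + m - 1) \<bullet> w j = 1"
      using edge_normal_vertex(2)[of "j + m - 1"] w_period[of j] by simp
    then show ?case using m by simp
  next
    case (step i)
    obtain c where c: "c > 0" "\<And>z. edge_normal (Suc i) \<bullet> z - edge_normal i \<bullet> z = c * cdet (w (Suc i)) z"
      using normal_step by blast
    have d: "cdet (w (Suc i)) (w j) = \<rho> (Suc i) * \<rho> j * sin (\<psi> (Suc i) - \<psi> j - pi)"
      unfolding polar[of "Suc i"] polar[of j] cdet_polar by (simp add: sin_diff algebra_simps)
    have gt: "\<psi> (Suc i) - \<psi> j > pi" using \<psi>(1)[of i] step.prems by simp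
    have "\<psi> (Suc i) < \<psi> (j + m)" using step.hyps by (intro \<psi>_strict_mono) auto
    then have "\<psi> (Suc i) - \<psi> j - pi < pi" using turn[of j] by simp
    then have "sin (\<psi> (Suc i) - \<psi> j - pi) > 0" using gt by (intro sin_gt_zero) auto
    then have "cdet (w (Suc i)) (w j) > 0" unfolding d by (intro mult_pos_pos \<rho>)
    then have "c * cdet (w (Suc i)) (w j) > 0" using c(1) by simp
    moreover have "edge_normal (Suc i) \<bullet> w j \<le> 1" using step.IH gt step.prems by simp
    ultimately show ?case using c(2)[of "w j"] by simp
  qed
  from this[of k] assms show ?thesis by simp
qed

lemma normal_vertex_less:
  assumes "j < k" "Suc k < j + m"
  shows "edge_normal k \<bullet> w j < 1"
  using normal_vertex_before[OF assms(1)] normal_vertex_after[OF assms] assms(2) by fastforce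

lemma normal_vertex:
  assumes "i < m" "j < m"
  shows "edge_normal i \<bullet> w j \<le> 1" "edge_normal i \<bullet> w j = 1 \<longleftrightarrow> j = i \<or> j = Suc i mod m"
proof -
  have *: "edge_normal i \<bullet> w j < 1" if ne: "j \<noteq> i" "j \<noteq> Suc i mod m"
  proof (cases "j < i")
    case True
    have "Suc i < j + m"
    proof (rule ccontr)
      assume "\<not> Suc i < j + m"
      then have "j = 0" "Suc i = m" using assms by auto
      then show False using ne by simp
    qed
    then show ?thesis using normal_vertex_less True by blast
  next
    case False
    then have "i < j" using ne by simp
    moreover have "Suc i \<noteq> j"
    proof
      assume "Suc i = j"
      then show False using ne assms by simp
    qed
    \<comment> \<open>The edge is replaced by its copy one turn later, so that the vertex comes
      before it.\<close>
    ultimately have "j < i + m" "Suc (i + m) < j + m" using assms by auto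
    then show ?thesis using normal_vertex_less[of j "i + m"] edge_normal_period[of i] by simp
  qed
  have eq: "edge_normal i \<bullet> w j = 1" if "j = i \<or> j = Suc i mod m"
    using that edge_normal_vertex[of i] w_mod[of "Suc i"] by auto
  show "edge_normal i \<bullet> w j \<le> 1" using * eq by fastforce
  show "edge_normal i \<bullet> w j = 1 \<longleftrightarrow> j = i \<or> j = Suc i mod m" using * eq by fastforce
qed

end

section \<open>A polygon nested in another one\<close>

lemma in_convex_hull_2:
  fixes x y :: "'a::real_vector"
  shows "0 \<le> a \<Longrightarrow> 0 \<le> b \<Longrightarrow> a + b = 1 \<Longrightarrow> a *\<^sub>R x + b *\<^sub>R y \<in> convex hull {x, y}"
  unfolding convex_hull_2 by blast

lemma in_convex_hull_3:
  fixes x y z :: "'a::real_vector"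
  shows "0 \<le> a \<Longrightarrow> 0 \<le> b \<Longrightarrow> 0 \<le> c \<Longrightarrow> a + b + c = 1 \<Longrightarrow>
    a *\<^sub>R x + b *\<^sub>R y + c *\<^sub>R z \<in> convex hull {x, y, z}"
  unfolding convex_hull_3 by blast

text \<open>
  The ring z interleaves the vertices p of an inner polygon (even indices) with the vertices x of an
  outer one (odd indices).  The inner vertices are scaled by sqrt 2, which turns the two conditions
  "p lies on an edge of the outer polygon" and "x/2 lies on an edge of the inner polygon" into
  a single condition on consecutive elements of z.
\<close>

locale nested_ring =
  fixes m :: nat and z :: "nat \<Rightarrow> complex" and \<theta> \<rho> :: "nat \<Rightarrow> real"
  assumes m: "m \<ge> 3"
    and z_polar: "\<And>k. z k = of_real (\<rho> k) * cis (\<theta> k)"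
    and \<rho>: "\<And>k. \<rho> k > 0"
    and \<theta>: "\<And>k. \<theta> k < \<theta> (Suc k)" "\<And>k. \<theta> (Suc k) < \<theta> k + pi"
    and turn: "\<And>k. \<theta> (k + 2 * m) = \<theta> k + 2 * pi"
    and period: "\<And>k. z (k + 2 * m) = z k"
    and between: "\<And>k. \<exists>t. 0 < t \<and> t < 1 \<and>
      (1 / sqrt 2) *\<^sub>R z (Suc k) = (1 - t) *\<^sub>R z k + t *\<^sub>R z (Suc (Suc k))"
begin

text \<open>A positive multiple of the middle point lies strictly between its neighbours, so the
  determinant of the neighbours is positive, like that of the first two points. Hence every second
  point again forms a ring with steps below \<open>pi\<close>.\<close>

lemma \<theta>_two: "\<theta> (Suc (Suc k)) < \<theta> k + pi"
proof -
  obtain t where t: "0 < t" "t < 1"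
    "(1 / sqrt 2) *\<^sub>R z (Suc k) = (1 - t) *\<^sub>R z k + t *\<^sub>R z (Suc (Suc k))"
    using between by blast
  have "cdet (z k) ((1 / sqrt 2) *\<^sub>R z (Suc k)) = t * cdet (z k) (z (Suc (Suc k)))"
    unfolding t(3) cdet_linear_right by simp
  then have "t * cdet (z k) (z (Suc (Suc k))) = cdet (z k) (z (Suc k)) / sqrt 2"
    by (simp add: cdet_def field_simps)
  moreover have "cdet (z k) (z (Suc k)) > 0"
    unfolding z_polar[of k] z_polar[of "Suc k"] cdet_polar
    using \<theta>[of k] by (intro mult_pos_pos \<rho> sin_gt_zero) auto
  ultimately have "t * cdet (z k) (z (Suc (Suc k))) > 0" by simp
  then have "cdet (z k) (z (Suc (Suc k))) > 0" using t by (simp add: zero_less_mult_iff)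
  then have "\<rho> k * \<rho> (Suc (Suc k)) * sin (\<theta> (Suc (Suc k)) - \<theta> k) > 0"
    unfolding z_polar[of k] z_polar[of "Suc (Suc k)"] cdet_polar .
  then have s: "sin (\<theta> (Suc (Suc k)) - \<theta> k) > 0"
    by (rule zero_less_mult_pos[OF _ mult_pos_pos[OF \<rho> \<rho>]])
  show ?thesis
  proof (rule ccontr)
    assume "\<not> ?thesis"
    then have "sin (\<theta> (Suc (Suc k)) - \<theta> k - pi) \<ge> 0"
      using \<theta>[of k] \<theta>[of "Suc k"] by (intro sin_ge_zero) auto
    then show False using s by simp
  qed
qed

definition p :: "nat \<Rightarrow> complex" where "p k = (1 / sqrt 2) *\<^sub>R z (2 * k)"
definition x :: "nat \<Rightarrow> complex" where "x k = z (2 * k + 1)"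

sublocale P: star_ring m p "\<lambda>k. \<theta> (2 * k)" "\<lambda>k. \<rho> (2 * k) / sqrt 2"
proof
  fix k
  show "p k = of_real (\<rho> (2 * k) / sqrt 2) * cis (\<theta> (2 * k))"
    unfolding p_def z_polar[of "2 * k"] by (simp add: scaleR_conv_of_real)
  show "\<theta> (2 * k) < \<theta> (2 * Suc k)" using \<theta>(1)[of "2 * k"] \<theta>(1)[of "Suc (2 * k)"] by simp
  show "\<theta> (2 * Suc k) < \<theta> (2 * k) + pi" using \<theta>_two[of "2 * k"] by simp
  show "\<theta> (2 * (k + m)) = \<theta> (2 * k) + 2 * pi" using turn[of "2 * k"] by (simp add: algebra_simps)
  show "p (k + m) = p k" using period[of "2 * k"] by (simp add: p_def algebra_simps)
qed (use m \<rho> in auto)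

sublocale X: star_ring m x "\<lambda>k. \<theta> (2 * k + 1)" "\<lambda>k. \<rho> (2 * k + 1)"
proof
  fix k
  show "x k = of_real (\<rho> (2 * k + 1)) * cis (\<theta> (2 * k + 1))"
    unfolding x_def by (rule z_polar)
  show "\<theta> (2 * k + 1) < \<theta> (2 * Suc k + 1)"
    using \<theta>(1)[of "2 * k + 1"] \<theta>(1)[of "Suc (2 * k + 1)"] by simp
  show "\<theta> (2 * Suc k + 1) < \<theta> (2 * k + 1) + pi" using \<theta>_two[of "2 * k + 1"] by simp
  show "\<theta> (2 * (k + m) + 1) = \<theta> (2 * k + 1) + 2 * pi"
    using turn[of "2 * k + 1"] by (simp add: algebra_simps)
  show "x (k + m) = x k" using period[of "2 * k + 1"] by (simp add: x_def algebra_simps)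
qed (use m \<rho> in auto)

lemma p_between: "\<exists>t. 0 < t \<and> t < 1 \<and> p (Suc k) = (1 - t) *\<^sub>R x k + t *\<^sub>R x (Suc k)"
  using between[of "2 * k + 1"] by (simp add: p_def x_def)

lemma x_between: "\<exists>t. 0 < t \<and> t < 1 \<and> x k = (2 * (1 - t)) *\<^sub>R p k + (2 * t) *\<^sub>R p (Suc k)"
proof -
  obtain t where t: "0 < t" "t < 1"
    "(1 / sqrt 2) *\<^sub>R z (2 * k + 1) = (1 - t) *\<^sub>R z (2 * k) + t *\<^sub>R z (2 * k + 2)"
    using between[of "2 * k"] by auto
  have "x k = sqrt 2 *\<^sub>R ((1 / sqrt 2) *\<^sub>R z (2 * k + 1))" by (simp add: x_def)
  also have "\<dots> = (sqrt 2 * (1 - t)) *\<^sub>R z (2 * k) + (sqrt 2 * t) *\<^sub>R z (2 * k + 2)"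
    unfolding t(3) by (simp add: scaleR_add_right)
  also have "\<dots> = (2 * (1 - t)) *\<^sub>R p k + (2 * t) *\<^sub>R p (Suc k)"
  proof -
    have "2 / sqrt 2 = sqrt 2" by (simp add: real_div_sqrt)
    then have "(2 * a) *\<^sub>R p j = (sqrt 2 * a) *\<^sub>R z (2 * j)" for a j
      by (simp add: p_def mult.commute flip: times_divide_eq_right)
    from this[of "1 - t" k] this[of t "Suc k"] show ?thesis by simp
  qed
  finally show ?thesis using t by blast
qed

lemma P_normal_x: "P.edge_normal k \<bullet> x k = 2"
proof -
  obtain t where "x k = (2 * (1 - t)) *\<^sub>R p k + (2 * t) *\<^sub>R p (Suc k)" using x_between by blast
  then show ?thesis by (simp add: inner_add_right P.edge_normal_vertex)
qed

lemma X_normal_p: "X.edge_normal k \<bullet> p (Suc k) = 1"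
proof -
  obtain t where "p (Suc k) = (1 - t) *\<^sub>R x k + t *\<^sub>R x (Suc k)" using p_between by blast
  then show ?thesis by (simp add: inner_add_right X.edge_normal_vertex)
qed

text \<open>Convexity follows from the nesting. The value of the normal is 2 at \<open>x k\<close>
  and 1 at \<open>p (Suc k)\<close>, which lies between \<open>x k\<close> and
  \<open>x (Suc k)\<close>; so it is below 2 at \<open>x (Suc k)\<close>. Half of this point lies
  between \<open>p (Suc k)\<close>, with value 1, and the next inner vertex, whose value must be
  below 1.\<close>

sublocale P: convex_ring m p "\<lambda>k. \<theta> (2 * k)" "\<lambda>k. \<rho> (2 * k) / sqrt 2"
proof
  fix k
  let ?a = "P.edge_normal k"
  obtain t where t: "0 < t" "t < 1" "p (Suc k) = (1 - t) *\<^sub>R x k + t *\<^sub>R x (Suc k)"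
    using p_between by blast
  obtain u where u: "0 < u" "u < 1" "x (Suc k) = (2 * (1 - u)) *\<^sub>R p (Suc k) + (2 * u) *\<^sub>R p (Suc (Suc k))"
    using x_between by blast
  have "?a \<bullet> p (Suc k) = (1 - t) * 2 + t * (?a \<bullet> x (Suc k))"
    by (subst t(3)) (simp add: inner_add_right P_normal_x)
  then have "t * (2 - ?a \<bullet> x (Suc k)) = 1" by (simp add: P.edge_normal_vertex algebra_simps)
  then have "2 - ?a \<bullet> x (Suc k) > 0" using t by (metis zero_less_mult_pos zero_less_one)
  moreover have "?a \<bullet> x (Suc k) = 2 * (1 - u) + 2 * u * (?a \<bullet> p (Suc (Suc k)))"
    by (subst u(3)) (simp add: inner_add_right P.edge_normal_vertex)
  ultimately have "u * (1 - ?a \<bullet> p (Suc (Suc k))) > 0" by (simp add: algebra_simps)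
  then show "?a \<bullet> p (Suc (Suc k)) < 1" using u by (simp add: zero_less_mult_iff)
qed

text \<open>The same exchange between the two polygons: at \<open>x (Suc k)\<close> the value is 1,
  at its half only 1/2, so it is below 1 at the next inner vertex and therefore also at the next
  outer one.\<close>

sublocale X: convex_ring m x "\<lambda>k. \<theta> (2 * k + 1)" "\<lambda>k. \<rho> (2 * k + 1)"
proof
  fix k
  let ?f = "X.edge_normal k"
  obtain t where t: "0 < t" "t < 1"
    "p (Suc (Suc k)) = (1 - t) *\<^sub>R x (Suc k) + t *\<^sub>R x (Suc (Suc k))"
    using p_between by blast
  obtain u where u: "0 < u" "u < 1" "x (Suc k) = (2 * (1 - u)) *\<^sub>R p (Suc k) + (2 * u) *\<^sub>R p (Suc (Suc k))"
    using x_between by blast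
  have "?f \<bullet> x (Suc k) = 2 * (1 - u) + 2 * u * (?f \<bullet> p (Suc (Suc k)))"
    by (subst u(3)) (simp add: inner_add_right X_normal_p)
  then have "1 = 2 - 2 * u + 2 * u * (?f \<bullet> p (Suc (Suc k)))" by (simp add: X.edge_normal_vertex)
  then have "2 * u * (1 - ?f \<bullet> p (Suc (Suc k))) = 1" unfolding right_diff_distrib by linarith
  then have "1 - ?f \<bullet> p (Suc (Suc k)) > 0" using u by (metis mult_pos_pos zero_less_mult_pos zero_less_numeral zero_less_one)
  moreover have "?f \<bullet> p (Suc (Suc k)) = (1 - t) + t * (?f \<bullet> x (Suc (Suc k)))"
    by (subst t(3)) (simp add: inner_add_right X.edge_normal_vertex)
  ultimately have "t * (1 - ?f \<bullet> x (Suc (Suc k))) > 0" by (simp add: algebra_simps)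
  then show "?f \<bullet> x (Suc (Suc k)) < 1" using t by (simp add: zero_less_mult_iff)
qed

lemma succ_distinct: "i < m \<Longrightarrow> Suc i mod m \<noteq> i"
  using m by (cases "Suc i = m") auto

lemma succ_succ_distinct: "i < m \<Longrightarrow> Suc (Suc i mod m) mod m \<noteq> i"
  using m by (cases "Suc i = m"; cases "Suc (Suc i) = m") auto

lemma succ_inj: "i < m \<Longrightarrow> j < m \<Longrightarrow> Suc i mod m = Suc j mod m \<longleftrightarrow> i = j"
  by (cases "Suc i = m"; cases "Suc j = m") auto

text \<open>Half of \<open>x j\<close> is a proper average of two consecutive inner vertices. The
  maximal value needs both of them on the line of the edge \<open>i\<close>, which with at least
  three vertices happens only for \<open>i = j\<close>.\<close>

lemma P_normal_x_le:
  assumes "i < m" "j < m"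
  shows "P.edge_normal i \<bullet> x j \<le> 2" "P.edge_normal i \<bullet> x j = 2 \<longleftrightarrow> i = j"
proof -
  obtain t where t: "0 < t" "t < 1" "x j = (2 * (1 - t)) *\<^sub>R p j + (2 * t) *\<^sub>R p (Suc j)"
    using x_between by blast
  let ?b = "P.edge_normal i \<bullet> p j" and ?c = "P.edge_normal i \<bullet> p (Suc j mod m)"
  have sj: "Suc j mod m < m" using m by simp
  have e: "P.edge_normal i \<bullet> x j = 2 * ((1 - t) * ?b + t * ?c)"
    unfolding t(3) P.w_mod[of "Suc j"] by (simp add: inner_add_right)
  have b: "?b \<le> 1" "?b = 1 \<longleftrightarrow> j = i \<or> j = Suc i mod m" using P.normal_vertex[OF assms] .
  have c: "?c \<le> 1" "?c = 1 \<longleftrightarrow> Suc j mod m = i \<or> Suc j mod m = Suc i mod m"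
    using P.normal_vertex[OF assms(1) sj] .
  define A B where "A = (1 - t) * (1 - ?b)" and "B = t * (1 - ?c)"
  have d: "P.edge_normal i \<bullet> x j = 2 - 2 * A - 2 * B"
    unfolding e A_def B_def by (simp add: algebra_simps)
  have nn: "A \<ge> 0" "B \<ge> 0" using t b c by (simp_all add: A_def B_def)
  show "P.edge_normal i \<bullet> x j \<le> 2" unfolding d using nn by simp
  have "P.edge_normal i \<bullet> x j = 2 \<longleftrightarrow> A = 0 \<and> B = 0"
    unfolding d using nn by auto
  also have "\<dots> \<longleftrightarrow> ?b = 1 \<and> ?c = 1" using t by (auto simp: A_def B_def)
  also have "\<dots> \<longleftrightarrow> i = j"
    unfolding b(2) c(2)
    using succ_distinct[OF assms(1)] succ_distinct[OF assms(2)] succ_succ_distinct[OF assms(1)]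
      succ_succ_distinct[OF assms(2)] succ_inj[OF assms] by auto
  finally show "P.edge_normal i \<bullet> x j = 2 \<longleftrightarrow> i = j" .
qed

text \<open>The normal of the outer edge through \<open>p i\<close>, which runs from
  \<open>x (i - 1)\<close> to \<open>x i\<close>; adding \<open>m - 1\<close> is subtraction of 1
  modulo \<open>m\<close>.\<close>

definition f :: "nat \<Rightarrow> complex" where "f i = X.edge_normal (i + (m - 1))"

lemma f_Suc: "f (Suc i) = X.edge_normal i"
proof -
  have "Suc i + (m - 1) = i + m" using m by simp
  then show ?thesis unfolding f_def by (simp only: X.edge_normal_period)
qed

lemma f_mod: "f (i mod m) = f i"
proof -
  have "(i mod m + (m - 1)) mod m = (i + (m - 1)) mod m" by (simp add: mod_add_left_eq)
  then show ?thesis unfolding f_def by (metis X.edge_normal_mod)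
qed

lemma pred_ex: assumes "i < m" obtains i' where "i' < m" "i = Suc i' mod m"
proof (cases i)
  case 0
  then show thesis using that[of "m - 1"] m by simp
next
  case (Suc k)
  then show thesis using that[of k] assms by simp
qed

lemma f_x_le:
  assumes "i < m" "j < m"
  shows "f i \<bullet> x j \<le> 1" "f i \<bullet> x j = 1 \<longleftrightarrow> i = j \<or> i = Suc j mod m"
proof -
  obtain i' where i': "i' < m" "i = Suc i' mod m" using pred_ex[OF assms(1)] .
  have fi: "f i = X.edge_normal i'" unfolding i'(2) f_mod f_Suc ..
  show "f i \<bullet> x j \<le> 1" unfolding fi using X.normal_vertex(1)[OF i'(1) assms(2)] .
  show "f i \<bullet> x j = 1 \<longleftrightarrow> i = j \<or> i = Suc j mod m"
    unfolding fi X.normal_vertex(2)[OF i'(1) assms(2)]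
    using succ_inj[OF i'(1) assms(2)] i'(2) by auto
qed

lemma f_p_le:
  assumes "i < m" "j < m"
  shows "f i \<bullet> p j \<le> 1" "f i \<bullet> p j = 1 \<longleftrightarrow> i = j"
proof -
  obtain i' where i': "i' < m" "i = Suc i' mod m" using pred_ex[OF assms(1)] .
  obtain j' where j': "j' < m" "j = Suc j' mod m" using pred_ex[OF assms(2)] .
  have fi: "f i = X.edge_normal i'" unfolding i'(2) f_mod f_Suc ..
  obtain t where t: "0 < t" "t < 1" "p (Suc j') = (1 - t) *\<^sub>R x j' + t *\<^sub>R x (Suc j')"
    using p_between by blast
  let ?b = "f i \<bullet> x j'" and ?c = "f i \<bullet> x (Suc j' mod m)"
  have sj: "Suc j' mod m < m" using m by simp
  have e: "f i \<bullet> p j = (1 - t) * ?b + t * ?c"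
    unfolding j'(2) P.w_mod t(3) X.w_mod[of "Suc j'"] by (simp add: inner_add_right)
  have b: "?b \<le> 1" "?b = 1 \<longleftrightarrow> i = j' \<or> i = Suc j' mod m" using f_x_le[OF assms(1) j'(1)] .
  have c: "?c \<le> 1" "?c = 1 \<longleftrightarrow> i = Suc j' mod m \<or> i = Suc (Suc j' mod m) mod m"
    using f_x_le[OF assms(1) sj] .
  define A B where "A = (1 - t) * (1 - ?b)" and "B = t * (1 - ?c)"
  have d: "1 - f i \<bullet> p j = A + B"
    unfolding e A_def B_def by (simp add: algebra_simps)
  have nn: "A \<ge> 0" "B \<ge> 0" using t b c by (simp_all add: A_def B_def)
  show "f i \<bullet> p j \<le> 1" using d nn by linarith
  have "f i \<bullet> p j = 1 \<longleftrightarrow> A = 0 \<and> B = 0"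
    using d nn by linarith
  also have "\<dots> \<longleftrightarrow> ?b = 1 \<and> ?c = 1" using t by (auto simp: A_def B_def)
  also have "\<dots> \<longleftrightarrow> i = j"
    unfolding b(2) c(2) j'(2)
    using succ_distinct[OF j'(1)] succ_succ_distinct[OF j'(1)] by auto
  finally show "f i \<bullet> p j = 1 \<longleftrightarrow> i = j" .
qed

section \<open>Covering the inner polygon and the outer triangles\<close>

lemma p_in: "p k \<in> p ` {..<m}"
  using P.w_mod[of k] m by (metis imageI lessThan_iff less_le_trans mod_less_divisor zero_less_numeral)

lemma zero_in_hull: "0 \<in> convex hull (p ` {..<m})"
proof -
  obtain k \<alpha> \<beta> where k: "- p 0 = \<alpha> *\<^sub>R p k + \<beta> *\<^sub>R p (Suc k)" "\<alpha> \<ge> 0" "\<beta> \<ge> 0"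
    by (rule P.fan)
  define s where "s = 1 + \<alpha> + \<beta>"
  have s: "s > 0" using k by (simp add: s_def)
  have eq: "(1 / s) *\<^sub>R p 0 + (\<alpha> / s) *\<^sub>R p k + (\<beta> / s) *\<^sub>R p (Suc k) = 0"
  proof -
    have "p 0 + \<alpha> *\<^sub>R p k + \<beta> *\<^sub>R p (Suc k) = 0" using k(1) by (simp add: add.assoc flip: k(1))
    then have "(1 / s) *\<^sub>R (p 0 + \<alpha> *\<^sub>R p k + \<beta> *\<^sub>R p (Suc k)) = 0" by simp
    then show ?thesis by (simp add: scaleR_add_right)
  qed
  have "(1 / s) *\<^sub>R p 0 + (\<alpha> / s) *\<^sub>R p k + (\<beta> / s) *\<^sub>R p (Suc k) \<in> convex hull {p 0, p k, p (Suc k)}"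
    using s k(2,3) by (intro in_convex_hull_3) (auto simp: s_def add_divide_distrib[symmetric])
  moreover have "convex hull {p 0, p k, p (Suc k)} \<subseteq> convex hull (p ` {..<m})"
    using p_in by (intro hull_mono) auto
  ultimately show ?thesis unfolding eq by blast
qed

text \<open>The maximum of the edge normals is the gauge of the inner polygon. For
  \<open>t = 0\<close> the point must be 0; this occurs at the apexes in the product, where the
  other coordinate vanishes.\<close>

lemma scaled_hull:
  assumes t: "t \<ge> 0" and le: "\<And>i. i < m \<Longrightarrow> P.edge_normal i \<bullet> y \<le> t"
  shows "\<exists>u \<in> convex hull (p ` {..<m}). y = t *\<^sub>R u"
proof -
  obtain k \<alpha> \<beta> where k: "y = \<alpha> *\<^sub>R p k + \<beta> *\<^sub>R p (Suc k)" "\<alpha> \<ge> 0" "\<beta> \<ge> 0"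
    by (rule P.fan)
  have "P.edge_normal k \<bullet> y \<le> t" using le[of "k mod m"] m by (simp add: P.edge_normal_mod)
  then have st: "\<alpha> + \<beta> \<le> t" unfolding k(1) by (simp add: inner_add_right P.edge_normal_vertex)
  show ?thesis
  proof (cases "t = 0")
    case True
    then have "\<alpha> = 0" "\<beta> = 0" using st k by auto
    then show ?thesis using zero_in_hull True k(1) by auto
  next
    case False
    then have t: "t > 0" using assms by simp
    let ?u = "(\<alpha> / t) *\<^sub>R p k + (\<beta> / t) *\<^sub>R p (Suc k) + (1 - \<alpha> / t - \<beta> / t) *\<^sub>R 0"
    have "(\<alpha> + \<beta>) / t \<le> 1" using st t by simp
    then have "?u \<in> convex hull {p k, p (Suc k), 0}"
      using t k(2,3) by (intro in_convex_hull_3) (auto simp: add_divide_distrib)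
    moreover have "convex hull {p k, p (Suc k), 0} \<subseteq> convex hull (p ` {..<m})"
      using p_in zero_in_hull by (intro hull_minimal) (auto intro: hull_inc)
    moreover have "y = t *\<^sub>R ?u" using t k(1) by (simp add: scaleR_add_right)
    ultimately show ?thesis by blast
  qed
qed

text \<open>Between the two polygons lie triangles, each with an inner edge as base and an outer
  vertex as opposite corner. The edge normal is 1 on the base and 2 at the corner, so
  \<open>s - 1\<close> is the weight of the corner.\<close>

lemma outer_triangle:
  assumes f: "\<And>i. i < m \<Longrightarrow> f i \<bullet> y \<le> 1"
    and le: "\<And>i. i < m \<Longrightarrow> P.edge_normal i \<bullet> y \<le> s"
    and ex: "\<exists>i<m. P.edge_normal i \<bullet> y = s" and s: "s \<ge> 1"
  shows "\<exists>i<m. \<exists>u \<in> convex hull {p i, p (Suc i mod m)}. y = (s - 1) *\<^sub>R x i + (2 - s) *\<^sub>R u \<and> s \<le> 2"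
proof -
  obtain k0 \<alpha> \<beta> where k0: "y = \<alpha> *\<^sub>R p k0 + \<beta> *\<^sub>R p (Suc k0)" "\<alpha> \<ge> 0" "\<beta> \<ge> 0"
    by (rule P.fan)
  define k where "k = k0 mod m"
  have km: "k < m" using m by (simp add: k_def)
  have pk: "p k0 = p k" "p (Suc k0) = p (Suc k)"
    using P.w_mod[of k0] P.w_mod[of "Suc k0"] P.w_mod[of "Suc k"] by (simp_all add: k_def mod_Suc_eq)
  have k: "y = \<alpha> *\<^sub>R p k + \<beta> *\<^sub>R p (Suc k)" using k0 pk by simp
  have ay: "P.edge_normal k \<bullet> y = \<alpha> + \<beta>"
    unfolding k by (simp add: inner_add_right P.edge_normal_vertex)
  \<comment> \<open>All edge normals are at most 1 at the vertices of the sector, so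
    \<open>\<alpha> + \<beta>\<close>, the value for the edge in this sector, is the
    maximum.\<close>
  have "\<alpha> + \<beta> = s"
  proof -
    obtain i where i: "i < m" "P.edge_normal i \<bullet> y = s" using ex by blast
    have sk: "Suc k mod m < m" using m by simp
    have "P.edge_normal i \<bullet> p k \<le> 1" "P.edge_normal i \<bullet> p (Suc k) \<le> 1"
      using P.normal_vertex(1)[OF i(1) km] P.normal_vertex(1)[OF i(1) sk] P.w_mod[of "Suc k"] by auto
    then have "\<alpha> * (P.edge_normal i \<bullet> p k) \<le> \<alpha> * 1" "\<beta> * (P.edge_normal i \<bullet> p (Suc k)) \<le> \<beta> * 1"
      using k0 by (intro mult_left_mono; simp)+
    then have "s \<le> \<alpha> + \<beta>" using i(2) unfolding k by (simp add: inner_add_right)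
    then show ?thesis using le[OF km] ay by simp
  qed
  obtain t where t: "0 < t" "t < 1" "x k = (2 * (1 - t)) *\<^sub>R p k + (2 * t) *\<^sub>R p (Suc k)"
    using x_between by blast
  have fk: "f k \<bullet> p k = 1" "f k \<bullet> x k = 1" "f (Suc k mod m) \<bullet> p (Suc k) = 1" "f (Suc k mod m) \<bullet> x k = 1"
    using f_p_le(2)[OF km km] f_x_le(2)[OF km km] P.w_mod[of "Suc k"]
      f_p_le(2)[of "Suc k mod m" "Suc k mod m"] f_x_le(2)[of "Suc k mod m" k] km m by auto
  \<comment> \<open>The outer line with normal \<open>f k\<close> joins \<open>p k\<close> and
    \<open>x k\<close>. That \<open>y\<close> does not lie beyond this side of the triangle bounds
    \<open>\<beta>\<close> from below; the other side bounds \<open>\<alpha>\<close>.\<close>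
  have "\<beta> \<ge> 2 * t * (s - 1)"
  proof -
    have "1 = 2 * (1 - t) + 2 * t * (f k \<bullet> p (Suc k))"
      using fk(2) unfolding t(3) by (simp add: inner_add_right fk)
    then have e: "2 * t * (1 - f k \<bullet> p (Suc k)) = 1" unfolding right_diff_distrib by linarith
    have "\<alpha> + \<beta> * (f k \<bullet> p (Suc k)) \<le> 1" using f[OF km] unfolding k by (simp add: inner_add_right fk)
    then have "s - 1 \<le> \<beta> * (1 - f k \<bullet> p (Suc k))" using \<open>\<alpha> + \<beta> = s\<close> by (simp add: algebra_simps)
    then have "2 * t * (s - 1) \<le> 2 * t * (\<beta> * (1 - f k \<bullet> p (Suc k)))" using t by simp
    also have "\<dots> = \<beta> * (2 * t * (1 - f k \<bullet> p (Suc k)))" by (simp add: algebra_simps)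
    finally show ?thesis unfolding e by simp
  qed
  moreover have "\<alpha> \<ge> 2 * (1 - t) * (s - 1)"
  proof -
    let ?g = "f (Suc k mod m)"
    have gm: "Suc k mod m < m" using m by simp
    have "1 = 2 * (1 - t) * (?g \<bullet> p k) + 2 * t"
      using fk(4) unfolding t(3) by (simp add: inner_add_right fk)
    then have e: "2 * (1 - t) * (1 - ?g \<bullet> p k) = 1" by (simp add: algebra_simps)
    have "\<alpha> * (?g \<bullet> p k) + \<beta> \<le> 1" using f[OF gm] unfolding k by (simp add: inner_add_right fk)
    then have "s - 1 \<le> \<alpha> * (1 - ?g \<bullet> p k)" using \<open>\<alpha> + \<beta> = s\<close> by (simp add: algebra_simps)
    then have "2 * (1 - t) * (s - 1) \<le> 2 * (1 - t) * (\<alpha> * (1 - ?g \<bullet> p k))"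
      using t by (intro mult_left_mono) auto
    also have "\<dots> = \<alpha> * (2 * (1 - t) * (1 - ?g \<bullet> p k))" by (simp add: algebra_simps)
    finally show ?thesis unfolding e by simp
  qed
  \<comment> \<open>The coordinates that remain after removing the share of the corner
    \<open>x k\<close>.\<close>
  moreover define a b where "a = \<alpha> - 2 * (1 - t) * (s - 1)" and "b = \<beta> - 2 * t * (s - 1)"
  ultimately have ab: "a \<ge> 0" "b \<ge> 0" "a + b = 2 - s" using \<open>\<alpha> + \<beta> = s\<close> by (auto simp: algebra_simps)
  have y: "y = (s - 1) *\<^sub>R x k + (a *\<^sub>R p k + b *\<^sub>R p (Suc k mod m))"
    unfolding k t(3) P.w_mod[of "Suc k"] a_def b_def by (simp add: algebra_simps)
  have "\<exists>u \<in> convex hull {p k, p (Suc k mod m)}. a *\<^sub>R p k + b *\<^sub>R p (Suc k mod m) = (2 - s) *\<^sub>R u"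
  proof (cases "s = 2")
    case True
    then have "a = 0" "b = 0" using ab by auto
    then show ?thesis using True by (intro bexI[of _ "p k"]) (auto simp: hull_inc)
  next
    case False
    then have s2: "2 - s > 0" using ab by simp
    let ?u = "(a / (2 - s)) *\<^sub>R p k + (b / (2 - s)) *\<^sub>R p (Suc k mod m)"
    have "?u \<in> convex hull {p k, p (Suc k mod m)}"
      using s2 ab by (intro in_convex_hull_2) (auto simp: add_divide_distrib[symmetric])
    moreover have "a *\<^sub>R p k + b *\<^sub>R p (Suc k mod m) = (2 - s) *\<^sub>R ?u"
      using s2 by (simp add: scaleR_add_right)
    ultimately show ?thesis by blast
  qed
  then obtain u where "u \<in> convex hull {p k, p (Suc k mod m)}"
    "a *\<^sub>R p k + b *\<^sub>R p (Suc k mod m) = (2 - s) *\<^sub>R u" by blast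
  then have "\<exists>u \<in> convex hull {p k, p (Suc k mod m)}. y = (s - 1) *\<^sub>R x k + (2 - s) *\<^sub>R u \<and> s \<le> 2"
    using y ab by auto
  then show ?thesis using km by blast
qed

end

section \<open>Existence of nested polygons\<close>

definition mid :: "complex \<Rightarrow> complex \<Rightarrow> complex \<Rightarrow> bool" where
  "mid a b c \<longleftrightarrow> (\<exists>t. 0 < t \<and> t < 1 \<and> (1 / sqrt 2) *\<^sub>R b = (1 - t) *\<^sub>R a + t *\<^sub>R c)"

lemma mid_sym: "mid a b c \<Longrightarrow> mid c b a"
  unfolding mid_def
proof (elim exE conjE)
  fix t :: real assume "0 < t" "t < 1" "(1 / sqrt 2) *\<^sub>R b = (1 - t) *\<^sub>R a + t *\<^sub>R c"
  then show "\<exists>t. 0 < t \<and> t < 1 \<and> (1 / sqrt 2) *\<^sub>R b = (1 - t) *\<^sub>R c + t *\<^sub>R a"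
    by (intro exI[of _ "1 - t"]) (simp add: add.commute)
qed

definition mirror :: "complex \<Rightarrow> complex" where "mirror z = Complex (- Re z) (Im z)"

lemma mirror_simps [simp]: "Re (mirror z) = - Re z" "Im (mirror z) = Im z" "mirror (mirror z) = z"
  by (simp_all add: mirror_def)

lemma mid_mirror: "mid a b c \<Longrightarrow> mid (mirror a) (mirror b) (mirror c)"
  unfolding mid_def complex_eq_iff by (elim exE, rule exI) (auto simp: algebra_simps)

text \<open>Coordinates of the right half plane: the slope and the reciprocal of the abscissa. On a
  line \<open>\<alpha> * Re z + \<beta> * Im z = 1\<close> they satisfy
  \<open>g = \<alpha> + \<beta> * y\<close>.\<close>

definition chart :: "real \<Rightarrow> real \<Rightarrow> complex" where "chart g y = Complex (1 / g) (y / g)"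

text \<open>Scaling a point by \<open>1 / sqrt 2\<close> multiplies its \<open>g\<close> by
  \<open>sqrt 2\<close>. So \<open>eq\<close> says that affine interpolation of \<open>g1\<close>
  and \<open>g2\<close> at the slope \<open>y\<close> gives the scaled point.\<close>

lemma mid_chart:
  assumes g: "g > 0" "g1 > 0" "g2 > 0" and y: "y1 < y" "y < y2"
    and eq: "g1 * (y2 - y) + g2 * (y - y1) = sqrt 2 * g * (y2 - y1)"
  shows "mid (chart g1 y1) (chart g y) (chart g2 y2)"
proof -
  \<comment> \<open>The interpolation weight for slopes, changed by the factor
    \<open>g2 / (sqrt 2 * g)\<close> to a weight for points.\<close>
  define t where "t = g2 * (y - y1) / (sqrt 2 * g * (y2 - y1))"
  have pos: "sqrt 2 * g * (y2 - y1) > 0" using g y by simp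
  have t1: "1 - t = g1 * (y2 - y) / (sqrt 2 * g * (y2 - y1))"
  proof -
    have "g1 * (y2 - y) = sqrt 2 * g * (y2 - y1) - g2 * (y - y1)" using eq by simp
    then show ?thesis using g y unfolding t_def by (simp add: diff_divide_distrib)
  qed
  have "t > 0" "1 - t > 0" unfolding t1 unfolding t_def using g y by simp_all
  moreover have "(1 / sqrt 2) *\<^sub>R chart g y = (1 - t) *\<^sub>R chart g1 y1 + t *\<^sub>R chart g2 y2"
  proof -
    have "(y2 - y) + (y - y1) = y2 - y1" "(y2 - y) * y1 + (y - y1) * y2 = y * (y2 - y1)"
      by (simp_all add: algebra_simps)
    then have "(y2 - y) / (sqrt 2 * g * (y2 - y1)) + (y - y1) / (sqrt 2 * g * (y2 - y1)) = 1 / (sqrt 2 * g)"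
      "(y2 - y) * y1 / (sqrt 2 * g * (y2 - y1)) + (y - y1) * y2 / (sqrt 2 * g * (y2 - y1)) = y / (sqrt 2 * g)"
      using y g unfolding add_divide_distrib[symmetric] by simp_all
    then show ?thesis
      unfolding t1 unfolding t_def chart_def complex_eq_iff using g by simp
  qed
  ultimately show ?thesis unfolding mid_def by (intro exI[of _ t]) simp
qed

text \<open>
  The ring is symmetric with respect to the imaginary axis.  From the top, its right half consists of
  the points chart (chain j) (1/2^j); the recursion is the condition of mid_chart for these slopes,
  and the value at 1 makes the two topmost points fit with their mirror images.
\<close>

fun chain :: "nat \<Rightarrow> real" where
  "chain 0 = 1"
| "chain (Suc 0) = (3 * sqrt 2 - 1) / 4"
| "chain (Suc (Suc j)) = (3 * sqrt 2 * chain (Suc j) - chain j) / 2"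

text \<open>Because of the minus sign in the recursion, positivity alone is not inductive; the bound
  on the ratio is. The bound is needed again as \<open>B < A\<close> when the ring is closed at the
  bottom.\<close>

lemma chain_pos: "chain j > 0 \<and> chain j < sqrt 2 * chain (Suc j)"
proof (induction j)
  case 0
  have "sqrt 2 < 2" by (simp add: real_less_lsqrt)
  then show ?case by (simp add: algebra_simps)
next
  case (Suc j)
  let ?a = "chain (Suc j)"
  have "sqrt 2 * ?a > 0" using Suc by linarith
  then have a: "?a > 0" by (simp add: zero_less_mult_iff)
  have "chain (Suc (Suc j)) > (3 * sqrt 2 * ?a - sqrt 2 * ?a) / 2"
    using Suc by (simp add: mult.commute)
  then have "chain (Suc (Suc j)) > sqrt 2 * ?a" by simp
  then have "sqrt 2 * chain (Suc (Suc j)) > sqrt 2 * (sqrt 2 * ?a)" by (intro mult_strict_left_mono) simp_all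
  moreover have "sqrt 2 * (sqrt 2 * ?a) = 2 * ?a" by (simp flip: mult.assoc)
  ultimately show ?case using a by linarith
qed

text \<open>The slope of the lowest point, relative to the one above it, closes the ring at the bottom.\<close>

lemma bottom_parameter:
  fixes A B :: real
  assumes "0 < B" "B < A"
  obtains \<tau> where "\<tau> * (sqrt 2 - 1) > sqrt 2 + 1"
    "(A * (2 + \<tau>) - B * (1 + \<tau>)) * ((sqrt 2 - 1) * \<tau> - (sqrt 2 + 1)) = sqrt 2 * A * \<tau>"
proof -
  let ?f = "\<lambda>\<tau>. (A * (2 + \<tau>) - B * (1 + \<tau>)) * ((sqrt 2 - 1) * \<tau> - (sqrt 2 + 1)) - sqrt 2 * A * \<tau>"
  define c where "c = sqrt 2 - 1"
  have c: "c > 0" by (simp add: c_def)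
  \<comment> \<open>At \<open>lo\<close> the second factor vanishes. At \<open>hi\<close> it equals
    \<open>sqrt 2 * A / (A - B)\<close>, which makes the multiples of \<open>hi\<close> cancel and
    leaves a positive constant.\<close>
  define lo where "lo = (sqrt 2 + 1) / c"
  define hi where "hi = (sqrt 2 + 1 + sqrt 2 * A / (A - B)) / c"
  have "sqrt 2 + 1 > (0::real)" by (intro add_pos_pos) auto
  then have lh: "lo < hi" "lo > 0" using assms c by (auto simp: lo_def hi_def divide_strict_right_mono)
  have "c * lo = sqrt 2 + 1" using c by (simp add: lo_def)
  then have flo: "?f lo < 0" unfolding c_def[symmetric] using assms lh by simp
  have "c * hi - (sqrt 2 + 1) = sqrt 2 * A / (A - B)" using c by (simp add: hi_def)
  then have "?f hi = ((A - B) * hi + (2 * A - B)) * (sqrt 2 * A / (A - B)) - sqrt 2 * A * hi"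
    unfolding c_def[symmetric] by (simp add: algebra_simps)
  also have "\<dots> = (2 * A - B) * (sqrt 2 * A / (A - B))"
  proof -
    have "((A - B) * hi + (2 * A - B)) * K = hi * ((A - B) * K) + (2 * A - B) * K" for K
      by (simp add: algebra_simps)
    from this[of "sqrt 2 * A / (A - B)"] show ?thesis using assms by simp
  qed
  also have "\<dots> > 0" using assms by (intro mult_pos_pos divide_pos_pos) auto
  finally have fhi: "?f hi > 0" .
  have "\<exists>\<tau>\<ge>lo. \<tau> \<le> hi \<and> ?f \<tau> = 0"
    using flo fhi lh by (intro IVT') (auto intro!: continuous_intros)
  then obtain \<tau> where \<tau>: "\<tau> \<ge> lo" "?f \<tau> = 0" by blast
  have "\<tau> \<noteq> lo" using \<tau>(2) flo by auto
  then have "\<tau> > lo" using \<tau> by simp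
  then have "\<tau> * c > sqrt 2 + 1" using c by (simp add: lo_def field_simps)
  then show thesis using that[of \<tau>] \<tau>(2) by (simp add: c_def)
qed

lemma mid_top: "mid (chart (chain 1) (1/2)) (chart 1 1) (mirror (chart 1 1))"
proof -
  \<comment> \<open>The two coordinates of the equation give
    \<open>(1 - t) / chain 1 = 4 * t\<close> and \<open>3 * t = 1 / sqrt 2\<close>. This is also the
    origin of the value of \<open>chain 1\<close>.\<close>
  define t where "t = sqrt 2 / 6"
  have s2: "sqrt 2 < 2" by (simp add: real_less_lsqrt)
  have t: "0 < t" "t < 1" using s2 by (auto simp: t_def)
  have "3 * sqrt 2 - 1 \<noteq> 0" using chain_pos[of 1] by auto
  have r: "1 / sqrt 2 = sqrt 2 / 2" by (simp add: field_simps)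
  have "1 - t = (2 * sqrt 2 / 3) * chain 1"
    by (simp add: t_def algebra_simps)
  then have E: "(1 - t) / chain 1 = 2 * sqrt 2 / 3"
    using chain_pos[of 1] by (simp add: nonzero_divide_eq_eq del: chain.simps One_nat_def)
  have re: "1 / sqrt 2 = (1 - t) / chain 1 - t" and im: "1 / sqrt 2 = ((1 - t) / chain 1) / 2 + t"
    unfolding E r by (simp_all add: t_def)
  have "(1 / sqrt 2) *\<^sub>R chart 1 1 = (1 - t) *\<^sub>R chart (chain 1) (1/2) + t *\<^sub>R mirror (chart 1 1)"
  proof (rule complex_eqI)
    have "Re ((1 / sqrt 2) *\<^sub>R chart 1 1) = 1 / sqrt 2" by (simp add: chart_def)
    also note re
    also have "(1 - t) / chain 1 - t = Re ((1 - t) *\<^sub>R chart (chain 1) (1/2) + t *\<^sub>R mirror (chart 1 1))"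
      by (simp add: chart_def del: chain.simps)
    finally show "Re ((1 / sqrt 2) *\<^sub>R chart 1 1) = Re ((1 - t) *\<^sub>R chart (chain 1) (1/2) + t *\<^sub>R mirror (chart 1 1))" .
    have "Im ((1 / sqrt 2) *\<^sub>R chart 1 1) = 1 / sqrt 2" by (simp add: chart_def)
    also note im
    also have "((1 - t) / chain 1) / 2 + t = Im ((1 - t) *\<^sub>R chart (chain 1) (1/2) + t *\<^sub>R mirror (chart 1 1))"
      by (simp add: chart_def mult.commute del: chain.simps)
    finally show "Im ((1 / sqrt 2) *\<^sub>R chart 1 1) = Im ((1 - t) *\<^sub>R chart (chain 1) (1/2) + t *\<^sub>R mirror (chart 1 1))" .
  qed
  then show ?thesis unfolding mid_def using t by blast
qed

text \<open>The mirror image lies in the left half plane, out of reach of \<open>mid_chart\<close>.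
  The first hypothesis makes the weight of the upper point positive, and \<open>eq\<close> is what
  remains of the two coordinates once the weight is known.\<close>

lemma mid_bottom:
  assumes \<tau>: "\<tau> * (sqrt 2 - 1) > sqrt 2 + 1" and g: "g > 0" "G > 0"
    and eq: "g * ((sqrt 2 - 1) * \<tau> - (sqrt 2 + 1)) = 2 * \<tau> * G"
  shows "mid (mirror (chart g (- \<tau> * \<eta>))) (chart g (- \<tau> * \<eta>)) (chart G \<eta>)"
proof -
  have s2: "1 < sqrt 2" by simp
  have "\<tau> > 1"
  proof (rule ccontr)
    assume "\<not> \<tau> > 1"
    then have "\<tau> * (sqrt 2 - 1) \<le> 1 * (sqrt 2 - 1)" using s2 by (intro mult_right_mono) auto
    then show False using less_le_trans[OF \<tau>] by fastforce
  qed
  \<comment> \<open>Eliminating \<open>G\<close> from the two coordinates gives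
    \<open>(1 - t) * (\<tau> - 1) = (\<tau> + 1) / sqrt 2\<close>.\<close>
  define t where "t = ((sqrt 2 - 1) * \<tau> - (sqrt 2 + 1)) / (sqrt 2 * (\<tau> - 1))"
  have t1: "1 - t = (\<tau> + 1) / (sqrt 2 * (\<tau> - 1))"
    using \<open>\<tau> > 1\<close> unfolding t_def by (simp add: field_simps)
  have t: "t > 0" "1 - t > 0" unfolding t1 unfolding t_def using \<tau> \<open>\<tau> > 1\<close> by (auto simp: mult.commute)
  have tG: "t / G = 2 * \<tau> / (sqrt 2 * (\<tau> - 1)) / g"
  proof -
    have "(sqrt 2 - 1) * \<tau> - (sqrt 2 + 1) = 2 * \<tau> * G / g" using eq g by (simp add: field_simps)
    then show ?thesis using g by (simp add: t_def)
  qed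
  let ?D = "sqrt 2 * (\<tau> - 1)"
  have e1: "1 / sqrt 2 = - (1 - t) + 2 * \<tau> / ?D"
  proof -
    have "- (1 - t) + 2 * \<tau> / ?D = (2 * \<tau> - (\<tau> + 1)) / ?D" unfolding t1 diff_divide_distrib by simp
    also have "2 * \<tau> - (\<tau> + 1) = \<tau> - 1" by simp
    finally show ?thesis using \<open>\<tau> > 1\<close> by simp
  qed
  have e2: "- \<tau> / sqrt 2 = - \<tau> * (1 - t) + 2 * \<tau> / ?D"
  proof -
    have "- \<tau> * (1 - t) + 2 * \<tau> / ?D = (2 * \<tau> - \<tau> * (\<tau> + 1)) / ?D" unfolding t1 diff_divide_distrib by simp
    also have "2 * \<tau> - \<tau> * (\<tau> + 1) = - \<tau> * (\<tau> - 1)" by (simp add: algebra_simps)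
    finally show ?thesis using \<open>\<tau> > 1\<close> by simp
  qed
  have "1 / sqrt 2 * (1 / g) = - (1 - t) / g + t / G"
    unfolding tG e1 by (simp add: add_divide_distrib diff_divide_distrib)
  moreover have "1 / sqrt 2 * (- \<tau> * \<eta> / g) = (1 - t) * (- \<tau> * \<eta> / g) + t * (\<eta> / G)"
  proof -
    have "1 / sqrt 2 * (- \<tau> * \<eta> / g) = (- \<tau> / sqrt 2) * (\<eta> / g)" by simp
    also have "\<dots> = (1 - t) * (- \<tau> * \<eta> / g) + (2 * \<tau> / (sqrt 2 * (\<tau> - 1)) / g) * \<eta>"
      unfolding e2 by (simp add: algebra_simps diff_divide_distrib)
    also have "\<dots> = (1 - t) * (- \<tau> * \<eta> / g) + t * (\<eta> / G)" unfolding tG[symmetric] by simp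
    finally show ?thesis .
  qed
  moreover have "(t - 1) / g = - ((1 - t) / g)" unfolding minus_divide_left by simp
  ultimately have "(1 / sqrt 2) *\<^sub>R chart g (- \<tau> * \<eta>)
      = (1 - t) *\<^sub>R mirror (chart g (- \<tau> * \<eta>)) + t *\<^sub>R chart G \<eta>"
    unfolding complex_eq_iff by (simp add: chart_def)
  then show ?thesis unfolding mid_def using t by (intro exI[of _ t]) simp
qed

lemma right_chain:
  assumes m: "m \<ge> 3"
  obtains g y :: "nat \<Rightarrow> real" where
    "\<And>k. k < m \<Longrightarrow> g k > 0" "\<And>k. Suc k < m \<Longrightarrow> y k < y (Suc k)" "y 0 < 0" "y (m - 1) > 0"
    "\<And>k. Suc (Suc k) < m \<Longrightarrow>
      mid (chart (g k) (y k)) (chart (g (Suc k)) (y (Suc k))) (chart (g (Suc (Suc k))) (y (Suc (Suc k))))"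
    "mid (chart (g (m - 2)) (y (m - 2))) (chart (g (m - 1)) (y (m - 1))) (mirror (chart (g (m - 1)) (y (m - 1))))"
    "mid (mirror (chart (g 0) (y 0))) (chart (g 0) (y 0)) (chart (g 1) (y 1))"
proof -
  define n where "n = m - 3"
  have mn: "m = n + 3" using m by (simp add: n_def)
  let ?A = "sqrt 2 * chain (Suc n)" and ?B = "chain n"
  have AB: "0 < ?B" "?B < ?A" using chain_pos[of n] by auto
  obtain \<tau> where \<tau>: "\<tau> * (sqrt 2 - 1) > sqrt 2 + 1"
    "(?A * (2 + \<tau>) - ?B * (1 + \<tau>)) * ((sqrt 2 - 1) * \<tau> - (sqrt 2 + 1)) = sqrt 2 * ?A * \<tau>"
    using bottom_parameter[OF AB] by blast
  have \<tau>0: "\<tau> > 0"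
  proof -
    have "\<tau> * (sqrt 2 - 1) > 0" by (rule less_trans[OF _ \<tau>(1)]) (simp add: add_pos_pos)
    then show ?thesis by (simp add: zero_less_mult_iff)
  qed
  \<comment> \<open>The condition of \<open>mid_chart\<close> for the three lowest points, solved
    for the value at the lowest one. Inserted into the condition of \<open>mid_bottom\<close>, it
    gives the equation for \<open>\<tau>\<close>.\<close>
  define G where "G = ?A * (2 + \<tau>) - ?B * (1 + \<tau>)"
  have G0: "G > 0"
  proof -
    have "?B * (1 + \<tau>) < ?A * (1 + \<tau>)" using AB \<tau>0 by (intro mult_strict_right_mono) auto
    moreover have "?A * (2 + \<tau>) = ?A * (1 + \<tau>) + ?A" by (simp add: algebra_simps)
    moreover have "?A > 0" using AB by linarith
    ultimately show ?thesis unfolding G_def by linarith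
  qed
  define \<eta> :: real where "\<eta> = (1/2) ^ Suc n"
  have \<eta>: "\<eta> > 0" "(1/2) ^ n = 2 * \<eta>" by (simp_all add: \<eta>_def)
  \<comment> \<open>Index 0 is the lowest point; from index 1 upwards \<open>chain\<close> is run
    through backwards, ending with \<open>chain 0\<close> at the top.\<close>
  define g where "g k = (if k = 0 then G else chain (m - 1 - k))" for k
  define y where "y k = (if k = 0 then - \<tau> * \<eta> else (1/2) ^ (m - 1 - k))" for k
  have g1: "g (Suc k) = chain (n + 1 - k)" and y1: "y (Suc k) = (1/2) ^ (n + 1 - k)" for k
    by (simp_all add: g_def y_def mn)
  have g0: "g 0 = G" "y 0 = - \<tau> * \<eta>" by (simp_all add: g_def y_def)
  show thesis
  proof (rule that[of g y])
    show "g k > 0" if "k < m" for k using G0 chain_pos by (simp add: g_def)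
    show "y 0 < 0" using \<tau>0 \<eta> by (simp add: g0)
    show "y (m - 1) > 0" by (simp add: y_def mn)
    show "y k < y (Suc k)" if "Suc k < m" for k
    proof (cases k)
      case 0
      have "y (Suc 0) > 0" by (simp add: y1)
      then show ?thesis using \<open>y 0 < 0\<close> 0 by simp
    next
      case (Suc k')
      then have "n + 1 - k' = Suc (n + 1 - k)" using that mn by simp
      then have "y (Suc k) = 2 * y (Suc k')" using y1[of k] y1[of k'] by simp
      moreover have "y (Suc k') > 0" unfolding y1 by simp
      ultimately show ?thesis using Suc by simp
    qed
    show "mid (chart (g k) (y k)) (chart (g (Suc k)) (y (Suc k))) (chart (g (Suc (Suc k))) (y (Suc (Suc k))))"
      if k: "Suc (Suc k) < m" for k
    proof (cases k)
      case 0
      have "g (Suc 0) = chain (Suc n)" "g (Suc (Suc 0)) = chain n"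
        using g1[of 0] g1[of "Suc 0"] by simp_all
      moreover have "y (Suc 0) = \<eta>" unfolding y1 \<eta>_def by simp
      moreover have "y (Suc (Suc 0)) = 2 * \<eta>" unfolding y1 \<eta>(2)[symmetric] by simp
      moreover have "mid (chart G (- \<tau> * \<eta>)) (chart (chain (Suc n)) \<eta>) (chart (chain n) (2 * \<eta>))"
      proof (rule mid_chart)
        show "- \<tau> * \<eta> < \<eta>" by (rule less_trans[of _ 0]) (use \<tau>0 \<eta> in auto)
        have "G * (2 * \<eta> - \<eta>) + chain n * (\<eta> - - \<tau> * \<eta>) = (G + chain n * (1 + \<tau>)) * \<eta>"
          by (simp add: algebra_simps)
        also have "\<dots> = sqrt 2 * chain (Suc n) * (2 + \<tau>) * \<eta>" by (simp add: G_def)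
        also have "\<dots> = sqrt 2 * chain (Suc n) * (2 * \<eta> - - \<tau> * \<eta>)" by (simp add: algebra_simps)
        finally show "G * (2 * \<eta> - \<eta>) + chain n * (\<eta> - - \<tau> * \<eta>) = sqrt 2 * chain (Suc n) * (2 * \<eta> - - \<tau> * \<eta>)" .
      qed (use G0 chain_pos \<eta> in auto)
      ultimately show ?thesis unfolding 0 g0 by simp
    next
      case (Suc k')
      define j where "j = n - k"
      have j: "n + 1 - k' = Suc (Suc j)" "n + 1 - k = Suc j" "n + 1 - Suc k = j"
        using Suc k mn by (auto simp: j_def)
      let ?c = "(1/2 :: real) ^ Suc (Suc j)"
      have c: "(1/2 :: real) ^ Suc j = 2 * ?c" "(1/2 :: real) ^ j = 4 * ?c" "?c > 0" by simp_all
      have "mid (chart (chain (Suc (Suc j))) ?c) (chart (chain (Suc j)) (2 * ?c)) (chart (chain j) (4 * ?c))"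
      proof (rule mid_chart)
        have "chain (Suc (Suc j)) * (4 * ?c - 2 * ?c) + chain j * (2 * ?c - ?c)
          = (2 * chain (Suc (Suc j)) + chain j) * ?c" by (simp only: algebra_simps)
        also have "2 * chain (Suc (Suc j)) + chain j = 3 * sqrt 2 * chain (Suc j)" by (simp add: diff_divide_distrib)
        also have "3 * sqrt 2 * chain (Suc j) * ?c = sqrt 2 * chain (Suc j) * (4 * ?c - ?c)"
          by (simp add: algebra_simps del: chain.simps)
        finally show "chain (Suc (Suc j)) * (4 * ?c - 2 * ?c) + chain j * (2 * ?c - ?c)
          = sqrt 2 * chain (Suc j) * (4 * ?c - ?c)" .
      qed (use chain_pos in \<open>auto simp del: chain.simps\<close>)
      moreover have e1: "g k = chain (Suc (Suc j))" "y k = ?c" unfolding Suc g1 y1 j(1) by (rule refl)+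
      moreover have e2: "g (Suc k) = chain (Suc j)" "y (Suc k) = 2 * ?c" unfolding g1 y1 j(2) by simp_all
      moreover have e3: "g (Suc (Suc k)) = chain j" "y (Suc (Suc k)) = 4 * ?c" unfolding g1 y1 j(3) by simp_all
      ultimately show ?thesis by (simp only: e1 e2 e3)
    qed
    have e: "g (m - 2) = chain 1" "y (m - 2) = 1/2" "g (m - 1) = 1" "y (m - 1) = 1"
      by (simp_all add: g_def y_def mn)
    show "mid (chart (g (m - 2)) (y (m - 2))) (chart (g (m - 1)) (y (m - 1))) (mirror (chart (g (m - 1)) (y (m - 1))))"
      unfolding e by (rule mid_top)
    have "g 1 = chain (Suc n)" "y 1 = \<eta>" using g1[of 0] y1[of 0] by (simp_all add: \<eta>_def del: chain.simps)
    moreover have "mid (mirror (chart G (- \<tau> * \<eta>))) (chart G (- \<tau> * \<eta>)) (chart (chain (Suc n)) \<eta>)"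
    proof (rule mid_bottom[OF \<tau>(1) G0])
      have "sqrt 2 * ?A * \<tau> = 2 * \<tau> * chain (Suc n)" by (simp flip: mult.assoc)
      then show "G * ((sqrt 2 - 1) * \<tau> - (sqrt 2 + 1)) = 2 * \<tau> * chain (Suc n)"
        using \<tau>(2) unfolding G_def by simp
    qed (use chain_pos in auto)
    ultimately show "mid (mirror (chart (g 0) (y 0))) (chart (g 0) (y 0)) (chart (g 1) (y 1))"
      using g0 by simp
  qed
qed

lemma chart_polar:
  "chart g y = of_real (sqrt (1 + y\<^sup>2) / g) * cis (arctan y)"
  "mirror (chart g y) = of_real (sqrt (1 + y\<^sup>2) / g) * cis (pi - arctan y)"
proof -
  have "sqrt (1 + y\<^sup>2) \<noteq> 0" by (simp add: add_pos_nonneg less_imp_neq[symmetric])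
  then show "chart g y = of_real (sqrt (1 + y\<^sup>2) / g) * cis (arctan y)"
    "mirror (chart g y) = of_real (sqrt (1 + y\<^sup>2) / g) * cis (pi - arctan y)"
    by (simp_all add: chart_def complex_eq_iff cos_arctan sin_arctan)
qed

theorem nested_ring_exists:
  assumes m: "m \<ge> 3"
  shows "\<exists>z \<theta> \<rho>. nested_ring m z \<theta> \<rho>"
proof -
  obtain g y :: "nat \<Rightarrow> real" where
    g: "\<And>k. k < m \<Longrightarrow> g k > 0" and y: "\<And>k. Suc k < m \<Longrightarrow> y k < y (Suc k)" "y 0 < 0" "y (m - 1) > 0"
    and mids: "\<And>k. Suc (Suc k) < m \<Longrightarrow>
      mid (chart (g k) (y k)) (chart (g (Suc k)) (y (Suc k))) (chart (g (Suc (Suc k))) (y (Suc (Suc k))))"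
    and top: "mid (chart (g (m - 2)) (y (m - 2))) (chart (g (m - 1)) (y (m - 1))) (mirror (chart (g (m - 1)) (y (m - 1))))"
    and bottom: "mid (mirror (chart (g 0) (y 0))) (chart (g 0) (y 0)) (chart (g 1) (y 1))"
    using right_chain[OF m] by blast
  define c where "c k = chart (g k) (y k)" for k
  \<comment> \<open>The second half of the ring lists the mirror images from top to bottom, that of
    the point \<open>j\<close> at the index \<open>2 * m - 1 - j\<close>.\<close>
  define z0 where "z0 k = (if k < m then c k else mirror (c (2 * m - 1 - k)))" for k
  define \<theta>0 where "\<theta>0 k = (if k < m then arctan (y k) else pi - arctan (y (2 * m - 1 - k)))" for k
  define \<rho>0 where "\<rho>0 k = (let j = (if k < m then k else 2 * m - 1 - k) in sqrt (1 + (y j)\<^sup>2) / g j)" for k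
  define z where "z k = z0 (k mod (2 * m))" for k
  \<comment> \<open>The multiples of \<open>2 * pi\<close> keep the angles increasing across the
    junction at the bottom.\<close>
  define \<theta> where "\<theta> k = \<theta>0 (k mod (2 * m)) + 2 * pi * real (k div (2 * m))" for k
  define \<rho> where "\<rho> k = \<rho>0 (k mod (2 * m))" for k
  have N: "2 * m > 0" using m by simp
  have polar0: "z0 k = of_real (\<rho>0 k) * cis (\<theta>0 k)" for k
    unfolding z0_def \<rho>0_def \<theta>0_def c_def Let_def using chart_polar by (cases "k < m") simp_all
  have mod_step: "\<exists>i<2 * m. k mod (2 * m) = i \<and> (Suc i < 2 * m \<and> Suc k mod (2 * m) = Suc i \<and> Suc k div (2 * m) = k div (2 * m)
      \<or> Suc i = 2 * m \<and> Suc k mod (2 * m) = 0 \<and> Suc k div (2 * m) = Suc (k div (2 * m)))" for k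
    using N mod_less_divisor[OF N, of k]
    by (intro exI[of _ "k mod (2 * m)"]) (auto simp: mod_Suc div_Suc)
  have at_lt: "- (pi / 2) < arctan t" "arctan t < pi / 2" for t by (rule arctan_lbound arctan_ubound)+
  have step0: "\<theta>0 i < \<theta>0 (Suc i) \<and> \<theta>0 (Suc i) < \<theta>0 i + pi" if "Suc i < 2 * m" for i
  proof -
    consider "Suc i < m" | "Suc i = m" | "Suc i > m" by linarith
    then show ?thesis
    proof cases
      case 1
      then have "arctan (y i) < arctan (y (Suc i))" using y(1) by (simp add: arctan_monotone)
      then show ?thesis using 1 at_lt(1)[of "y i"] at_lt(2)[of "y (Suc i)"] by (simp add: \<theta>0_def)
    next
      case 2
      then have e: "i = m - 1" "2 * m - 1 - m = m - 1" by auto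
      have "arctan (y (m - 1)) > 0" using y(3) by simp
      then show ?thesis using 2 at_lt(2)[of "y (m - 1)"] unfolding \<theta>0_def by (simp add: e)
    next
      case 3
      define j where "j = 2 * m - 1 - Suc i"
      have j: "2 * m - 1 - i = Suc j" "2 * m - 1 - Suc i = j" "Suc j < m" using 3 that by (auto simp: j_def)
      have "arctan (y j) < arctan (y (Suc j))" using y(1) j by (simp add: arctan_monotone)
      then show ?thesis
        using 3 at_lt(1)[of "y j"] at_lt(2)[of "y (Suc j)"] unfolding \<theta>0_def j(1,2) by simp
    qed
  qed
  have wrap0: "\<theta>0 (2 * m - 1) < \<theta>0 0 + 2 * pi \<and> \<theta>0 0 + 2 * pi < \<theta>0 (2 * m - 1) + pi"
  proof -
    have "arctan (y 0) < 0" using y(2) by simp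
    moreover have "\<theta>0 (2 * m - 1) = pi - arctan (y 0)" "\<theta>0 0 = arctan (y 0)" using m by (auto simp: \<theta>0_def)
    ultimately show ?thesis using at_lt(1)[of "y 0"] by simp
  qed
  have step: "\<theta> k < \<theta> (Suc k) \<and> \<theta> (Suc k) < \<theta> k + pi" for k
  proof -
    obtain i where i: "k mod (2 * m) = i"
      "(Suc i < 2 * m \<and> Suc k mod (2 * m) = Suc i \<and> Suc k div (2 * m) = k div (2 * m))
      \<or> (Suc i = 2 * m \<and> Suc k mod (2 * m) = 0 \<and> Suc k div (2 * m) = Suc (k div (2 * m)))"
      using mod_step[of k] by (elim exE conjE)
    from i(2) show ?thesis
    proof (elim disjE conjE)
      assume 1: "Suc i < 2 * m" "Suc k mod (2 * m) = Suc i" "Suc k div (2 * m) = k div (2 * m)"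
      then show ?thesis using step0[of i] i(1) by (simp add: \<theta>_def)
    next
      assume 2: "Suc i = 2 * m" "Suc k mod (2 * m) = 0" "Suc k div (2 * m) = Suc (k div (2 * m))"
      then have "i = 2 * m - 1" by simp
      then show ?thesis using wrap0 2 i(1) by (simp add: \<theta>_def algebra_simps)
    qed
  qed
  have mid0: "mid (z0 i) (z0 (Suc i)) (z0 (Suc (Suc i)))" if "Suc (Suc i) < 2 * m" for i
  proof -
    consider "Suc (Suc i) < m" | "Suc (Suc i) = m" | "Suc i = m" | "i \<ge> m" by linarith
    then show ?thesis
    proof cases
      case 1
      then show ?thesis using mids[of i] by (simp add: z0_def c_def)
    next
      case 2
      then have "z0 i = c (m - 2)" "z0 (Suc i) = c (m - 1)" "z0 (Suc (Suc i)) = mirror (c (m - 1))"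
        by (auto simp: z0_def intro!: arg_cong[of _ _ c] arg_cong[of _ _ mirror])
      then show ?thesis using top by (simp add: c_def)
    next
      case 3
      then have "z0 i = c (m - 1)" "z0 (Suc i) = mirror (c (m - 1))" "z0 (Suc (Suc i)) = mirror (c (m - 2))"
        using m by (auto simp: z0_def intro!: arg_cong[of _ _ c] arg_cong[of _ _ mirror])
      then show ?thesis using mid_sym[OF mid_mirror[OF top]] by (simp add: c_def)
    next
      case 4
      define j where "j = 2 * m - 1 - Suc (Suc i)"
      have j: "2 * m - 1 - i = Suc (Suc j)" "2 * m - 1 - Suc i = Suc j" "2 * m - 1 - Suc (Suc i) = j" "Suc (Suc j) < m"
        using 4 that by (auto simp: j_def)
      then show ?thesis
        using mid_sym[OF mid_mirror[OF mids[OF j(4)]]] 4 unfolding z0_def j by (simp add: c_def)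
    qed
  qed
  have bot1: "mid (z0 (2 * m - 1)) (z0 0) (z0 1)"
  proof -
    have "z0 (2 * m - 1) = mirror (c 0)" "z0 0 = c 0" "z0 1 = c 1"
      using m by (auto simp: z0_def)
    then show ?thesis using bottom by (simp add: c_def)
  qed
  have bot2: "mid (z0 (2 * m - 2)) (z0 (2 * m - 1)) (z0 0)"
  proof -
    have "z0 (2 * m - 2) = mirror (c 1)" "z0 (2 * m - 1) = mirror (c 0)" "z0 0 = c 0"
      using m by (auto simp: z0_def intro!: arg_cong[of _ _ c] arg_cong[of _ _ mirror])
    then show ?thesis using mid_sym[OF mid_mirror[OF bottom]] by (simp add: c_def)
  qed
  have mid: "mid (z k) (z (Suc k)) (z (Suc (Suc k)))" for k
  proof -
    define i where "i = k mod (2 * m)"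
    have i: "i < 2 * m" using N by (simp add: i_def)
    have s1: "Suc k mod (2 * m) = Suc i mod (2 * m)" and s2: "Suc (Suc k) mod (2 * m) = Suc (Suc i) mod (2 * m)"
      by (simp_all add: i_def mod_Suc_eq mod_Suc_Suc_eq)
    consider "Suc (Suc i) < 2 * m" | "Suc (Suc i) = 2 * m" | "Suc i = 2 * m" using i by linarith
    then show ?thesis
    proof cases
      case 1
      then show ?thesis using mid0 unfolding z_def s1 s2 i_def[symmetric] by simp
    next
      case 2
      then have "i = 2 * m - 2" "Suc i mod (2 * m) = 2 * m - 1" "Suc (Suc i) mod (2 * m) = 0" by auto
      then show ?thesis using bot2 unfolding z_def s1 s2 i_def[symmetric] by simp
    next
      case 3
      then have "i = 2 * m - 1" "Suc i mod (2 * m) = 0" "Suc (Suc i) mod (2 * m) = 1"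
        using m mod_Suc_eq[of "2 * m" "2 * m"] by auto
      then show ?thesis using bot1 unfolding z_def s1 s2 i_def[symmetric] by simp
    qed
  qed
  have "nested_ring m z \<theta> \<rho>"
  proof
    fix k
    show "m \<ge> 3" by fact
    show "z k = of_real (\<rho> k) * cis (\<theta> k)"
    proof -
      have "cis (2 * pi * real q) = 1" for q by (rule cis_multiple_2pi) simp
      then show ?thesis by (simp add: z_def \<rho>_def \<theta>_def polar0 flip: cis_mult)
    qed
    have "k mod (2 * m) < 2 * m" using N by simp
    then show "\<rho> k > 0"
      unfolding \<rho>_def \<rho>0_def Let_def by (intro divide_pos_pos g) (auto simp: add_pos_nonneg)
    show "\<theta> k < \<theta> (Suc k)" "\<theta> (Suc k) < \<theta> k + pi" using step by blast+
    show "\<theta> (k + 2 * m) = \<theta> k + 2 * pi" using N by (simp add: \<theta>_def algebra_simps)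
    show "z (k + 2 * m) = z k" by (simp add: z_def)
    show "\<exists>t. 0 < t \<and> t < 1 \<and> (1 / sqrt 2) *\<^sub>R z (Suc k) = (1 - t) *\<^sub>R z k + t *\<^sub>R z (Suc (Suc k))"
      using mid[of k] unfolding mid_def .
  qed
  then show ?thesis by blast
qed

section \<open>The cyclic order of the vertices of a polygon\<close>

lemma pair_set_eqI: "A = {b, c} \<Longrightarrow> p \<in> A \<Longrightarrow> q \<in> A \<Longrightarrow> p \<noteq> q \<Longrightarrow> A = {p, q}"
  by auto

text \<open>The vertices of a path of maximal length are closed under adjacency.\<close>

lemma two_regular_connected_cycle:
  fixes adj :: "'a \<Rightarrow> 'a \<Rightarrow> bool"
  assumes fin: "finite V" and ne: "V \<noteq> {}"
    and sym: "\<And>a b. adj a b \<Longrightarrow> adj b a"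
    and reg: "\<And>a. a \<in> V \<Longrightarrow> \<exists>b c. b \<noteq> c \<and> {x. adj a x} = {b, c}"
    and irr: "\<And>a. \<not> adj a a"
    and sub: "\<And>a b. adj a b \<Longrightarrow> a \<in> V"
    and conn: "\<And>S. S \<subseteq> V \<Longrightarrow> S \<noteq> {} \<Longrightarrow> (\<And>a b. a \<in> S \<Longrightarrow> adj a b \<Longrightarrow> b \<in> S) \<Longrightarrow> S = V"
  obtains xs where "distinct xs" "set xs = V" "length xs \<ge> 3"
    "\<And>i. i < length xs \<Longrightarrow> adj (xs ! i) (xs ! (Suc i mod length xs))"
proof -
  define path where "path xs \<longleftrightarrow> distinct xs \<and> xs \<noteq> [] \<and> set xs \<subseteq> V \<and>
    (\<forall>i. Suc i < length xs \<longrightarrow> adj (xs ! i) (xs ! Suc i))" for xs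
  obtain a where a: "a \<in> V" using ne by blast
  then have pa: "path [a]" by (simp add: path_def)
  have bound: "length xs \<le> card V" if "path xs" for xs
  proof -
    have "distinct xs" "set xs \<subseteq> V" using that by (simp_all add: path_def)
    then show ?thesis using card_mono[OF fin, of "set xs"] distinct_card[of xs] by simp
  qed
  have "\<exists>xs. path xs \<and> (\<forall>ys. path ys \<longrightarrow> length ys \<le> length xs)"
    by (rule ex_has_greatest_nat[of path "[a]" length "Suc (card V)"]) (use pa bound in \<open>auto simp: less_Suc_eq_le\<close>)
  then obtain xs where xs: "path xs" and max: "\<And>ys. path ys \<Longrightarrow> length ys \<le> length xs"
    by (elim exE conjE) simp
  then have dist: "distinct xs" and xne: "xs \<noteq> []" and xV: "set xs \<subseteq> V"
    and step: "\<And>i. Suc i < length xs \<Longrightarrow> adj (xs ! i) (xs ! Suc i)"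
    unfolding path_def by auto
  define n where "n = length xs"
  have n: "n > 0" using xne by (simp add: n_def)
  let ?l = "xs ! (n - 1)"
  have last_in: "w \<in> set xs" if w: "adj ?l w" for w
  proof (rule ccontr)
    assume "w \<notin> set xs"
    have "w \<in> V" using sub sym w by blast
    have "path (xs @ [w])"
      unfolding path_def
    proof (intro conjI allI impI)
      fix i assume i: "Suc i < length (xs @ [w])"
      show "adj ((xs @ [w]) ! i) ((xs @ [w]) ! Suc i)"
      proof (cases "Suc i < length xs")
        case True
        then show ?thesis using step by (simp add: nth_append)
      next
        case False
        then have "i = n - 1" "Suc i = length xs" "i < length xs" using i n by (auto simp: n_def)
        then show ?thesis using w by (simp add: nth_append n_def)
      qed
    qed (use dist xV \<open>w \<notin> set xs\<close> \<open>w \<in> V\<close> in auto)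
    then show False using max[of "xs @ [w]"] by simp
  qed
  have lV: "?l \<in> V" using xV n by (simp add: n_def subset_iff)
  have neighbours: "{x. adj (xs ! i) x} = {xs ! (i - 1), xs ! Suc i}" if i: "0 < i" "Suc i < n" for i
  proof -
    have "xs ! i \<in> V" using xV i by (simp add: n_def subset_iff)
    then obtain b c where bc: "{x. adj (xs ! i) x} = {b, c}" using reg by blast
    show ?thesis
    proof (rule pair_set_eqI[OF bc])
      have "adj (xs ! (i - 1)) (xs ! i)" using step[of "i - 1"] i by (simp add: n_def)
      then show "xs ! (i - 1) \<in> {x. adj (xs ! i) x}" using sym by simp
      show "xs ! Suc i \<in> {x. adj (xs ! i) x}" using step i by (simp add: n_def)
      show "xs ! (i - 1) \<noteq> xs ! Suc i" using dist i by (simp add: nth_eq_iff_index_eq n_def)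
    qed
  qed
  \<comment> \<open>An inner vertex of the path already has both its neighbours on the path, so it
    is adjacent to the last vertex only as its predecessor.\<close>
  have closing: "i = 0 \<or> Suc i = n - 1" if i: "i < n" "adj ?l (xs ! i)" for i
  proof (rule ccontr)
    assume c: "\<not> (i = 0 \<or> Suc i = n - 1)"
    have "i \<noteq> n - 1" using i irr by auto
    then have i2: "0 < i" "Suc i < n" using c i by auto
    then have "?l \<in> {xs ! (i - 1), xs ! Suc i}" using neighbours[OF i2] sym[OF i(2)] by blast
    then have "n - 1 = i - 1 \<or> n - 1 = Suc i"
      using dist i2 n by (auto simp: nth_eq_iff_index_eq n_def)
    then show False using c i2 by auto
  qed
  obtain b c where bc: "b \<noteq> c" "{x. adj ?l x} = {b, c}" using reg[OF lV] by blast
  obtain ib where ib: "ib < n" "b = xs ! ib"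
    using last_in[of b] bc(2) unfolding n_def in_set_conv_nth by blast
  obtain ic where ic: "ic < n" "c = xs ! ic"
    using last_in[of c] bc(2) unfolding n_def in_set_conv_nth by blast
  have "adj ?l (xs ! ib)" "adj ?l (xs ! ic)" using bc(2) ib(2) ic(2) by blast+
  then have "ib = 0 \<or> Suc ib = n - 1" "ic = 0 \<or> Suc ic = n - 1"
    using closing[OF ib(1)] closing[OF ic(1)] by simp_all
  moreover have "ib \<noteq> ic" using bc ib ic by auto
  \<comment> \<open>The last vertex has two neighbours, one of them its predecessor; the other can
    only be the first vertex, which closes the cycle.\<close>
  ultimately have z: "(ib = 0 \<and> Suc ic = n - 1) \<or> (ic = 0 \<and> Suc ib = n - 1)" by auto
  then have adj0: "adj ?l (xs ! 0)" using \<open>adj ?l (xs ! ib)\<close> \<open>adj ?l (xs ! ic)\<close> by auto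
  have n3: "n \<ge> 3" using z \<open>ib \<noteq> ic\<close> by auto
  have cyc: "adj (xs ! i) (xs ! (Suc i mod n))" if "i < n" for i
  proof (cases "Suc i < n")
    case True
    then show ?thesis using step by (simp add: n_def)
  next
    case False
    then have "Suc i = n" using that by simp
    then have "i = n - 1" "Suc i mod n = 0" by auto
    then show ?thesis using adj0 by simp
  qed
  have "set xs = V"
  proof (rule conn[OF xV])
    show "set xs \<noteq> {}" using xne by simp
    fix a b assume a: "a \<in> set xs" "adj a b"
    then obtain i where i: "i < n" "a = xs ! i" by (auto simp: in_set_conv_nth n_def)
    define j where "j = (if i = 0 then n - 1 else i - 1)"
    have j: "j < n" "Suc j mod n = i" "j \<noteq> Suc i mod n"
      using i n3 by (auto simp: j_def mod_Suc split: if_splits)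
    have a1: "adj a (xs ! j)" using sym cyc[OF j(1)] i j by simp
    have a2: "adj a (xs ! (Suc i mod n))" using cyc[OF i(1)] i by simp
    have ne: "xs ! j \<noteq> xs ! (Suc i mod n)"
      using dist j n by (simp add: nth_eq_iff_index_eq n_def)
    have "a \<in> V" using a(1) xV by blast
    then obtain d e where de: "{x. adj a x} = {d, e}" using reg by blast
    have "{x. adj a x} = {xs ! j, xs ! (Suc i mod n)}"
      by (rule pair_set_eqI[OF de]) (use a1 a2 ne in simp_all)
    then have "b = xs ! j \<or> b = xs ! (Suc i mod n)" using a(2) by blast
    then show "b \<in> set xs" using j n by (auto simp: n_def)
  qed
  show thesis
  proof (rule that[of xs])
    show "distinct xs" "set xs = V" by fact+
    show "length xs \<ge> 3" using n3 by (simp add: n_def)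
    show "adj (xs ! i) (xs ! (Suc i mod length xs))" if "i < length xs" for i
      using cyc that by (simp add: n_def)
  qed
qed

section \<open>Vertices and edges of a convex polygon\<close>

context
  fixes C :: "'a::euclidean_space set"
  assumes C: "polytope C" and dim: "aff_dim C = 2"
begin

lemma polygon_edge:
  assumes "F facet_of C"
  obtains a b where "a \<noteq> b" "F = closed_segment a b" "{x. x extreme_point_of F} = {a, b}"
proof -
  have F: "F \<noteq> {}" "aff_dim F = 1" "polytope F"
    using assms dim face_of_polytope_polytope[OF C] by (auto simp: facet_of_def)
  then have "collinear F" by (simp add: collinear_aff_dim)
  then obtain a b where ab: "F = closed_segment a b"
    using compact_convex_collinear_segment F polytope_imp_compact polytope_imp_convex by metis
  moreover have "a \<noteq> b" using ab F by auto
  moreover have "{x. x extreme_point_of F} = {a, b}" using ab by (auto simp: extreme_point_of_segment)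
  ultimately show thesis using that by blast
qed

text \<open>In dimension 2 the vertices are the ridges.\<close>

lemma polygon_vertex:
  assumes "w extreme_point_of C"
  obtains F F' where "F facet_of C" "F' facet_of C" "F \<noteq> F'" "F \<inter> F' = {w}"
    "\<And>H. H facet_of C \<Longrightarrow> w \<in> H \<Longrightarrow> H = F \<or> H = F'"
proof -
  have R: "{w} ridge_of C" using assms dim by (simp add: ridge_of_def face_of_singleton)
  show thesis
  proof (rule ridge_in_two_facets[OF C _ R])
    show "aff_dim C \<ge> 2" using dim by simp
    fix F F' assume a: "F facet_of C" "F' facet_of C" "F \<noteq> F'" "F \<inter> F' = {w}"
      "\<And>H. H facet_of C \<Longrightarrow> {w} \<subseteq> H \<Longrightarrow> H = F \<or> H = F'"
    show thesis by (rule that[OF a(1-4)]) (use a(5) in simp)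
  qed
qed

text \<open>The boundary of a polygon is a connected set. The edges meeting \<open>S\<close> and the
  edges missing it form two closed sets that cover it; they are disjoint, since two edges with a
  common point have a common vertex. So one of the two sets is empty.\<close>

lemma polygon_connected:
  assumes S: "S \<subseteq> {x. x extreme_point_of C}" "S \<noteq> {}"
    and closed: "\<And>F. F facet_of C \<Longrightarrow> F \<inter> S \<noteq> {} \<Longrightarrow> {x. x extreme_point_of F} \<subseteq> S"
  shows "S = {x. x extreme_point_of C}"
proof (rule ccontr)
  assume "S \<noteq> {x. x extreme_point_of C}"
  then obtain w where w: "w extreme_point_of C" "w \<notin> S" using S by blast
  obtain s where s: "s extreme_point_of C" "s \<in> S" using S by blast
  let ?A = "\<Union>{F. F facet_of C \<and> F \<inter> S \<noteq> {}}" and ?B = "\<Union>{F. F facet_of C \<and> F \<inter> S = {}}"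
  have fr: "rel_frontier C = \<Union>{F. F facet_of C}"
    by (rule rel_frontier_of_polyhedron) (simp add: C polytope_imp_polyhedron)
  have AB: "rel_frontier C = ?A \<union> ?B" unfolding fr by blast
  have conn: "connected (rel_frontier C)"
    by (rule connected_sphere_gen) (use C dim polytope_imp_convex polytope_imp_bounded in auto)
  have fin: "finite {F. F facet_of C}" by (rule finite_polytope_facets[OF C])
  have cl: "closed F" if "F facet_of C" for F
    using that C face_of_polytope_polytope facet_of_imp_face_of polytope_imp_closed by metis
  have "finite {F. F facet_of C \<and> F \<inter> S \<noteq> {}}" "finite {F. F facet_of C \<and> F \<inter> S = {}}"
    using fin by (auto elim: rev_finite_subset)
  then have clAB: "closed ?A" "closed ?B" using cl by auto
  have disj: "?A \<inter> ?B = {}"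
  proof (rule ccontr)
    assume "?A \<inter> ?B \<noteq> {}"
    then obtain F F' where F: "F facet_of C" "F \<inter> S \<noteq> {}" "F' facet_of C" "F' \<inter> S = {}" "F \<inter> F' \<noteq> {}"
      by blast
    have fi: "F \<inter> F' face_of C" using F facet_of_imp_face_of face_of_Int by blast
    have "compact (F \<inter> F')" "convex (F \<inter> F')"
      using face_of_polytope_polytope[OF C fi] polytope_imp_compact polytope_imp_convex by blast+
    then obtain u where u: "u extreme_point_of (F \<inter> F')"
      using F(5) extreme_point_exists_convex by blast
    then have "u extreme_point_of C" "u \<in> F" "u \<in> F'" using extreme_point_of_face[OF fi] by auto
    then have "u extreme_point_of F" using extreme_point_of_face[OF facet_of_imp_face_of[OF F(1)]] by simp
    then have "u \<in> S" using closed[OF F(1,2)] by blast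
    then show False using F(4) \<open>u \<in> F'\<close> by blast
  qed
  obtain F where F: "F facet_of C" "s \<in> F" using polygon_vertex[OF s(1)] by (metis insertI1 IntD1)
  then have A: "s \<in> ?A" using s by blast
  obtain H where H: "H facet_of C" "w \<in> H" using polygon_vertex[OF w(1)] by (metis insertI1 IntD1)
  have "H \<inter> S = {}"
  proof (rule ccontr)
    assume "H \<inter> S \<noteq> {}"
    then have "{x. x extreme_point_of H} \<subseteq> S" using closed H by blast
    moreover have "w extreme_point_of H"
      using extreme_point_of_face[OF facet_of_imp_face_of[OF H(1)]] w H by simp
    ultimately show False using w by blast
  qed
  then have B: "w \<in> ?B" using H by blast
  have "?A \<inter> rel_frontier C = {} \<or> ?B \<inter> rel_frontier C = {}"
    using conn[unfolded connected_closed] clAB AB disj by (metis (no_types, lifting) inf_bot_left order_refl)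
  then show False using A B AB by blast
qed

text \<open>Every vertex lies on exactly two edges, so the graph of the polygon is connected and
  2-regular, that is, a cycle.\<close>

theorem polygon_cycle:
  obtains c where "bij_betw c {..<card {x. x extreme_point_of C}} {x. x extreme_point_of C}"
    "bij_betw (\<lambda>i. closed_segment (c i) (c (Suc i mod card {x. x extreme_point_of C})))
       {..<card {x. x extreme_point_of C}} {F. F facet_of C}"
proof -
  let ?V = "{x. x extreme_point_of C}"
  define adj where "adj a b \<longleftrightarrow> a \<noteq> b \<and> (\<exists>F. F facet_of C \<and> {x. x extreme_point_of F} = {a, b})" for a b
  have ext: "x extreme_point_of F \<longleftrightarrow> x extreme_point_of C \<and> x \<in> F" if "F facet_of C" for F x
    using extreme_point_of_face[OF facet_of_imp_face_of[OF that]] by simp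
  have reg: "\<exists>b c. b \<noteq> c \<and> {x. adj a x} = {b, c}" if a: "a \<in> ?V" for a
  proof -
    have "a extreme_point_of C" using a by simp
    from polygon_vertex[OF this] obtain F F' where F: "F facet_of C" "F' facet_of C" "F \<noteq> F'" "F \<inter> F' = {a}"
      and only: "\<And>H. H facet_of C \<Longrightarrow> a \<in> H \<Longrightarrow> H = F \<or> H = F'" by metis
    have other: "\<exists>b. b \<noteq> a \<and> {x. x extreme_point_of H} = {a, b}" if H: "H facet_of C" "a \<in> H" for H
    proof -
      obtain p q where pq: "p \<noteq> q" "{x. x extreme_point_of H} = {p, q}" using polygon_edge[OF H(1)] by metis
      moreover have "a \<in> {p, q}" using ext[OF H(1)] a H(2) pq(2) by blast
      ultimately show ?thesis by auto
    qed
    have aF: "a \<in> F" "a \<in> F'" using F(4) by auto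
    obtain b where b: "b \<noteq> a" "{x. x extreme_point_of F} = {a, b}" using other[OF F(1) aF(1)] by blast
    obtain b' where b': "b' \<noteq> a" "{x. x extreme_point_of F'} = {a, b'}" using other[OF F(2) aF(2)] by blast
    have "b \<noteq> b'"
    proof
      assume "b = b'"
      then have "b \<in> F \<inter> F'" using b b' by (auto simp: extreme_point_of_def)
      then show False using F(4) b by simp
    qed
    moreover have "adj a x \<longleftrightarrow> x = b \<or> x = b'" for x
    proof
      assume "adj a x"
      then obtain H where H: "H facet_of C" "{x. x extreme_point_of H} = {a, x}" "a \<noteq> x"
        unfolding adj_def by blast
      then have "a \<in> H" by (auto simp: extreme_point_of_def)
      then have "H = F \<or> H = F'" using only H(1) by blast
      then show "x = b \<or> x = b'" using H b b' by (metis doubleton_eq_iff)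
    next
      assume "x = b \<or> x = b'"
      then show "adj a x" using F b b' unfolding adj_def by metis
    qed
    ultimately show ?thesis by (intro exI[of _ b] exI[of _ b']) auto
  qed
  obtain xs where xs: "distinct xs" "set xs = ?V" "length xs \<ge> 3"
    and cyc: "\<And>i. i < length xs \<Longrightarrow> adj (xs ! i) (xs ! (Suc i mod length xs))"
  proof (rule two_regular_connected_cycle[of ?V adj])
    show "finite ?V" by (rule finite_polytope_extreme_points[OF C])
    have "C \<noteq> {}" using dim by auto
    then show "?V \<noteq> {}"
      using extreme_point_exists_convex C polytope_imp_compact polytope_imp_convex by blast
    show "adj a b \<Longrightarrow> adj b a" for a b unfolding adj_def by (metis insert_commute)
    show "\<not> adj a a" for a by (simp add: adj_def)
    show "a \<in> ?V" if ab: "adj a b" for a b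
    proof -
      obtain F where "F facet_of C" "{x. x extreme_point_of F} = {a, b}" using ab unfolding adj_def by blast
      then show ?thesis using ext by blast
    qed
    show "S = ?V" if S: "S \<subseteq> ?V" "S \<noteq> {}" "\<And>a b. a \<in> S \<Longrightarrow> adj a b \<Longrightarrow> b \<in> S" for S
    proof (rule polygon_connected[OF S(1,2)])
      fix F assume F: "F facet_of C" "F \<inter> S \<noteq> {}"
      then obtain s where s: "s \<in> F" "s \<in> S" by blast
      obtain p q where pq: "p \<noteq> q" "{x. x extreme_point_of F} = {p, q}" using polygon_edge[OF F(1)] by metis
      have "s \<in> {p, q}" using ext[OF F(1)] s S(1) pq(2) by blast
      moreover have "adj p q" "adj q p" using F(1) pq unfolding adj_def by (metis insert_commute)+
      ultimately have "p \<in> S" "q \<in> S" using S(3) s by blast+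
      then show "{x. x extreme_point_of F} \<subseteq> S" using pq by simp
    qed
  qed (use reg in auto)
  let ?n = "length xs"
  have cardV: "card ?V = ?n" using xs distinct_card by metis
  have bij: "bij_betw (\<lambda>i. xs ! i) {..<?n} ?V"
    using bij_betw_nth[OF xs(1)] xs(2) by simp
  let ?e = "\<lambda>i. closed_segment (xs ! i) (xs ! (Suc i mod ?n))"
  have face_ext: "closed_segment a b = F" if "F facet_of C" "{x. x extreme_point_of F} = {a, b}" for F a b
  proof -
    have "F = convex hull {a, b}"
      using polytope_eq_hull_extreme_points[of F] that face_of_polytope_polytope[OF C] facet_of_imp_face_of by metis
    then show ?thesis by (simp add: segment_convex_hull)
  qed
  have e_facet: "?e i facet_of C" if "i < ?n" for i
    using cyc[OF that] face_ext unfolding adj_def by metis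
  have "inj_on ?e {..<?n}"
  proof (rule inj_onI)
    fix i j assume ij: "i \<in> {..<?n}" "j \<in> {..<?n}" "?e i = ?e j"
    then have "{xs ! i, xs ! (Suc i mod ?n)} = {xs ! j, xs ! (Suc j mod ?n)}"
      by (metis closed_segment_eq)
    \<comment> \<open>The second alternative, the same edge in opposite directions, is impossible in
      a cycle of length at least 3.\<close>
    then have "i = j \<or> (i = Suc j mod ?n \<and> j = Suc i mod ?n)"
    proof -
      have "Suc i mod ?n < ?n" "Suc j mod ?n < ?n" using xs(3) by (auto intro!: mod_less_divisor)
      then show ?thesis
        using \<open>{xs ! i, xs ! (Suc i mod ?n)} = _\<close> ij xs(1) by (simp add: doubleton_eq_iff nth_eq_iff_index_eq) auto
    qed
    then show "i = j" using ij xs(3) by (auto simp: mod_Suc split: if_splits)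
  qed
  moreover have "?e ` {..<?n} = {F. F facet_of C}"
  proof (intro subset_antisym subsetI)
    fix F assume "F \<in> {F. F facet_of C}"
    then have F: "F facet_of C" by simp
    obtain p q where pq: "p \<noteq> q" "{x. x extreme_point_of F} = {p, q}" using polygon_edge[OF F] by metis
    then have pV: "p \<in> ?V" "adj p q" using ext[OF F] F unfolding adj_def by blast+
    obtain i where i: "i < ?n" "p = xs ! i" using pV xs(2) by (metis in_set_conv_nth)
    define j where "j = (if i = 0 then ?n - 1 else i - 1)"
    have j: "j < ?n" "Suc j mod ?n = i" "j \<noteq> Suc i mod ?n"
      using i xs(3) by (auto simp: j_def mod_Suc split: if_splits)
    have "Suc i mod ?n < ?n" using i(1) by (intro mod_less_divisor) linarith
    have sym: "adj a b \<Longrightarrow> adj b a" for a b unfolding adj_def by (metis insert_commute)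
    have a1: "adj p (xs ! j)" using sym[OF cyc[OF j(1)]] i j by simp
    have a2: "adj p (xs ! (Suc i mod ?n))" using cyc[OF i(1)] i by simp
    have ne: "xs ! j \<noteq> xs ! (Suc i mod ?n)"
      using xs(1) j \<open>Suc i mod ?n < ?n\<close> by (simp add: nth_eq_iff_index_eq)
    obtain d e where de: "{x. adj p x} = {d, e}" using reg[OF pV(1)] by blast
    have "{x. adj p x} = {xs ! j, xs ! (Suc i mod ?n)}"
      by (rule pair_set_eqI[OF de]) (use a1 a2 ne in simp_all)
    then have "q = xs ! j \<or> q = xs ! (Suc i mod ?n)" using pV(2) by blast
    then show "F \<in> ?e ` {..<?n}"
    proof
      assume "q = xs ! j"
      then have "F = ?e j" using face_ext[OF F, of q p] pq i j by (simp add: insert_commute)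
      then show ?thesis using j by blast
    next
      assume "q = xs ! (Suc i mod ?n)"
      then have "F = ?e i" using face_ext[OF F pq(2)] i by simp
      then show ?thesis using i by blast
    qed
  qed (use e_facet in auto)
  ultimately have "bij_betw ?e {..<?n} {F. F facet_of C}" by (simp add: bij_betw_def)
  then show thesis using that[of "\<lambda>i. xs ! i"] bij unfolding cardV by blast
qed

end

section \<open>Products of two polygons\<close>

text \<open>
  In a model of C, the vertices of the inner polygon are p c, those of the outer polygon are x e; the
  line a e = 1 contains the inner edge for e, the line f c = 1 the outer edge through p c.
\<close>

locale polygon_model =
  fixes C :: "'a::euclidean_space set" and p f :: "'a \<Rightarrow> complex" and x a :: "'a set \<Rightarrow> complex"
  assumes C: "polytope C" "aff_dim C = 2"
    and a_p: "\<And>e c. e facet_of C \<Longrightarrow> c extreme_point_of C \<Longrightarrow> a e \<bullet> p c \<le> 1"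
      "\<And>e c. e facet_of C \<Longrightarrow> c extreme_point_of C \<Longrightarrow> a e \<bullet> p c = 1 \<longleftrightarrow> c \<in> e"
    and a_x: "\<And>e e'. e facet_of C \<Longrightarrow> e' facet_of C \<Longrightarrow> a e \<bullet> x e' \<le> 2"
      "\<And>e e'. e facet_of C \<Longrightarrow> e' facet_of C \<Longrightarrow> a e \<bullet> x e' = 2 \<longleftrightarrow> e = e'"
    and f_p: "\<And>c c'. c extreme_point_of C \<Longrightarrow> c' extreme_point_of C \<Longrightarrow> f c \<bullet> p c' \<le> 1"
      "\<And>c c'. c extreme_point_of C \<Longrightarrow> c' extreme_point_of C \<Longrightarrow> f c \<bullet> p c' = 1 \<longleftrightarrow> c = c'"
    and f_x: "\<And>c e. c extreme_point_of C \<Longrightarrow> e facet_of C \<Longrightarrow> f c \<bullet> x e \<le> 1"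
      "\<And>c e. c extreme_point_of C \<Longrightarrow> e facet_of C \<Longrightarrow> f c \<bullet> x e = 1 \<longleftrightarrow> c \<in> e"
    and inner_cover: "\<And>y t. t \<ge> 0 \<Longrightarrow> (\<And>e. e facet_of C \<Longrightarrow> a e \<bullet> y \<le> t) \<Longrightarrow>
      \<exists>u \<in> convex hull (p ` {c. c extreme_point_of C}). y = t *\<^sub>R u"
    and outer_cover: "\<And>y s. s \<ge> 1 \<Longrightarrow> (\<And>c. c extreme_point_of C \<Longrightarrow> f c \<bullet> y \<le> 1) \<Longrightarrow>
      (\<And>e. e facet_of C \<Longrightarrow> a e \<bullet> y \<le> s) \<Longrightarrow> \<exists>e. e facet_of C \<and> a e \<bullet> y = s \<Longrightarrow>
      \<exists>e. e facet_of C \<and> s \<le> 2 \<and> (\<exists>u \<in> convex hull (p ` {c. c extreme_point_of C}).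
        y = (s - 1) *\<^sub>R x e + (2 - s) *\<^sub>R u)"

text \<open>The nested polygons have no metric relation to \<open>C\<close>; they are attached to it
  by numbering its vertices and edges cyclically.\<close>

theorem polygon_model_exists:
  fixes C :: "'a::euclidean_space set"
  assumes C: "polytope C" "aff_dim C = 2" and m: "card {c. c extreme_point_of C} \<ge> 3"
  shows "\<exists>p f x a. polygon_model C p f x a"
proof -
  define m where "m = card {c. c extreme_point_of C}"
  have m3: "m \<ge> 3" using m by (simp add: m_def)
  obtain c where cV: "bij_betw c {..<m} {c. c extreme_point_of C}"
    and cE: "bij_betw (\<lambda>i. closed_segment (c i) (c (Suc i mod m))) {..<m} {F. F facet_of C}"
    using polygon_cycle[OF C] unfolding m_def by blast
  define s where "s i = closed_segment (c i) (c (Suc i mod m))" for i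
  have sE: "bij_betw s {..<m} {F. F facet_of C}" using cE unfolding s_def .
  obtain z \<theta> \<rho> where "nested_ring m z \<theta> \<rho>" using nested_ring_exists[OF m3] by blast
  then interpret N: nested_ring m z \<theta> \<rho> .
  define ix where "ix = inv_into {..<m} c"
  define ie where "ie = inv_into {..<m} s"
  have ix: "ix v < m" "c (ix v) = v" if "v extreme_point_of C" for v
    using that cV f_inv_into_f[of v c "{..<m}"] inv_into_into[of v c "{..<m}"]
    by (auto simp: ix_def bij_betw_def)
  have ie: "ie e < m" "s (ie e) = e" if "e facet_of C" for e
    using that sE f_inv_into_f[of e s "{..<m}"] inv_into_into[of e s "{..<m}"]
    by (auto simp: ie_def bij_betw_def)
  have ix_c: "ix (c i) = i" if "i < m" for i
    using that cV by (simp add: ix_def bij_betw_def inv_into_f_f)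
  have ie_s: "ie (s i) = i" if "i < m" for i
    using that sE by (simp add: ie_def bij_betw_def inv_into_f_f)
  have cext: "c i extreme_point_of C" if "i < m" for i using that cV by (auto simp: bij_betw_def)
  have sfac: "s i facet_of C" if "i < m" for i using that sE by (auto simp: bij_betw_def)
  have mod_lt: "Suc i mod m < m" for i using m3 by simp
  have mem: "v \<in> e \<longleftrightarrow> ix v = ie e \<or> ix v = Suc (ie e) mod m" if v: "v extreme_point_of C" and e: "e facet_of C" for v e
  proof -
    have seg: "e = closed_segment (c (ie e)) (c (Suc (ie e) mod m))" using ie(2)[OF e] by (simp add: s_def)
    have "v \<in> e \<longleftrightarrow> v extreme_point_of e"
      using extreme_point_of_face[OF facet_of_imp_face_of[OF e]] v by simp
    also have "\<dots> \<longleftrightarrow> v = c (ie e) \<or> v = c (Suc (ie e) mod m)" by (subst seg) (rule extreme_point_of_segment)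
    also have "\<dots> \<longleftrightarrow> ix v = ie e \<or> ix v = Suc (ie e) mod m"
      using ix[OF v] ix_c[OF ie(1)[OF e]] ix_c[OF mod_lt] by metis
    finally show ?thesis .
  qed
  let ?p = "\<lambda>v. N.p (ix v)" and ?f = "\<lambda>v. N.f (ix v)"
  let ?x = "\<lambda>e. N.x (ie e)" and ?a = "\<lambda>e. N.P.edge_normal (ie e)"
  have range: "?p ` {c. c extreme_point_of C} = N.p ` {..<m}"
  proof -
    have "ix ` {c. c extreme_point_of C} = {..<m}"
      using cext ix ix_c by (force simp: image_iff)
    then show ?thesis by (metis image_image)
  qed
  have all_a: "\<And>i. i < m \<Longrightarrow> N.P.edge_normal i \<bullet> y \<le> t" if "\<And>e. e facet_of C \<Longrightarrow> ?a e \<bullet> y \<le> t" for y t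
    using that[OF sfac] ie_s by simp
  have "polygon_model C ?p ?f ?x ?a"
  proof
    fix e v assume e: "e facet_of C" and v: "v extreme_point_of C"
    show "?a e \<bullet> ?p v \<le> 1" "?a e \<bullet> ?p v = 1 \<longleftrightarrow> v \<in> e"
      using N.P.normal_vertex[OF ie(1)[OF e] ix(1)[OF v]] mem[OF v e] by auto
  next
    fix e e' assume e: "e facet_of C" and e': "e' facet_of C"
    have "e = e' \<longleftrightarrow> ie e = ie e'" using ie(2)[OF e] ie(2)[OF e'] by metis
    then show "?a e \<bullet> ?x e' \<le> 2" "?a e \<bullet> ?x e' = 2 \<longleftrightarrow> e = e'"
      using N.P_normal_x_le[OF ie(1)[OF e] ie(1)[OF e']] by auto
  next
    fix v v' assume v: "v extreme_point_of C" and v': "v' extreme_point_of C"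
    have "v = v' \<longleftrightarrow> ix v = ix v'" using ix(2)[OF v] ix(2)[OF v'] by metis
    then show "?f v \<bullet> ?p v' \<le> 1" "?f v \<bullet> ?p v' = 1 \<longleftrightarrow> v = v'"
      using N.f_p_le[OF ix(1)[OF v] ix(1)[OF v']] by auto
  next
    fix v e assume v: "v extreme_point_of C" and e: "e facet_of C"
    show "?f v \<bullet> ?x e \<le> 1" "?f v \<bullet> ?x e = 1 \<longleftrightarrow> v \<in> e"
      using N.f_x_le[OF ix(1)[OF v] ie(1)[OF e]] mem[OF v e] by auto
  next
    fix y and t :: real assume t: "t \<ge> 0" and le: "\<And>e. e facet_of C \<Longrightarrow> ?a e \<bullet> y \<le> t"
    show "\<exists>u \<in> convex hull (?p ` {c. c extreme_point_of C}). y = t *\<^sub>R u"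
      unfolding range by (rule N.scaled_hull[OF t all_a[OF le]])
  next
    fix y and r :: real
    assume r: "r \<ge> 1" and f: "\<And>c. c extreme_point_of C \<Longrightarrow> ?f c \<bullet> y \<le> 1"
      and le: "\<And>e. e facet_of C \<Longrightarrow> ?a e \<bullet> y \<le> r" and ex: "\<exists>e. e facet_of C \<and> ?a e \<bullet> y = r"
    have f': "N.f i \<bullet> y \<le> 1" if "i < m" for i using f[OF cext[OF that]] ix_c[OF that] by simp
    have ex': "\<exists>i<m. N.P.edge_normal i \<bullet> y = r" using ex ie(1) by blast
    obtain i u where iu: "i < m" "u \<in> convex hull {N.p i, N.p (Suc i mod m)}"
      "y = (r - 1) *\<^sub>R N.x i + (2 - r) *\<^sub>R u" "r \<le> 2"
      using N.outer_triangle[OF f' all_a[OF le] ex' r] by blast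
    have "convex hull {N.p i, N.p (Suc i mod m)} \<subseteq> convex hull (N.p ` {..<m})"
      using iu(1) mod_lt by (intro hull_mono) auto
    then show "\<exists>e. e facet_of C \<and> r \<le> 2 \<and> (\<exists>u \<in> convex hull (?p ` {c. c extreme_point_of C}).
        y = (r - 1) *\<^sub>R ?x e + (2 - r) *\<^sub>R u)"
      unfolding range using iu sfac[OF iu(1)] ie_s[OF iu(1)] by (intro exI[of _ "s i"]) auto
  qed (rule C)+
  then show ?thesis by blast
qed

section \<open>Dimensions, facets and ridges of products\<close>

lemma span_Times_zero:
  fixes S :: "'a::euclidean_space set" and T :: "'b::euclidean_space set"
  assumes "0 \<in> S" "0 \<in> T"
  shows "span (S \<times> T) = span S \<times> span T"
proof
  show "span (S \<times> T) \<subseteq> span S \<times> span T"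
    by (rule span_minimal) (auto intro: span_base subspace_Times)
  have 1: "(\<lambda>u. (u, 0)) ` span S \<subseteq> span (S \<times> T)"
  proof -
    have "linear (\<lambda>u. (u, 0) :: 'a \<times> 'b)" by (intro linearI) auto
    then have "(\<lambda>u. (u, 0)) ` span S = span ((\<lambda>u. (u, 0) :: 'a \<times> 'b) ` S)"
      by (rule linear_span_image[symmetric])
    also have "\<dots> \<subseteq> span (S \<times> T)" using assms by (intro span_mono) auto
    finally show ?thesis .
  qed
  have 2: "(\<lambda>u. (0, u)) ` span T \<subseteq> span (S \<times> T)"
  proof -
    have "linear (\<lambda>u. (0, u) :: 'a \<times> 'b)" by (intro linearI) auto
    then have "(\<lambda>u. (0, u)) ` span T = span ((\<lambda>u. (0, u) :: 'a \<times> 'b) ` T)"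
      by (rule linear_span_image[symmetric])
    also have "\<dots> \<subseteq> span (S \<times> T)" using assms by (intro span_mono) auto
    finally show ?thesis .
  qed
  show "span S \<times> span T \<subseteq> span (S \<times> T)"
  proof
    fix z assume "z \<in> span S \<times> span T"
    then obtain u v where z: "z = (u, v)" "u \<in> span S" "v \<in> span T" by blast
    then have "(u, 0) + (0, v) \<in> span (S \<times> T)" using 1 2 by (intro span_add) auto
    then show "z \<in> span (S \<times> T)" using z by simp
  qed
qed

lemma aff_dim_Times:
  fixes S :: "'a::euclidean_space set" and T :: "'b::euclidean_space set"
  assumes "S \<noteq> {}" "T \<noteq> {}"
  shows "aff_dim (S \<times> T) = aff_dim S + aff_dim T"
proof -
  obtain s t where st: "s \<in> S" "t \<in> T" using assms by blast
  let ?S = "(+) (- s) ` S" and ?T = "(+) (- t) ` T"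
  have prod: "(+) (- (s, t)) ` (S \<times> T) = ?S \<times> ?T" by (auto simp: image_iff)
  have zero: "0 \<in> ?S" "0 \<in> ?T" using st by (auto simp: image_iff)
  have "aff_dim (S \<times> T) = int (dim (?S \<times> ?T))"
    using aff_dim_eq_dim[of "(s, t)" "S \<times> T"] st unfolding prod by (simp add: hull_inc)
  also have "dim (?S \<times> ?T) = dim (span ?S \<times> span ?T)"
    using span_Times_zero[OF zero] dim_span[of "?S \<times> ?T"] by simp
  also have "\<dots> = dim (span ?S) + dim (span ?T)" by (intro dim_Times subspace_span)
  finally show ?thesis
    using aff_dim_eq_dim[of s S] aff_dim_eq_dim[of t T] st by (simp add: hull_inc dim_span)
qed

lemma extreme_point_of_Times:
  fixes C :: "'a::euclidean_space set" and D :: "'b::euclidean_space set"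
  shows "(c, d) extreme_point_of (C \<times> D) \<longleftrightarrow> c extreme_point_of C \<and> d extreme_point_of D"
  using face_of_Times_eq[of "{c}" "{d}" C D] by (simp add: face_of_singleton)

lemma two_dim_face:
  fixes X F :: "'c::euclidean_space set"
  assumes "polytope X" "aff_dim X = 2" "F face_of X" "F \<noteq> {}"
  shows "aff_dim F = 2 \<and> F = X \<or> F facet_of X \<and> aff_dim F = 1
    \<or> aff_dim F = 0 \<and> (\<exists>c. c extreme_point_of X \<and> F = {c})"
proof -
  have "aff_dim F \<ge> 0" using assms(4) aff_dim_geq[of F] aff_dim_empty[of F] by linarith
  show ?thesis
  proof (cases "F = X")
    case False
    then have "aff_dim F < 2"
      using face_of_aff_dim_lt[OF polytope_imp_convex[OF assms(1)] assms(3)] assms(2) by simp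
    then consider "aff_dim F = 1" | "aff_dim F = 0" using \<open>aff_dim F \<ge> 0\<close> by linarith
    then show ?thesis
    proof cases
      case 1
      then show ?thesis using assms by (simp add: facet_of_def)
    next
      case 2
      then obtain c where "F = {c}" using aff_dim_eq_0 by blast
      then show ?thesis using 2 assms(3) by (auto simp: face_of_singleton)
    qed
  qed (use assms in simp)
qed

context
  fixes C :: "'a::euclidean_space set" and D :: "'b::euclidean_space set"
  assumes C: "polytope C" "aff_dim C = 2" and D: "polytope D" "aff_dim D = 2"
begin

lemma C_ne: "C \<noteq> {}" and D_ne: "D \<noteq> {}"
  using C D by auto

lemma aff_dim_product: "aff_dim (C \<times> D) = 4"
  using aff_dim_Times[OF C_ne D_ne] C D by simp

lemma facet_of_product_cases:
  assumes "F facet_of C \<times> D"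
  obtains e where "e facet_of C" "F = e \<times> D" | e where "e facet_of D" "F = C \<times> e"
proof -
  have F: "F face_of C \<times> D" "F \<noteq> {}" "aff_dim F = 3"
    using assms aff_dim_product by (auto simp: facet_of_def)
  then obtain G H where GH: "G face_of C" "H face_of D" "F = G \<times> H" using face_of_Times_decomp by blast
  then have ne: "G \<noteq> {}" "H \<noteq> {}" using F by auto
  then have "aff_dim G + aff_dim H = 3" using aff_dim_Times F GH by metis
  then show thesis
    using two_dim_face[OF C GH(1) ne(1)] two_dim_face[OF D GH(2) ne(2)] that GH(3) by auto
qed

lemma facet_of_product:
  "e facet_of C \<Longrightarrow> e \<times> D facet_of C \<times> D"
  "e' facet_of D \<Longrightarrow> C \<times> e' facet_of C \<times> D"
  using aff_dim_product aff_dim_Times[of e D] aff_dim_Times[of C e'] C D C_ne D_ne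
    face_of_Times[of e C D D] face_of_Times[of C C e' D] face_of_refl polytope_imp_convex
  by (auto simp: facet_of_def)

text \<open>The dimensions of the factors are (1,1), (0,2) or (2,0), one for each of the three kinds
  of facets of the sphere.\<close>

lemma ridge_of_product_cases:
  assumes "R ridge_of C \<times> D"
  obtains e e' where "e facet_of C" "e' facet_of D" "R = e \<times> e'"
    | c where "c extreme_point_of C" "R = {c} \<times> D"
    | d where "d extreme_point_of D" "R = C \<times> {d}"
proof -
  have R: "R face_of C \<times> D" "aff_dim R = 2"
    using assms aff_dim_product by (auto simp: ridge_of_def)
  then obtain G H where GH: "G face_of C" "H face_of D" "R = G \<times> H" using face_of_Times_decomp by blast
  then have ne: "G \<noteq> {}" "H \<noteq> {}" using R by auto
  then have "aff_dim G + aff_dim H = 2" using aff_dim_Times R GH by metis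
  then show thesis
    using two_dim_face[OF C GH(1) ne(1)] two_dim_face[OF D GH(2) ne(2)] that GH(3) by auto
qed

lemma ridge_of_product:
  "e facet_of C \<Longrightarrow> e' facet_of D \<Longrightarrow> e \<times> e' ridge_of C \<times> D"
  "c extreme_point_of C \<Longrightarrow> {c} \<times> D ridge_of C \<times> D"
  "d extreme_point_of D \<Longrightarrow> C \<times> {d} ridge_of C \<times> D"
proof -
  have rC: "C face_of C" and rD: "D face_of D"
    using C D face_of_refl polytope_imp_convex by blast+
  show "e \<times> e' ridge_of C \<times> D" if "e facet_of C" "e' facet_of D"
    using that aff_dim_product aff_dim_Times[of e e'] face_of_Times[of e C e' D] C D
    by (auto simp: ridge_of_def facet_of_def)
  show "{c} \<times> D ridge_of C \<times> D" if "c extreme_point_of C"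
    using that aff_dim_product aff_dim_Times[of "{c}" D] face_of_Times[of "{c}" C D D] rD D D_ne
    by (simp add: ridge_of_def face_of_singleton)
  show "C \<times> {d} ridge_of C \<times> D" if "d extreme_point_of D"
    using that aff_dim_product aff_dim_Times[of C "{d}"] face_of_Times[of C C "{d}" D] rC C C_ne
    by (simp add: ridge_of_def face_of_singleton)
qed

end

section \<open>The gauge of the inner polygon\<close>

context polygon_model
begin

text \<open>Extended by 0 to C itself, so that both factors of a face of a product are treated alike.\<close>

definition apex :: "'a set \<Rightarrow> complex" where "apex F = (if F = C then 0 else x F)"

definition normal :: "'a set \<Rightarrow> complex" where
  "normal F = (if F = C then 0 else if F facet_of C then a F else f (THE c. F = {c}))"

lemma C_nonempty: "C \<noteq> {}"
  using C by auto

lemma facet_ne_C: "e facet_of C \<Longrightarrow> e \<noteq> C"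
  by auto

lemma apex_C [simp]: "apex C = 0" and normal_C [simp]: "normal C = 0"
  by (simp_all add: apex_def normal_def)

lemma apex_facet: "e facet_of C \<Longrightarrow> apex e = x e"
  by (auto simp: apex_def)

lemma normal_facet: "e facet_of C \<Longrightarrow> normal e = a e"
  by (auto simp: normal_def)

lemma singleton_not_facet: "\<not> {c} facet_of C" "{c} \<noteq> C"
  using C by (auto simp: facet_of_def)

lemma normal_vertex: "normal {c} = f c"
  using singleton_not_facet[of c] by (simp add: normal_def)

lemma finite_facets: "finite {e. e facet_of C}"
  using C finite_polytope_facets by blast

lemma facets_nonempty: "{e. e facet_of C} \<noteq> {}"
  using polytope_facet_exists[of C] C by auto

definition gauge :: "complex \<Rightarrow> real" where
  "gauge y = Max ((\<lambda>e. a e \<bullet> y) ` {e. e facet_of C})"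

lemma gauge_ge: "e facet_of C \<Longrightarrow> a e \<bullet> y \<le> gauge y"
  unfolding gauge_def using finite_facets by (intro Max_ge) auto

lemma gauge_attained: "\<exists>e. e facet_of C \<and> a e \<bullet> y = gauge y"
proof -
  have "gauge y \<in> (\<lambda>e. a e \<bullet> y) ` {e. e facet_of C}"
    unfolding gauge_def using finite_facets facets_nonempty by (intro Max_in) auto
  then show ?thesis by force
qed

lemma gauge_nonneg: "gauge y \<ge> 0"
proof (rule ccontr)
  assume neg: "\<not> gauge y \<ge> 0"
  then have "a e \<bullet> y \<le> 0" if "e facet_of C" for e using gauge_ge[OF that, of y] by linarith
  then have "y = 0" using inner_cover[of 0 y] by auto
  then show False using gauge_attained[of y] neg by auto
qed

abbreviation "hull_p \<equiv> convex hull (p ` {c. c extreme_point_of C})"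

lemma gauge_scaled: "gauge y \<le> t \<Longrightarrow> \<exists>u\<in>hull_p. y = t *\<^sub>R u"
  using inner_cover[of t y] gauge_nonneg[of y] gauge_ge[of _ y] by force

lemma gauge_outer:
  assumes "gauge y \<ge> 1" "\<And>c. c extreme_point_of C \<Longrightarrow> f c \<bullet> y \<le> 1"
  shows "\<exists>e. e facet_of C \<and> gauge y \<le> 2 \<and> (\<exists>u\<in>hull_p. y = (gauge y - 1) *\<^sub>R x e + (2 - gauge y) *\<^sub>R u)"
  by (rule outer_cover[OF assms gauge_ge gauge_attained])

end

lemma lattice_isomorphic_image:
  assumes h: "inj h" and L: "lattice_isomorphic L M"
  shows "lattice_isomorphic ((`) h ` L) M"
proof -
  obtain g where g: "bij_betw g L M" "\<forall>x\<in>L. \<forall>y\<in>L. x \<subseteq> y \<longleftrightarrow> g x \<subseteq> g y"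
    using L unfolding lattice_isomorphic_def by blast
  have inv: "h -` (h ` X) = X" for X using h by (simp add: inj_vimage_image_eq)
  have "bij_betw (\<lambda>X. h -` X) ((`) h ` L) L"
    by (rule bij_betw_byWitness[where f' = "(`) h"]) (auto simp: inv)
  then have "bij_betw (g \<circ> (\<lambda>X. h -` X)) ((`) h ` L) M" using g(1) by (rule bij_betw_trans)
  moreover have "\<forall>x\<in>(`) h ` L. \<forall>y\<in>(`) h ` L. x \<subseteq> y \<longleftrightarrow> (g \<circ> (\<lambda>X. h -` X)) x \<subseteq> (g \<circ> (\<lambda>X. h -` X)) y"
    using g(2) h by (auto simp: inv inj_image_subset_iff)
  ultimately show ?thesis unfolding lattice_isomorphic_def by blast
qed

text \<open>In \<open>complex \<times> complex\<close> each factor carries its own nested polygons,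
  so every inequality is a sum of two planar ones.\<close>

theorem E_product_polytopal:
  fixes C :: "'a::euclidean_space set" and D :: "'b::euclidean_space set"
  assumes C: "polytope C" "aff_dim C = 2" "card {c. c extreme_point_of C} \<ge> 3"
    and D: "polytope D" "aff_dim D = 2" "card {d. d extreme_point_of D} \<ge> 3"
    and v: "new_vertices (C \<times> D) v"
  shows "\<exists>Q :: (complex \<times> complex) set. polytope Q \<and> aff_dim Q = 4 \<and>
           lattice_isomorphic (polytope_face_lattice Q) (E_face_lattice v (C \<times> D))"
proof -
  obtain p f x a where "polygon_model C p f x a" using polygon_model_exists[OF C] by blast
  then interpret M: polygon_model C p f x a .
  obtain p' f' x' a' where "polygon_model D p' f' x' a'" using polygon_model_exists[OF D] by blast
  then interpret N: polygon_model D p' f' x' a' .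
  let ?P = "C \<times> D"
  interpret stellar_sphere ?P v
    by unfold_locales
      (use C D v polytope_Times[of C D] aff_dim_product[OF C(1,2) D(1,2)] in auto)
  note facet_cases = facet_of_product_cases[OF C(1,2) D(1,2)]
  note ridge_cases = ridge_of_product_cases[OF C(1,2) D(1,2)]
  note facets = facet_of_product[OF C(1,2) D(1,2)]
  note ridges = ridge_of_product[OF C(1,2) D(1,2)]
  have proj: "fst ` (X \<times> Y) = X" "snd ` (X \<times> Y) = Y" if "X \<noteq> {}" "Y \<noteq> {}" for X :: "'a set" and Y :: "'b set"
    using that by auto
  have fne: "e \<noteq> {}" if "e facet_of C" for e using that by (simp add: facet_of_def)
  have fne': "e \<noteq> {}" if "e facet_of D" for e using that by (simp add: facet_of_def)
  define pt where "pt l = (case l of Inl w \<Rightarrow> (p (fst w), p' (snd w)) | Inr F \<Rightarrow> (M.apex (fst ` F), N.apex (snd ` F)))"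
    for l :: "('a \<times> 'b) + ('a \<times> 'b) set"
  define A where "A R = (M.normal (fst ` R), N.normal (snd ` R))" for R :: "('a \<times> 'b) set"
  \<comment> \<open>The bound is 2 for a product of two edges, where both factors contribute. A full
    factor has normal 0, and a single outer edge line has bound 1.\<close>
  define b where "b R = (if fst ` R = C \<or> snd ` R = D then 1 else 2 :: real)" for R :: "('a \<times> 'b) set"
  have pt_vertex: "pt (Inl (c, d)) = (p c, p' d)" for c d by (simp add: pt_def)
  have pt_left: "pt (Inr (e \<times> D)) = (x e, 0)" if "e facet_of C" for e
    using proj[OF fne[OF that] N.C_nonempty] M.apex_facet[OF that] by (simp add: pt_def)
  have pt_right: "pt (Inr (C \<times> e)) = (0, x' e)" if "e facet_of D" for e
    using proj[OF M.C_nonempty fne'[OF that]] N.apex_facet[OF that] by (simp add: pt_def)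
  have A_edges: "A (e \<times> e') = (a e, a' e')" "b (e \<times> e') = 2" if "e facet_of C" "e' facet_of D" for e e'
    using proj[OF fne[OF that(1)] fne'[OF that(2)]] M.normal_facet[OF that(1)] N.normal_facet[OF that(2)]
      M.facet_ne_C[OF that(1)] N.facet_ne_C[OF that(2)] by (simp_all add: A_def b_def)
  have A_left: "A ({c} \<times> D) = (f c, 0)" "b ({c} \<times> D) = 1" for c
    using proj[of "{c}" D] N.C_nonempty M.normal_vertex by (simp_all add: A_def b_def)
  have A_right: "A (C \<times> {d}) = (0, f' d)" "b (C \<times> {d}) = 1" for d
    using proj[of C "{d}"] M.C_nonempty N.normal_vertex by (simp_all add: A_def b_def)
  have label_cases: thesis
    if "l \<in> labels ?P"
      "\<And>c d. l = Inl (c, d) \<Longrightarrow> c extreme_point_of C \<Longrightarrow> d extreme_point_of D \<Longrightarrow> thesis"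
      "\<And>e. l = Inr (e \<times> D) \<Longrightarrow> e facet_of C \<Longrightarrow> thesis"
      "\<And>e. l = Inr (C \<times> e) \<Longrightarrow> e facet_of D \<Longrightarrow> thesis" for l thesis
    using that(1) unfolding labels_def
  proof (elim UnE imageE CollectE)
    fix w assume w: "l = Inl w" "w extreme_point_of ?P"
    then show thesis using that(2)[of "fst w" "snd w"] extreme_point_of_Times[of "fst w" "snd w" C D] by simp
  next
    fix F assume F: "l = Inr F" "F facet_of ?P"
    from F(2) show thesis
    proof (rule facet_cases)
      show "e facet_of C \<Longrightarrow> F = e \<times> D \<Longrightarrow> thesis" for e using that(3)[of e] F(1) by simp
      show "e facet_of D \<Longrightarrow> F = C \<times> e \<Longrightarrow> thesis" for e using that(4)[of e] F(1) by simp
    qed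
  qed
  have vertex_in: "Inl (c, d) \<in> ridge_labels ?P R \<longleftrightarrow> (c, d) \<in> R"
    if "R ridge_of ?P" "c extreme_point_of C" "d extreme_point_of D" for R c d
    using extreme_point_of_face[OF ridge_face[OF that(1)], of "(c, d)"] extreme_point_of_Times[of c d C D] that
    by (auto simp: ridge_labels_def)
  have facet_in: "Inr F \<in> ridge_labels ?P R \<longleftrightarrow> R \<subseteq> F" if "F facet_of ?P" for F R
    using that by (auto simp: ridge_labels_def)
  have vals: "A R \<bullet> pt l \<le> b R \<and> (A R \<bullet> pt l = b R \<longleftrightarrow> l \<in> ridge_labels ?P R)"
    if R: "R ridge_of ?P" and l: "l \<in> labels ?P" for R l
    using R
  proof (rule ridge_cases)
    fix e e' assume e: "e facet_of C" "e' facet_of D" "R = e \<times> e'"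
    note Ae = A_edges[OF e(1,2), folded e(3)]
    from l show ?thesis
    proof (rule label_cases)
      fix c d assume l: "l = Inl (c, d)" "c extreme_point_of C" "d extreme_point_of D"
      then show ?thesis
        using M.a_p[OF e(1) l(2)] N.a_p[OF e(2) l(3)] vertex_in[OF R l(2,3)] e(3)
        unfolding l(1) pt_vertex Ae by (auto simp: inner_Pair)
    next
      fix g assume l: "l = Inr (g \<times> D)" "g facet_of C"
      have "R \<subseteq> g \<times> D \<longleftrightarrow> e = g"
        using facet_subset_imp_eq[OF e(1) l(2)] fne'[OF e(2)] fne[OF e(1)] facet_of_imp_subset[OF e(2)]
        unfolding e(3) by (auto simp: times_subset_iff)
      then show ?thesis
        using M.a_x[OF e(1) l(2)] facet_in[OF facets(1)[OF l(2)]]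
        unfolding l(1) pt_left[OF l(2)] Ae by (auto simp: inner_Pair)
    next
      fix g assume l: "l = Inr (C \<times> g)" "g facet_of D"
      have "R \<subseteq> C \<times> g \<longleftrightarrow> e' = g"
        using facet_subset_imp_eq[OF e(2) l(2)] fne'[OF e(2)] fne[OF e(1)] facet_of_imp_subset[OF e(1)]
        unfolding e(3) by (auto simp: times_subset_iff)
      then show ?thesis
        using N.a_x[OF e(2) l(2)] facet_in[OF facets(2)[OF l(2)]]
        unfolding l(1) pt_right[OF l(2)] Ae by (auto simp: inner_Pair)
    qed
  next
    fix c assume c: "c extreme_point_of C" "R = {c} \<times> D"
    from l show ?thesis
    proof (rule label_cases)
      fix c' d assume l: "l = Inl (c', d)" "c' extreme_point_of C" "d extreme_point_of D"
      have "d \<in> D" using l(3) by (simp add: extreme_point_of_def)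
      then show ?thesis
        using M.f_p[OF c(1) l(2)] vertex_in[OF R l(2,3)]
        unfolding l(1) pt_vertex c(2) A_left by (auto simp: inner_Pair)
    next
      fix g assume l: "l = Inr (g \<times> D)" "g facet_of C"
      have "R \<subseteq> g \<times> D \<longleftrightarrow> c \<in> g" using N.C_nonempty unfolding c(2) by (auto simp: times_subset_iff)
      then show ?thesis
        using M.f_x[OF c(1) l(2)] facet_in[OF facets(1)[OF l(2)]]
        unfolding l(1) pt_left[OF l(2)] c(2) A_left by (auto simp: inner_Pair)
    next
      fix g assume l: "l = Inr (C \<times> g)" "g facet_of D"
      have "\<not> R \<subseteq> C \<times> g"
        using N.facet_ne_C[OF l(2)] facet_of_imp_subset[OF l(2)] N.C_nonempty
        unfolding c(2) by (auto simp: times_subset_iff)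
      then show ?thesis
        using facet_in[OF facets(2)[OF l(2)]]
        unfolding l(1) pt_right[OF l(2)] c(2) A_left by (auto simp: inner_Pair)
    qed
  next
    fix d assume d: "d extreme_point_of D" "R = C \<times> {d}"
    from l show ?thesis
    proof (rule label_cases)
      fix c d' assume l: "l = Inl (c, d')" "c extreme_point_of C" "d' extreme_point_of D"
      have "c \<in> C" using l(2) by (simp add: extreme_point_of_def)
      then show ?thesis
        using N.f_p[OF d(1) l(3)] vertex_in[OF R l(2,3)]
        unfolding l(1) pt_vertex d(2) A_right by (auto simp: inner_Pair)
    next
      fix g assume l: "l = Inr (g \<times> D)" "g facet_of C"
      have "\<not> R \<subseteq> g \<times> D"
        using M.facet_ne_C[OF l(2)] facet_of_imp_subset[OF l(2)] M.C_nonempty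
        unfolding d(2) by (auto simp: times_subset_iff)
      then show ?thesis
        using facet_in[OF facets(1)[OF l(2)]]
        unfolding l(1) pt_left[OF l(2)] d(2) A_right by (auto simp: inner_Pair)
    next
      fix g assume l: "l = Inr (C \<times> g)" "g facet_of D"
      have "R \<subseteq> C \<times> g \<longleftrightarrow> d \<in> g" using M.C_nonempty unfolding d(2) by (auto simp: times_subset_iff)
      then show ?thesis
        using N.f_x[OF d(1) l(2)] facet_in[OF facets(2)[OF l(2)]]
        unfolding l(1) pt_right[OF l(2)] d(2) A_right by (auto simp: inner_Pair)
    qed
  qed
  let ?Q = "convex hull (pt ` labels ?P)"
  have in_Q: "pt l \<in> ?Q" if "l \<in> labels ?P" for l using that by (intro hull_inc) auto
  have prod_in: "(u, u') \<in> ?Q" if u: "u \<in> M.hull_p" "u' \<in> N.hull_p" for u u'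
  proof -
    have "M.hull_p \<times> N.hull_p = convex hull (p ` {c. c extreme_point_of C} \<times> p' ` {d. d extreme_point_of D})"
      by (rule convex_hull_Times[symmetric])
    also have "\<dots> \<subseteq> ?Q"
    proof (rule hull_mono)
      show "p ` {c. c extreme_point_of C} \<times> p' ` {d. d extreme_point_of D} \<subseteq> pt ` labels ?P"
      proof clarify
        fix c d assume "c extreme_point_of C" "d extreme_point_of D"
        then have "Inl (c, d) \<in> labels ?P" by (simp add: labels_def extreme_point_of_Times)
        then show "(p c, p' d) \<in> pt ` labels ?P" using pt_vertex by (metis imageI)
      qed
    qed
    finally show ?thesis using u by blast
  qed
  have left_in: "(x e, 0) \<in> ?Q" if "e facet_of C" for e
    using in_Q[of "Inr (e \<times> D)"] facets(1)[OF that] pt_left[OF that] by (simp add: labels_def)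
  have right_in: "(0, x' e) \<in> ?Q" if "e facet_of D" for e
    using in_Q[of "Inr (C \<times> e)"] facets(2)[OF that] pt_right[OF that] by (simp add: labels_def)
  \<comment> \<open>The inequalities say that each coordinate lies in its outer polygon and that the
    two gauges have sum at most 2. With both gauges at most 1 the point lies in the product of the
    inner polygons.\<close>
  have cover: "{z. \<forall>R. R ridge_of ?P \<longrightarrow> A R \<bullet> z \<le> b R} \<subseteq> ?Q"
  proof
    fix z assume "z \<in> {z. \<forall>R. R ridge_of ?P \<longrightarrow> A R \<bullet> z \<le> b R}"
    then have z: "A R \<bullet> z \<le> b R" if "R ridge_of ?P" for R using that by blast
    obtain y y' where yz: "z = (y, y')" by (cases z)
    have fy: "f c \<bullet> y \<le> 1" if "c extreme_point_of C" for c
      using z[OF ridges(2)[OF that]] unfolding A_left yz by (simp add: inner_Pair)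
    have fy': "f' d \<bullet> y' \<le> 1" if "d extreme_point_of D" for d
      using z[OF ridges(3)[OF that]] unfolding A_right yz by (simp add: inner_Pair)
    obtain e where e: "e facet_of C" "a e \<bullet> y = M.gauge y" using M.gauge_attained by blast
    obtain e' where e': "e' facet_of D" "a' e' \<bullet> y' = N.gauge y'" using N.gauge_attained by blast
    have sum: "M.gauge y + N.gauge y' \<le> 2"
      using z[OF ridges(1)[OF e(1) e'(1)]] e(2) e'(2) unfolding A_edges[OF e(1) e'(1)] yz
      by (simp add: inner_Pair)
    consider "M.gauge y \<le> 1" "N.gauge y' \<le> 1" | "M.gauge y \<ge> 1" | "N.gauge y' \<ge> 1" by linarith
    then show "z \<in> ?Q"
    proof cases
      case 1
      then show ?thesis using M.gauge_scaled[OF 1(1)] N.gauge_scaled[OF 1(2)] prod_in yz by auto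
    next
      case 2
      \<comment> \<open>With gauge \<open>?s\<close> at least 1, \<open>y\<close> has weight
        \<open>?s - 1\<close> at an outer vertex, and the other coordinate has gauge at most
        \<open>2 - ?s\<close>. So both coordinates share the factor \<open>2 - ?s\<close>, and
        \<open>z\<close> lies between an apex and a point of the product of the inner
        polygons.\<close>
      let ?s = "M.gauge y"
      obtain g u where g: "g facet_of C" "?s \<le> 2" "u \<in> M.hull_p" "y = (?s - 1) *\<^sub>R x g + (2 - ?s) *\<^sub>R u"
        using M.gauge_outer[OF 2 fy] by blast
      have "N.gauge y' \<le> 2 - ?s" using sum by simp
      then obtain u' where u': "u' \<in> N.hull_p" "y' = (2 - ?s) *\<^sub>R u'" using N.gauge_scaled by blast
      have "z = (?s - 1) *\<^sub>R (x g, 0) + (2 - ?s) *\<^sub>R (u, u')" using yz g(4) u'(2) by simp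
      also have "\<dots> \<in> ?Q"
        by (rule convexD[OF convex_convex_hull left_in[OF g(1)] prod_in[OF g(3) u'(1)]]) (use 2 g(2) in auto)
      finally show ?thesis .
    next
      case 3
      let ?s = "N.gauge y'"
      obtain g u' where g: "g facet_of D" "?s \<le> 2" "u' \<in> N.hull_p" "y' = (?s - 1) *\<^sub>R x' g + (2 - ?s) *\<^sub>R u'"
        using N.gauge_outer[OF 3 fy'] by blast
      have "M.gauge y \<le> 2 - ?s" using sum by simp
      then obtain u where u: "u \<in> M.hull_p" "y = (2 - ?s) *\<^sub>R u" using M.gauge_scaled by blast
      have "z = (?s - 1) *\<^sub>R (0, x' g) + (2 - ?s) *\<^sub>R (u, u')" using yz g(4) u(2) by simp
      also have "\<dots> \<in> ?Q"
        by (rule convexD[OF convex_convex_hull right_in[OF g(1)] prod_in[OF u(1) g(3)]]) (use 3 g(2) in auto)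
      finally show ?thesis .
    qed
  qed
  have iso: "lattice_isomorphic (polytope_face_lattice ?Q) (E_face_lattice v ?P)"
    by (rule E_face_lattice_realization[OF _ _ cover]) (use vals in blast)+
  have poly: "polytope ?Q" by (intro polytope_convex_hull finite_imageI finite_labels)
  \<comment> \<open>All bounds are positive, so 0 satisfies the finitely many inequalities strictly
    and is an interior point.\<close>
  have "aff_dim ?Q = 4"
  proof -
    have fin: "finite {R. R ridge_of ?P}" using finite_labels(2) unfolding stellar_sphere.ridges_def[OF stellar_sphere_axioms] .
    let ?U = "\<Inter>R\<in>{R. R ridge_of ?P}. {z. A R \<bullet> z < b R}"
    have "open ?U" using fin by (intro open_INT ballI open_halfspace_lt) auto
    moreover have "0 \<in> ?U" by (auto simp: b_def)
    moreover have "?U \<subseteq> ?Q" using cover by fastforce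
    ultimately have "0 \<in> interior ?Q" by (meson interiorI)
    then have "interior ?Q \<noteq> {}" by blast
    then have "aff_dim ?Q = DIM(complex \<times> complex)" by (rule aff_dim_nonempty_interior)
    then show ?thesis by simp
  qed
  then show ?thesis using poly iso by blast
qed

theorem theorem3p1:
  fixes m n :: nat
    and C D :: "(real ^ 2) set"
    and v :: "((real ^ 2) \<times> (real ^ 2)) set \<Rightarrow> (real ^ 2) \<times> (real ^ 2)"
  assumes "m \<ge> 3" and "n \<ge> 3"
    and "convex_polygon m C" and "convex_polygon n D"
    and "new_vertices (C \<times> D) v"
  shows "\<exists>Q :: (real ^ 4) set. polytope Q \<and> aff_dim Q = 4 \<and>
           lattice_isomorphic (polytope_face_lattice Q) (E_face_lattice v (C \<times> D))"
proof -
  obtain Q :: "(complex \<times> complex) set" where Q: "polytope Q" "aff_dim Q = 4"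
    "lattice_isomorphic (polytope_face_lattice Q) (E_face_lattice v (C \<times> D))"
    using E_product_polytopal[of C D v] assms unfolding convex_polygon_def by auto
  \<comment> \<open>A linear isomorphism carries the polytope and its faces to the required
    space.\<close>
  have "DIM(complex \<times> complex) = DIM(real ^ 4)" by simp
  then obtain h :: "complex \<times> complex \<Rightarrow> real ^ 4" and k where h: "linear h" "\<And>z. k (h z) = z"
    using isomorphisms_UNIV_UNIV by metis
  have inj: "inj h" using h(2) by (metis injI)
  have "polytope_face_lattice (h ` Q) = (`) h ` polytope_face_lattice Q"
    unfolding polytope_face_lattice_def by (rule faces_of_linear_image[OF h(1) inj])
  then have "lattice_isomorphic (polytope_face_lattice (h ` Q)) (E_face_lattice v (C \<times> D))"
    using lattice_isomorphic_image[OF inj Q(3)] by simp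
  moreover have "polytope (h ` Q)" using polytope_linear_image[OF h(1) Q(1)] .
  moreover have "aff_dim (h ` Q) = 4" using aff_dim_injective_linear_image[OF h(1) inj] Q(2) by simp
  ultimately show ?thesis by blast
qed

end
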